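(* Let $\Pi_1$ and $\Pi_2$ be two distinct parallel planes in $\mathbb{R}^3$ and let $\Omega$ be the closed slab bounded by them. Let $\Sigma$ be a compact connected surface with boundary, of genus $0$, and let $\varphi:\Sigma\to\Omega\subseteq\mathbb{R}^3$ be a stable $H_2$-surface with free boundary in $\partial\Omega=\Pi_1\cup\Pi_2$ and with $H_2>0$. Then $\varphi(\Sigma)$ is a surface of revolution around an axis orthogonal to $\Pi_1$.
   Context: All objects are smooth. Surfaces $\varphi:\Sigma^2\to\mathbb{R}^3$ are oriented isometric immersions with unit normal vector field $\eta$. The Weingarten operator $A$ is given by $\langle A(X),Y\rangle=\langle-\overline\nabla_X\eta,Y\rangle$, where $\overline\nabla$ is the flat connection of $\mathbb{R}^3$. The principal curvatures $\kappa_1\ge\kappa_2$ are the eigenvalues of $A$, $H_1=\tfrac12(\kappa_1+\kappa_2)$ and $H_2=\kappa_1\kappa_2$. The surface is an $H_2$-surface if $H_2$ is constant on $\Sigma$. The first Newton transformation is $P_1=2H_1I-A$; when $H_2>0$, the orientation $\eta$ is chosen so that $P_1$ is positive definite at every point. Free boundary: $\varphi:\Sigma\to\Omega$ has free boundary in $\partial\Omega$ if $\varphi(\Sigma)\subseteq\Omega$, $\varphi(\partial\Sigma)\subseteq\partial\Omega$, and the outward unit conormal $\nu$ of $\partial\Sigma$ in $\Sigma$ equals the outward unit normal of $\partial\Omega$ along $\partial\Sigma$ (orthogonal intersection). Stability: since the ambient space is flat and $\partial\Omega$ is totally geodesic, an $H_2$-surface with free boundary in $\partial\Omega$ and with $P_1$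 positive definite is stable (also called $1$-stable) if $$\int_\Sigma\Big(\langle P_1\nabla f,\nabla f\rangle-2H_1H_2f^2\Big)\,d\mu_\Sigma\ \ge 0$$ for every $f$ in the Sobolev space $H^1(\Sigma)$ with $\int_\Sigma f\,d\mu_\Sigma=0$. *)

theory Defs
  imports "HOL-Analysis.Analysis"
begin

section \<open>Smooth maps\<close>

primrec Ck_on :: "nat \<Rightarrow> ('a::real_normed_vector \<Rightarrow> 'b::real_normed_vector) \<Rightarrow> 'a set \<Rightarrow> bool" where
  "Ck_on 0 f V \<longleftrightarrow> continuous_on V f"
| "Ck_on (Suc k) f V \<longleftrightarrow> (\<forall>x\<in>V. f differentiable (at x)) \<and>
     (\<forall>v. Ck_on k (\<lambda>x. frechet_derivative f (at x) v) V)"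

text \<open>On a set that need not be open, such as a relatively open subset of a half-plane,
  smoothness means that the map has local smooth extensions.\<close>

definition smooth_on :: "'a::real_normed_vector set \<Rightarrow> ('a \<Rightarrow> 'b::real_normed_vector) \<Rightarrow> bool" where
  "smooth_on D f \<longleftrightarrow> (\<forall>x\<in>D. \<exists>V F. open V \<and> x \<in> V \<and> (\<forall>k. Ck_on k F V) \<and> (\<forall>y\<in>V \<inter> D. F y = f y))"


section \<open>Compact surfaces with boundary\<close>

text \<open>A chart is a pair of a domain and a coordinate map into the closed upper half-plane.\<close>

type_synonym 'a chart = "'a set \<times> ('a \<Rightarrow> real \<times> real)"

definition half_plane :: "(real \<times> real) set" where
  "half_plane = {x. 0 \<le> snd x}"

definition local_rep :: "'a chart \<Rightarrow> ('a \<Rightarrow> 'b) \<Rightarrow> real \<times> real \<Rightarrow> 'b" where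
  "local_rep c F = F \<circ> inv_into (fst c) (snd c)"

definition surface_chart :: "'a topology \<Rightarrow> 'a chart \<Rightarrow> bool" where
  "surface_chart X c \<longleftrightarrow> openin X (fst c) \<and>
     openin (top_of_set half_plane) (snd c ` fst c) \<and>
     homeomorphic_map (subtopology X (fst c)) (top_of_set (snd c ` fst c)) (snd c)"

definition smooth_atlas :: "'a topology \<Rightarrow> 'a chart set \<Rightarrow> bool" where
  "smooth_atlas X \<A> \<longleftrightarrow> (\<forall>c\<in>\<A>. surface_chart X c) \<and> (\<Union>c\<in>\<A>. fst c) = topspace X \<and>
     (\<forall>c\<in>\<A>. \<forall>d\<in>\<A>. smooth_on (snd c ` (fst c \<inter> fst d)) (local_rep c (snd d)))"

text \<open>Second countability is automatic for a compact space covered by such charts. The boundary,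
  defined below, may be empty.\<close>

definition compact_connected_surface :: "'a topology \<Rightarrow> 'a chart set \<Rightarrow> bool" where
  "compact_connected_surface X \<A> \<longleftrightarrow> topspace X \<noteq> {} \<and> Hausdorff_space X \<and> compact_space X \<and>
     connected_space X \<and> smooth_atlas X \<A>"

definition surface_boundary :: "'a chart set \<Rightarrow> 'a set" where
  "surface_boundary \<A> = {p. \<exists>c\<in>\<A>. p \<in> fst c \<and> snd (snd c p) = 0}"

text \<open>The genus of an orientable connected surface is the largest number of pairwise disjoint simple
  closed curves in its interior that together do not separate it. (Curves are kept off the boundary
  because removing a boundary circle never separates.)\<close>

definition simple_closed_curve :: "'a topology \<Rightarrow> 'a set \<Rightarrow> bool" where
  "simple_closed_curve X C \<longleftrightarrow> C \<subseteq> topspace X \<and>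
     subtopology X C homeomorphic_space top_of_set (sphere (0::real \<times> real) 1)"

definition surface_genus :: "'a topology \<Rightarrow> 'a chart set \<Rightarrow> enat" where
  "surface_genus X \<A> = Sup {enat (card \<C>) | \<C>. finite \<C> \<and> disjoint \<C> \<and>
     (\<forall>C\<in>\<C>. simple_closed_curve X C \<and> C \<inter> surface_boundary \<A> = {}) \<and>
     connectedin X (topspace X - \<Union>\<C>)}"

definition smooth_map :: "'a chart set \<Rightarrow> ('a \<Rightarrow> 'b::real_normed_vector) \<Rightarrow> bool" where
  "smooth_map \<A> F \<longleftrightarrow> (\<forall>c\<in>\<A>. smooth_on (snd c ` fst c) (local_rep c F))"

text \<open>The derivative of a map at a surface point, read in a chart. The derivative is taken within
  the chart image, where it is unique also at boundary points.\<close>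

definition differential ::
    "'a chart \<Rightarrow> ('a \<Rightarrow> 'b::real_normed_vector) \<Rightarrow> 'a \<Rightarrow> real \<times> real \<Rightarrow> 'b" where
  "differential c F p = frechet_derivative (local_rep c F) (at (snd c p) within snd c ` fst c)"


section \<open>Oriented immersed surfaces in Euclidean space\<close>

text \<open>The surface carries the metric induced by \<open>\<phi>\<close>. Its tangent space at \<open>p\<close> is identified
  isometrically with its image under the differential of \<open>\<phi>\<close>, a plane in \<open>real^3\<close>.\<close>

definition tangent_space :: "'a chart set \<Rightarrow> ('a \<Rightarrow> real^3) \<Rightarrow> 'a \<Rightarrow> (real^3) set" where
  "tangent_space \<A> \<phi> p = {Y. \<exists>c\<in>\<A>. p \<in> fst c \<and> Y \<in> range (differential c \<phi> p)}"

definition immersion :: "'a chart set \<Rightarrow> ('a \<Rightarrow> real^3) \<Rightarrow> bool" where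
  "immersion \<A> \<phi> \<longleftrightarrow> smooth_map \<A> \<phi> \<and> (\<forall>c\<in>\<A>. \<forall>p\<in>fst c. inj (differential c \<phi> p))"

definition unit_normal_field :: "'a topology \<Rightarrow> 'a chart set \<Rightarrow> ('a \<Rightarrow> real^3) \<Rightarrow> ('a \<Rightarrow> real^3) \<Rightarrow> bool" where
  "unit_normal_field X \<A> \<phi> \<eta> \<longleftrightarrow> smooth_map \<A> \<eta> \<and>
     (\<forall>p\<in>topspace X. norm (\<eta> p) = 1 \<and> (\<forall>Y\<in>tangent_space \<A> \<phi> p. \<eta> p \<bullet> Y = 0))"

text \<open>The derivative of \<open>F\<close> at \<open>p\<close> along a tangent vector \<open>Y\<close>. For vector fields of \<open>real^3\<close> along
  the surface this is the flat connection of the ambient space.\<close>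

definition deriv_along ::
    "'a chart set \<Rightarrow> ('a \<Rightarrow> real^3) \<Rightarrow> ('a \<Rightarrow> 'b::real_normed_vector) \<Rightarrow> 'a \<Rightarrow> real^3 \<Rightarrow> 'b" where
  "deriv_along \<A> \<phi> F p Y = (THE z. \<exists>c\<in>\<A>. p \<in> fst c \<and>
     (\<exists>v. differential c \<phi> p v = Y \<and> differential c F p v = z))"

definition gradient :: "'a chart set \<Rightarrow> ('a \<Rightarrow> real^3) \<Rightarrow> ('a \<Rightarrow> real) \<Rightarrow> 'a \<Rightarrow> real^3" where
  "gradient \<A> \<phi> u p = (THE Z. Z \<in> tangent_space \<A> \<phi> p \<and>
     (\<forall>Y\<in>tangent_space \<A> \<phi> p. Z \<bullet> Y = deriv_along \<A> \<phi> u p Y))"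

definition weingarten ::
    "'a chart set \<Rightarrow> ('a \<Rightarrow> real^3) \<Rightarrow> ('a \<Rightarrow> real^3) \<Rightarrow> 'a \<Rightarrow> real^3 \<Rightarrow> real^3" where
  "weingarten \<A> \<phi> \<eta> p Y = (THE Z. Z \<in> tangent_space \<A> \<phi> p \<and>
     (\<forall>W\<in>tangent_space \<A> \<phi> p. Z \<bullet> W = (- deriv_along \<A> \<phi> \<eta> p Y) \<bullet> W))"

definition principal_curvatures ::
    "'a chart set \<Rightarrow> ('a \<Rightarrow> real^3) \<Rightarrow> ('a \<Rightarrow> real^3) \<Rightarrow> 'a \<Rightarrow> real set" where
  "principal_curvatures \<A> \<phi> \<eta> p =
     {k. \<exists>Y\<in>tangent_space \<A> \<phi> p. Y \<noteq> 0 \<and> weingarten \<A> \<phi> \<eta> p Y = k *\<^sub>R Y}"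

text \<open>At an umbilic point there is a single eigenvalue, and then \<open>kappa1 = kappa2\<close>.\<close>

definition kappa1 :: "'a chart set \<Rightarrow> ('a \<Rightarrow> real^3) \<Rightarrow> ('a \<Rightarrow> real^3) \<Rightarrow> 'a \<Rightarrow> real" where
  "kappa1 \<A> \<phi> \<eta> p = Max (principal_curvatures \<A> \<phi> \<eta> p)"

definition kappa2 :: "'a chart set \<Rightarrow> ('a \<Rightarrow> real^3) \<Rightarrow> ('a \<Rightarrow> real^3) \<Rightarrow> 'a \<Rightarrow> real" where
  "kappa2 \<A> \<phi> \<eta> p = Min (principal_curvatures \<A> \<phi> \<eta> p)"

definition H1 :: "'a chart set \<Rightarrow> ('a \<Rightarrow> real^3) \<Rightarrow> ('a \<Rightarrow> real^3) \<Rightarrow> 'a \<Rightarrow> real" where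
  "H1 \<A> \<phi> \<eta> p = (kappa1 \<A> \<phi> \<eta> p + kappa2 \<A> \<phi> \<eta> p) / 2"

definition H2 :: "'a chart set \<Rightarrow> ('a \<Rightarrow> real^3) \<Rightarrow> ('a \<Rightarrow> real^3) \<Rightarrow> 'a \<Rightarrow> real" where
  "H2 \<A> \<phi> \<eta> p = kappa1 \<A> \<phi> \<eta> p * kappa2 \<A> \<phi> \<eta> p"

definition P1 :: "'a chart set \<Rightarrow> ('a \<Rightarrow> real^3) \<Rightarrow> ('a \<Rightarrow> real^3) \<Rightarrow> 'a \<Rightarrow> real^3 \<Rightarrow> real^3" where
  "P1 \<A> \<phi> \<eta> p Y = (2 * H1 \<A> \<phi> \<eta> p) *\<^sub>R Y - weingarten \<A> \<phi> \<eta> p Y"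

definition P1_positive_definite ::
    "'a topology \<Rightarrow> 'a chart set \<Rightarrow> ('a \<Rightarrow> real^3) \<Rightarrow> ('a \<Rightarrow> real^3) \<Rightarrow> bool" where
  "P1_positive_definite X \<A> \<phi> \<eta> \<longleftrightarrow> (\<forall>p\<in>topspace X. \<forall>Y\<in>tangent_space \<A> \<phi> p.
     Y \<noteq> 0 \<longrightarrow> P1 \<A> \<phi> \<eta> p Y \<bullet> Y > 0)"


section \<open>Area measure, Sobolev space and stability\<close>

text \<open>The area element \<open>sqrt (det g)\<close> of the induced metric in a chart.\<close>

definition area_element :: "'a chart \<Rightarrow> ('a \<Rightarrow> real^3) \<Rightarrow> 'a \<Rightarrow> real" where
  "area_element c \<phi> p = (let Y = differential c \<phi> p (1, 0); Z = differential c \<phi> p (0, 1)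
     in sqrt ((Y \<bullet> Y) * (Z \<bullet> Z) - (Y \<bullet> Z)\<^sup>2))"

text \<open>The Riemannian measure is the unique Borel measure given by \<open>sqrt (det g) dx\<close> in every chart.\<close>

definition area_measure :: "'a topology \<Rightarrow> 'a chart set \<Rightarrow> ('a \<Rightarrow> real^3) \<Rightarrow> 'a measure" where
  "area_measure X \<A> \<phi> = (THE M. space M = topspace X \<and>
     sets M = sigma_sets (topspace X) {U. openin X U} \<and>
     (\<forall>c\<in>\<A>. \<forall>B\<in>sets M. B \<subseteq> fst c \<longrightarrow> emeasure M B =
        (\<integral>\<^sup>+ x \<in> snd c ` B. ennreal (area_element c \<phi> (inv_into (fst c) (snd c) x)) \<partial>lborel)))"

text \<open>The Sobolev space \<open>H\<^sup>1\<close> is the completion of the smooth functions (smooth up to the boundary)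
  for the norm \<open>\<integral> u\<^sup>2 + |\<nabla>u|\<^sup>2\<close>. Here \<open>f\<close> belongs to it and \<open>G\<close> is its weak gradient.\<close>

definition sobolev_H1 ::
    "'a topology \<Rightarrow> 'a chart set \<Rightarrow> ('a \<Rightarrow> real^3) \<Rightarrow> ('a \<Rightarrow> real) \<Rightarrow> ('a \<Rightarrow> real^3) \<Rightarrow> bool" where
  "sobolev_H1 X \<A> \<phi> f G \<longleftrightarrow>
     f \<in> borel_measurable (area_measure X \<A> \<phi>) \<and> G \<in> borel_measurable (area_measure X \<A> \<phi>) \<and>
     (\<forall>p\<in>topspace X. G p \<in> tangent_space \<A> \<phi> p) \<and>
     (\<exists>u. (\<forall>k::nat. smooth_map \<A> (u k)) \<and>
       (\<lambda>k. \<integral>\<^sup>+ p. ennreal ((f p - u k p)\<^sup>2) \<partial>area_measure X \<A> \<phi>) \<longlonglongrightarrow> 0 \<and>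
       (\<lambda>k. \<integral>\<^sup>+ p. ennreal ((norm (G p - gradient \<A> \<phi> (u k) p))\<^sup>2) \<partial>area_measure X \<A> \<phi>) \<longlonglongrightarrow> 0)"

definition one_stable ::
    "'a topology \<Rightarrow> 'a chart set \<Rightarrow> ('a \<Rightarrow> real^3) \<Rightarrow> ('a \<Rightarrow> real^3) \<Rightarrow> bool" where
  "one_stable X \<A> \<phi> \<eta> \<longleftrightarrow> (\<forall>f G. sobolev_H1 X \<A> \<phi> f G \<longrightarrow>
     (\<integral>p. f p \<partial>area_measure X \<A> \<phi>) = 0 \<longrightarrow>
     (\<integral>p. P1 \<A> \<phi> \<eta> p (G p) \<bullet> G p - 2 * H1 \<A> \<phi> \<eta> p * H2 \<A> \<phi> \<eta> p * (f p)\<^sup>2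
        \<partial>area_measure X \<A> \<phi>) \<ge> 0)"


section \<open>Free boundary\<close>

text \<open>In a half-plane chart, \<open>(1, 0)\<close> is tangent to the boundary and \<open>(0, 1)\<close> points inwards.\<close>

definition outward_conormal :: "'a chart set \<Rightarrow> ('a \<Rightarrow> real^3) \<Rightarrow> 'a \<Rightarrow> real^3" where
  "outward_conormal \<A> \<phi> p = (THE \<nu>. \<nu> \<in> tangent_space \<A> \<phi> p \<and> norm \<nu> = 1 \<and>
     (\<exists>c\<in>\<A>. p \<in> fst c \<and> \<nu> \<bullet> differential c \<phi> p (1, 0) = 0 \<and> \<nu> \<bullet> differential c \<phi> p (0, 1) < 0))"

definition plane :: "real^3 \<Rightarrow> real \<Rightarrow> (real^3) set" where
  "plane n a = {x. n \<bullet> x = a}"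

definition slab :: "real^3 \<Rightarrow> real \<Rightarrow> real \<Rightarrow> (real^3) set" where
  "slab n a b = {x. a \<le> n \<bullet> x \<and> n \<bullet> x \<le> b}"

text \<open>The outward unit normal of \<open>slab n a b\<close> (with \<open>norm n = 1\<close> and \<open>a < b\<close>) on its boundary.\<close>

definition slab_normal :: "real^3 \<Rightarrow> real \<Rightarrow> real^3 \<Rightarrow> real^3" where
  "slab_normal n a x = (if x \<in> plane n a then - n else n)"

definition free_boundary_in_slab ::
    "'a topology \<Rightarrow> 'a chart set \<Rightarrow> ('a \<Rightarrow> real^3) \<Rightarrow> real^3 \<Rightarrow> real \<Rightarrow> real \<Rightarrow> bool" where
  "free_boundary_in_slab X \<A> \<phi> n a b \<longleftrightarrow> \<phi> ` topspace X \<subseteq> slab n a b \<and>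
     \<phi> ` surface_boundary \<A> \<subseteq> plane n a \<union> plane n b \<and>
     (\<forall>p\<in>surface_boundary \<A>. outward_conormal \<A> \<phi> p = slab_normal n a (\<phi> p))"


section \<open>Surfaces of revolution\<close>

text \<open>The set swept out by rotating a smooth regular curve \<open>\<gamma>\<close> about the line through \<open>q\<close> with unit
  direction \<open>n\<close>. The curve lies in a half-plane bounded by the axis, with coordinates (distance to the
  axis, height along the axis), and meets the axis at most at its end points.\<close>

definition surface_of_revolution :: "real^3 \<Rightarrow> real^3 \<Rightarrow> (real^3) set \<Rightarrow> bool" where
  "surface_of_revolution q n S \<longleftrightarrow> (\<exists>u (\<gamma>::real \<Rightarrow> real \<times> real) \<alpha> \<beta>.
     norm u = 1 \<and> u \<bullet> n = 0 \<and> \<alpha> < \<beta> \<and> smooth_on {\<alpha>..\<beta>} \<gamma> \<and>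
     (\<forall>t\<in>{\<alpha>..\<beta>}. vector_derivative \<gamma> (at t within {\<alpha>..\<beta>}) \<noteq> 0 \<and> fst (\<gamma> t) \<ge> 0) \<and>
     (\<forall>t\<in>{\<alpha><..<\<beta>}. fst (\<gamma> t) > 0) \<and>
     S = {q + fst (\<gamma> t) *\<^sub>R (cos \<theta> *\<^sub>R u + sin \<theta> *\<^sub>R cross3 n u) + snd (\<gamma> t) *\<^sub>R n
            | t \<theta>. t \<in> {\<alpha>..\<beta>}})"

end

theory Submission
  imports Defs
begin

text \<open>The surface is shown to be a round sphere, or a round hemisphere whose boundary circle lies in one of
the two planes. In both cases the line through the centre in the direction \<open>n\<close> is an axis of
revolution. The argument is Liebmann's theorem, in Hilbert's form, carried through up to the free
boundary.

Since \<open>H2 = h\<close> is a positive constant, \<open>H1\<^sup>2 - h = ((kappa1 - kappa2) / 2)\<^sup>2\<close>, so the positive function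
\<open>H1\<close> is at least \<open>sqrt h\<close>, with equality exactly at the umbilic points. By compactness \<open>H1\<close> has a
maximum; if the maximum point is umbilic, then every point is. Near the maximum point write the
surface as a graph \<open>z(x, y)\<close> over its tangent plane, with \<open>x\<close> and \<open>y\<close> along principal directions with
curvatures \<open>k\<close> and \<open>l\<close>. The equation \<open>H2 = h\<close> and the maximality of \<open>H1\<close> are polynomial relations
between the derivatives of \<open>z\<close>. If \<open>k \<noteq> l\<close>, their first derivatives make all third derivatives of \<open>z\<close>
vanish at the point, and their second derivatives in the directions \<open>x\<close> and \<open>y\<close> then combine to
\<open>k * l * (k - l)\<^sup>2 \<le> 0\<close>, a contradiction (\<open>hilbert_inequality\<close>, \<open>umbilic_at_max_mean_curvature\<close>).

At a boundary point let \<open>y\<close> be the inward conormal direction, which is \<open>n\<close> or \<open>- n\<close>. Orthogonal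
intersection says that \<open>z\<^sub>y = 0\<close> along the boundary. Hence \<open>z\<^sub>x\<^sub>y\<close> and \<open>z\<^sub>x\<^sub>x\<^sub>y\<close> vanish there, and the
\<open>y\<close>-derivative of the curvature equation gives \<open>z\<^sub>y\<^sub>y\<^sub>y = 0\<close>. So \<open>H1\<close> has zero normal derivative, as if
the surface had been reflected in the plane, and the one-sided second derivative test is enough
(\<open>max_mean_curvature_umbilic\<close>).

The coordinates \<open>x\<close> and \<open>y\<close> are used only through their partial derivative operators. These are
written down directly in the given chart as the fields dual to \<open>dx\<close> and \<open>dy\<close>; they commute, so
they obey the rules for partial derivatives (\<open>coordinate_frame_commute\<close>).

A totally umbilic surface has \<open>\<eta> + sqrt h * \<phi>\<close> constant and so lies on a sphere (\<open>umbilic_on_sphere\<close>).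
Along the boundary \<open>\<eta>\<close> is orthogonal to \<open>n\<close>, so the centre lies in the plane that carries the boundary,
and one plane carries all of it. Interior points are mapped openly into the sphere, so a connectedness
argument identifies the image as the sphere or the closed hemisphere on the inner side
(\<open>spherical_image\<close>).\<close>

section \<open>Calculus of smooth maps on open sets\<close>

abbreviation dir_deriv :: "'a::real_normed_vector \<Rightarrow> ('a \<Rightarrow> 'b::real_normed_vector) \<Rightarrow> 'a \<Rightarrow> 'b" where
  "dir_deriv v f \<equiv> (\<lambda>x. frechet_derivative f (at x) v)"

lemma Ck_on_cong:
  assumes "open V" "\<And>x. x \<in> V \<Longrightarrow> f x = g x"
  shows "Ck_on k f V \<longleftrightarrow> Ck_on k g V"
  using assms(2)
proof (induction k arbitrary: f g)
  case 0
  then show ?case by (auto intro: continuous_on_cong)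
next
  case (Suc k)
  have *: "f differentiable (at x) \<Longrightarrow> g differentiable (at x)"
    if "\<And>x. x \<in> V \<Longrightarrow> f x = g x" "x \<in> V" for x and f g :: "'a \<Rightarrow> 'b"
    using that assms(1) by (meson differentiable_def has_derivative_transform_within_open)
  have diff: "f differentiable (at x) \<longleftrightarrow> g differentiable (at x)" if "x \<in> V" for x
    using *[of f g] *[of g f] that Suc.prems by auto
  show ?case
  proof (cases "\<forall>x\<in>V. f differentiable (at x)")
    case True
    have eq: "frechet_derivative f (at x) v = frechet_derivative g (at x) v" if "x \<in> V" for x v
      using frechet_derivative_transform_within_open[of f x V g] True that assms(1) Suc.prems by auto
    show ?thesis
      using Suc.IH[OF eq] diff by auto
  qed (use diff in auto)
qed

lemma Ck_on_SucD:
  assumes "Ck_on (Suc k) f V"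
  shows "Ck_on k f V"
  using assms
proof (induction k arbitrary: f)
  case 0
  then show ?case
    using differentiable_at_imp_differentiable_on[of V f] differentiable_imp_continuous_on by auto
qed auto

lemma Ck_on_const: "Ck_on k (\<lambda>x. c) V"
  by (induction k arbitrary: c) auto

lemma Ck_on_add:
  assumes "open V" "Ck_on k f V" "Ck_on k g V"
  shows "Ck_on k (\<lambda>x. f x + g x) V"
  using assms(2,3)
proof (induction k arbitrary: f g)
  case 0
  then show ?case by (auto intro: continuous_intros)
next
  case (Suc k)
  have eq: "frechet_derivative (\<lambda>x. f x + g x) (at x) v
      = frechet_derivative f (at x) v + frechet_derivative g (at x) v" if "x \<in> V" for x v
  proof -
    have "((\<lambda>x. f x + g x) has_derivative (\<lambda>v. frechet_derivative f (at x) v + frechet_derivative g (at x) v)) (at x)"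
      using Suc.prems that by (intro has_derivative_add) (auto simp: frechet_derivative_works)
    from fun_cong[OF frechet_derivative_at[OF this], of v] show ?thesis by simp
  qed
  have "Ck_on k (\<lambda>x. frechet_derivative (\<lambda>x. f x + g x) (at x) v) V" for v
    using Suc by (subst Ck_on_cong[OF assms(1) eq]) auto
  then show ?case using Suc.prems by auto
qed

text \<open>The product rule expresses the derivative by products of maps of class one less than \<open>f\<close> and \<open>g\<close>,
so the induction on \<open>k\<close> needs the inclusion \<open>Ck_on_SucD\<close> of the differentiability classes.\<close>

lemma Ck_on_mult:
  fixes f g :: "'a::real_normed_vector \<Rightarrow> real"
  assumes "open V" "Ck_on k f V" "Ck_on k g V"
  shows "Ck_on k (\<lambda>x. f x * g x) V"
  using assms(2,3)
proof (induction k arbitrary: f g)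
  case 0
  then show ?case by (auto intro: continuous_intros)
next
  case (Suc k)
  have eq: "frechet_derivative (\<lambda>x. f x * g x) (at x) v
      = f x * frechet_derivative g (at x) v + frechet_derivative f (at x) v * g x" if "x \<in> V" for x v
  proof -
    have "((\<lambda>x. f x * g x) has_derivative (\<lambda>v. f x * frechet_derivative g (at x) v + frechet_derivative f (at x) v * g x)) (at x)"
      using Suc.prems that by (intro has_derivative_mult) (auto simp: frechet_derivative_works)
    from fun_cong[OF frechet_derivative_at[OF this], of v] show ?thesis by simp
  qed
  have "Ck_on k f V" "Ck_on k g V" "Ck_on k (dir_deriv v f) V" "Ck_on k (dir_deriv v g) V" for v
    using Suc.prems Ck_on_SucD[OF Suc.prems(1)] Ck_on_SucD[OF Suc.prems(2)] by auto
  then have "Ck_on k (\<lambda>x. f x * dir_deriv v g x + dir_deriv v f x * g x) V" for v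
    by (intro Ck_on_add[OF assms(1)] Suc.IH)
  then have "Ck_on k (dir_deriv v (\<lambda>x. f x * g x)) V" for v
    by (subst Ck_on_cong[OF assms(1) eq])
  moreover have "\<forall>x\<in>V. (\<lambda>x. f x * g x) differentiable (at x)"
    using Suc.prems by (simp add: differentiable_mult)
  ultimately show ?case by simp
qed

lemma Ck_on_inverse:
  fixes f :: "'a::real_normed_vector \<Rightarrow> real"
  assumes "open V" "Ck_on k f V" "\<And>x. x \<in> V \<Longrightarrow> f x \<noteq> 0"
  shows "Ck_on k (\<lambda>x. inverse (f x)) V"
  using assms(2,3)
proof (induction k)
  case 0
  then show ?case by (auto intro: continuous_intros)
next
  case (Suc k)
  have eq: "frechet_derivative (\<lambda>x. inverse (f x)) (at x) v
      = (-1) * (frechet_derivative f (at x) v * (inverse (f x) * inverse (f x)))" if "x \<in> V" for x v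
  proof -
    have "((\<lambda>x. inverse (f x)) has_derivative (\<lambda>v. - (inverse (f x) * frechet_derivative f (at x) v * inverse (f x)))) (at x)"
      using Suc.prems that by (intro Deriv.has_derivative_inverse) (auto simp: frechet_derivative_works)
    from fun_cong[OF frechet_derivative_at[OF this], of v] show ?thesis by (simp add: algebra_simps)
  qed
  have "Ck_on k (\<lambda>x. inverse (f x)) V" using Suc Ck_on_SucD[OF Suc.prems(1)] by blast
  moreover have "Ck_on k (dir_deriv v f) V" for v using Suc.prems by simp
  ultimately have "Ck_on k (\<lambda>x. (-1) * (dir_deriv v f x * (inverse (f x) * inverse (f x)))) V" for v
    by (intro Ck_on_mult[OF assms(1)] Ck_on_const)
  then have "Ck_on k (dir_deriv v (\<lambda>x. inverse (f x))) V" for v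
    by (subst Ck_on_cong[OF assms(1) eq])
  then show ?case using Suc.prems by auto
qed

lemma Ck_on_bounded_linear:
  assumes "open V" "Ck_on k f V" "bounded_linear L"
  shows "Ck_on k (\<lambda>x. L (f x)) V"
  using assms(2)
proof (induction k arbitrary: f)
  case 0
  then show ?case using assms(3) by (auto intro: bounded_linear.continuous_on)
next
  case (Suc k)
  have eq: "frechet_derivative (\<lambda>x. L (f x)) (at x) v = L (frechet_derivative f (at x) v)"
    if "x \<in> V" for x v
  proof -
    have "((\<lambda>x. L (f x)) has_derivative (\<lambda>v. L (frechet_derivative f (at x) v))) (at x)"
      using Suc.prems that by (intro bounded_linear.has_derivative[OF assms(3)]) (auto simp: frechet_derivative_works)
    from fun_cong[OF frechet_derivative_at[OF this], of v] show ?thesis by simp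
  qed
  have "Ck_on k (\<lambda>x. frechet_derivative (\<lambda>x. L (f x)) (at x) v) V" for v
    using Suc by (subst Ck_on_cong[OF assms(1) eq]) auto
  moreover have "\<forall>x\<in>V. (\<lambda>x. L (f x)) differentiable (at x)"
  proof
    fix x assume "x \<in> V"
    then have "f differentiable (at x)" using Suc.prems by simp
    then obtain f' where "(f has_derivative f') (at x)" by (auto simp: differentiable_def)
    from bounded_linear.has_derivative[OF assms(3) this]
    show "(\<lambda>x. L (f x)) differentiable (at x)" by (rule differentiableI)
  qed
  ultimately show ?case by auto
qed

text \<open>The local extensions in the definition of \<open>smooth_on\<close> are of this kind.\<close>

definition smooth_in :: "'a::real_normed_vector set \<Rightarrow> ('a \<Rightarrow> 'b::real_normed_vector) \<Rightarrow> bool" where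
  "smooth_in V f \<longleftrightarrow> open V \<and> (\<forall>k. Ck_on k f V)"

lemma smooth_in_open: "smooth_in V f \<Longrightarrow> open V"
  by (simp add: smooth_in_def)

lemma smooth_in_has_derivative:
  assumes "smooth_in V f" "x \<in> V"
  shows "(f has_derivative frechet_derivative f (at x)) (at x)"
proof -
  have "Ck_on (Suc 0) f V" using assms by (simp only: smooth_in_def)
  then show ?thesis using assms by (simp add: frechet_derivative_works)
qed

lemma smooth_in_isCont: "smooth_in V f \<Longrightarrow> x \<in> V \<Longrightarrow> isCont f x"
  using smooth_in_has_derivative has_derivative_continuous by blast

lemma smooth_in_continuous_on: "smooth_in V f \<Longrightarrow> continuous_on V f"
  by (simp add: continuous_at_imp_continuous_on smooth_in_isCont)

lemma smooth_in_dir_deriv: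
  assumes "smooth_in V f" shows "smooth_in V (dir_deriv v f)"
proof -
  have "Ck_on (Suc k) f V" for k using assms by (simp only: smooth_in_def)
  then show ?thesis using assms by (simp add: smooth_in_def)
qed

lemma smooth_in_cong: "smooth_in V f \<Longrightarrow> (\<And>x. x \<in> V \<Longrightarrow> f x = g x) \<Longrightarrow> smooth_in V g"
  using Ck_on_cong[of V f g] by (auto simp: smooth_in_def)

lemma smooth_in_subset:
  assumes "smooth_in V f" "open U" "U \<subseteq> V"
  shows "smooth_in U f"
proof -
  have "Ck_on k f V \<Longrightarrow> Ck_on k f U" for k
    using assms(3) by (induction k arbitrary: f) (auto intro: continuous_on_subset)
  then show ?thesis using assms by (auto simp: smooth_in_def)
qed

lemma smooth_in_const: "open V \<Longrightarrow> smooth_in V (\<lambda>x. c)"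
  by (simp add: smooth_in_def Ck_on_const)

lemma smooth_in_add:
  "smooth_in V f \<Longrightarrow> smooth_in V g \<Longrightarrow> smooth_in V (\<lambda>x. f x + g x)"
  by (simp add: smooth_in_def Ck_on_add)

lemma smooth_in_bounded_linear:
  "smooth_in V f \<Longrightarrow> bounded_linear L \<Longrightarrow> smooth_in V (\<lambda>x. L (f x))"
  by (simp add: smooth_in_def Ck_on_bounded_linear)

lemma smooth_in_inner:
  fixes f :: "'a::real_normed_vector \<Rightarrow> 'b::real_inner"
  shows "smooth_in V f \<Longrightarrow> smooth_in V (\<lambda>x. f x \<bullet> e)"
  using smooth_in_bounded_linear[OF _ bounded_linear_inner_left] .

lemma smooth_in_uminus: "smooth_in V f \<Longrightarrow> smooth_in V (\<lambda>x. - f x)"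
  using smooth_in_bounded_linear[OF _ bounded_linear_minus[OF bounded_linear_ident]] .

lemma smooth_in_diff:
  "smooth_in V f \<Longrightarrow> smooth_in V g \<Longrightarrow> smooth_in V (\<lambda>x. f x - g x)"
  using smooth_in_add[of V f "\<lambda>x. - g x"] smooth_in_uminus[of V g] by simp

lemma smooth_in_mult:
  fixes f g :: "'a::real_normed_vector \<Rightarrow> real"
  shows "smooth_in V f \<Longrightarrow> smooth_in V g \<Longrightarrow> smooth_in V (\<lambda>x. f x * g x)"
  by (simp add: smooth_in_def Ck_on_mult)

lemma smooth_in_divide:
  fixes f g :: "'a::real_normed_vector \<Rightarrow> real"
  shows "smooth_in V f \<Longrightarrow> smooth_in V g \<Longrightarrow> (\<And>x. x \<in> V \<Longrightarrow> g x \<noteq> 0) \<Longrightarrow> smooth_in V (\<lambda>x. f x / g x)"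
  unfolding divide_inverse
  by (intro smooth_in_mult) (auto simp: smooth_in_def Ck_on_inverse)

lemma smooth_in_inner_fields:
  fixes F G :: "'a::real_normed_vector \<Rightarrow> real^3"
  assumes "smooth_in V F" "smooth_in V G"
  shows "smooth_in V (\<lambda>x. F x \<bullet> G x)"
proof -
  have "smooth_in V (\<lambda>x. (F x \<bullet> b) * (G x \<bullet> b))" for b
    by (intro smooth_in_mult smooth_in_inner assms)
  note sm = this
  have "smooth_in V (\<lambda>x. \<Sum>b\<in>B. (F x \<bullet> b) * (G x \<bullet> b))" if "finite B" for B
    using that by (induction B rule: finite_induct) (simp_all add: sm smooth_in_const smooth_in_open[OF assms(1)] smooth_in_add)
  moreover have "(\<lambda>x. F x \<bullet> G x) = (\<lambda>x. \<Sum>b\<in>Basis. (F x \<bullet> b) * (G x \<bullet> b))"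
    by (rule ext, rule euclidean_inner)
  ultimately show ?thesis by simp
qed

lemma dir_deriv_has_vector_derivative:
  assumes "smooth_in V f" "x + t *\<^sub>R v \<in> V"
  shows "((\<lambda>t. f (x + t *\<^sub>R v)) has_vector_derivative dir_deriv v f (x + t *\<^sub>R v)) (at t within T)"
proof -
  have "((\<lambda>t. x + t *\<^sub>R v) has_vector_derivative v) (at t within T)"
    by (auto intro!: derivative_eq_intros)
  then show ?thesis
    using vector_derivative_diff_chain_within[of "\<lambda>t. x + t *\<^sub>R v" v t T f "frechet_derivative f (at (x + t *\<^sub>R v))"]
      smooth_in_has_derivative[OF assms] has_derivative_at_withinI
    by (auto simp: o_def)
qed

lemma dir_deriv_DERIV:
  fixes f :: "'a::real_normed_vector \<Rightarrow> real"
  assumes "smooth_in V f" "x + t *\<^sub>R v \<in> V"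
  shows "((\<lambda>t. f (x + t *\<^sub>R v)) has_real_derivative dir_deriv v f (x + t *\<^sub>R v)) (at t within T)"
  using dir_deriv_has_vector_derivative[OF assms] has_real_derivative_iff_has_vector_derivative by blast

lemma dir_deriv_components:
  fixes f :: "real \<times> real \<Rightarrow> 'b::real_normed_vector"
  assumes "smooth_in V f" "x \<in> V"
  shows "dir_deriv u f x = fst u *\<^sub>R dir_deriv (1,0) f x + snd u *\<^sub>R dir_deriv (0,1) f x"
proof -
  interpret bounded_linear "frechet_derivative f (at x)"
    using smooth_in_has_derivative[OF assms] by (rule has_derivative_bounded_linear)
  have "u = fst u *\<^sub>R (1,0) + snd u *\<^sub>R (0,1)" by (simp add: prod_eq_iff)
  then show ?thesis by (metis add scaleR)
qed

lemma dir_deriv_inner_fields: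
  fixes F G :: "'a::real_normed_vector \<Rightarrow> 'b::real_inner"
  assumes "smooth_in V F" "smooth_in V G" "x \<in> V"
  shows "dir_deriv v (\<lambda>x. F x \<bullet> G x) x = F x \<bullet> dir_deriv v G x + dir_deriv v F x \<bullet> G x"
  by (rule fun_cong[OF frechet_derivative_at[OF has_derivative_inner[OF smooth_in_has_derivative[OF assms(1,3)]
      smooth_in_has_derivative[OF assms(2,3)]], symmetric]])

lemma dir_deriv_inner_const:
  fixes F :: "'a::real_normed_vector \<Rightarrow> 'b::real_inner"
  assumes "smooth_in V F" "x \<in> V"
  shows "dir_deriv v (\<lambda>x. F x \<bullet> e) x = dir_deriv v F x \<bullet> e"
  by (rule fun_cong[OF frechet_derivative_at[OF bounded_linear.has_derivative[OF bounded_linear_inner_left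
      smooth_in_has_derivative[OF assms]], symmetric]])

text \<open>The second difference on the left is symmetric in \<open>v\<close> and \<open>w\<close>, while the right-hand side singles out
one order of differentiation. Two applications of the mean value theorem, one in each direction.\<close>

lemma second_difference_mvt:
  fixes f :: "'a::real_normed_vector \<Rightarrow> real"
  assumes f: "smooth_in V f" and h: "h > 0"
    and V: "\<And>s t. 0 \<le> s \<Longrightarrow> s \<le> h \<Longrightarrow> 0 \<le> t \<Longrightarrow> t \<le> h \<Longrightarrow> x + s *\<^sub>R v + t *\<^sub>R w \<in> V"
  shows "\<exists>s t. 0 \<le> s \<and> s \<le> h \<and> 0 \<le> t \<and> t \<le> h \<and>
     f (x + h *\<^sub>R v + h *\<^sub>R w) - f (x + h *\<^sub>R v) - f (x + h *\<^sub>R w) + f x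
       = h * h * dir_deriv w (dir_deriv v f) (x + s *\<^sub>R v + t *\<^sub>R w)"
proof -
  let ?u = "\<lambda>s. f (x + h *\<^sub>R w + s *\<^sub>R v) - f (x + s *\<^sub>R v)"
  have "\<exists>s. 0 < s \<and> s < h \<and> ?u h - ?u 0 = (h - 0) * (dir_deriv v f (x + h *\<^sub>R w + s *\<^sub>R v) - dir_deriv v f (x + s *\<^sub>R v))"
  proof (rule MVT2[OF h])
    fix s assume "0 \<le> s" "s \<le> h"
    then show "(?u has_real_derivative dir_deriv v f (x + h *\<^sub>R w + s *\<^sub>R v) - dir_deriv v f (x + s *\<^sub>R v)) (at s)"
      using V[of s h] V[of s 0] h
      by (intro DERIV_diff dir_deriv_DERIV[OF f]) (auto simp: algebra_simps)
  qed
  then obtain s where s: "0 < s" "s < h"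
    and 1: "?u h - ?u 0 = h * (dir_deriv v f (x + h *\<^sub>R w + s *\<^sub>R v) - dir_deriv v f (x + s *\<^sub>R v))"
    by auto
  have "\<exists>t. 0 < t \<and> t < h \<and> dir_deriv v f (x + s *\<^sub>R v + h *\<^sub>R w) - dir_deriv v f (x + s *\<^sub>R v + 0 *\<^sub>R w)
     = (h - 0) * dir_deriv w (dir_deriv v f) (x + s *\<^sub>R v + t *\<^sub>R w)"
    using s by (intro MVT2[OF h] dir_deriv_DERIV[OF smooth_in_dir_deriv[OF f]] V) auto
  then obtain t where t: "0 < t" "t < h" "dir_deriv v f (x + s *\<^sub>R v + h *\<^sub>R w) - dir_deriv v f (x + s *\<^sub>R v)
     = h * dir_deriv w (dir_deriv v f) (x + s *\<^sub>R v + t *\<^sub>R w)"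
    by auto
  show ?thesis
    using 1 t s by (intro exI[of _ s] exI[of _ t]) (auto simp: algebra_simps)
qed

text \<open>Schwarz's theorem. By \<open>second_difference_mvt\<close> the two mixed derivatives take equal values at
two points arbitrarily near \<open>x\<close>, and both are continuous.\<close>

lemma dir_deriv_commute:
  fixes f :: "'a::real_normed_vector \<Rightarrow> real"
  assumes f: "smooth_in V f" and x: "x \<in> V"
  shows "dir_deriv v (dir_deriv w f) x = dir_deriv w (dir_deriv v f) x"
proof (rule ccontr)
  let ?p = "dir_deriv v (dir_deriv w f)" and ?q = "dir_deriv w (dir_deriv v f)"
  assume ne: "?p x \<noteq> ?q x"
  define e where "e = \<bar>?p x - ?q x\<bar> / 2"
  have e: "e > 0" using ne by (simp add: e_def)
  have cont: "isCont ?p x" "isCont ?q x"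
    using f x by (intro smooth_in_isCont[of V] smooth_in_dir_deriv; simp)+
  obtain d1 where d1: "d1 > 0" "\<And>y. dist y x < d1 \<Longrightarrow> dist (?p y) (?p x) < e"
    using cont(1) e unfolding continuous_at_eps_delta by (metis dist_commute)
  obtain d2 where d2: "d2 > 0" "\<And>y. dist y x < d2 \<Longrightarrow> dist (?q y) (?q x) < e"
    using cont(2) e unfolding continuous_at_eps_delta by (metis dist_commute)
  obtain d3 where d3: "d3 > 0" "\<And>y. dist y x < d3 \<Longrightarrow> y \<in> V"
    using smooth_in_open[OF f] x unfolding open_dist by blast
  define d where "d = min d1 (min d2 d3)"
  \<comment> \<open>A side length for which the parallelogram spanned by \<open>h * v\<close> and \<open>h * w\<close> stays within distance \<open>d\<close> of \<open>x\<close>.\<close>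
  define h where "h = d / (2 * (norm v + norm w + 1))"
  have N: "norm v + norm w + 1 > 0" by (simp add: add_nonneg_pos)
  have "d > 0" using d1 d2 d3 by (simp add: d_def)
  then have h: "h > 0" using N by (simp add: h_def)
  have near: "dist (x + s *\<^sub>R v + t *\<^sub>R w) x < d" if "0 \<le> s" "s \<le> h" "0 \<le> t" "t \<le> h" for s t
  proof -
    have "dist (x + s *\<^sub>R v + t *\<^sub>R w) x = norm (s *\<^sub>R v + t *\<^sub>R w)"
      by (simp add: dist_norm algebra_simps)
    also have "\<dots> \<le> s * norm v + t * norm w"
      using norm_triangle_ineq[of "s *\<^sub>R v" "t *\<^sub>R w"] that by simp
    also have "\<dots> \<le> h * norm v + h * norm w"
      using that by (intro add_mono mult_right_mono) auto
    also have "\<dots> < h * (2 * (norm v + norm w + 1))"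
      using h by (simp add: algebra_simps add_nonneg_pos)
    also have "\<dots> = d" using N by (simp add: h_def)
    finally show ?thesis .
  qed
  have inV: "x + s *\<^sub>R v + t *\<^sub>R w \<in> V" "x + s *\<^sub>R w + t *\<^sub>R v \<in> V"
    if "0 \<le> s" "s \<le> h" "0 \<le> t" "t \<le> h" for s t
  proof -
    have "d \<le> d3" by (simp add: d_def)
    then show "x + s *\<^sub>R v + t *\<^sub>R w \<in> V" "x + s *\<^sub>R w + t *\<^sub>R v \<in> V"
      using near[of s t] near[of t s] that by (auto intro!: d3(2) simp: add_ac)
  qed
  obtain s t where st: "0 \<le> s" "s \<le> h" "0 \<le> t" "t \<le> h"
     "f (x + h *\<^sub>R v + h *\<^sub>R w) - f (x + h *\<^sub>R v) - f (x + h *\<^sub>R w) + f x = h * h * ?q (x + s *\<^sub>R v + t *\<^sub>R w)"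
    using second_difference_mvt[OF f h, of x v w, OF inV(1)] by blast
  obtain s' t' where st': "0 \<le> s'" "s' \<le> h" "0 \<le> t'" "t' \<le> h"
     "f (x + h *\<^sub>R w + h *\<^sub>R v) - f (x + h *\<^sub>R w) - f (x + h *\<^sub>R v) + f x = h * h * ?p (x + s' *\<^sub>R w + t' *\<^sub>R v)"
    using second_difference_mvt[OF f h, of x w v, OF inV(2)] by blast
  have "?q (x + s *\<^sub>R v + t *\<^sub>R w) = ?p (x + t' *\<^sub>R v + s' *\<^sub>R w)"
    using st(5) st'(5) h by (simp add: algebra_simps)
  moreover have "dist (?q (x + s *\<^sub>R v + t *\<^sub>R w)) (?q x) < e"
    by (rule d2) (use near[of s t] st in \<open>auto simp: d_def\<close>)
  moreover have "dist (?p (x + t' *\<^sub>R v + s' *\<^sub>R w)) (?p x) < e"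
    by (rule d1) (use near[of t' s'] st' in \<open>auto simp: d_def\<close>)
  ultimately have "\<bar>?p x - ?q x\<bar> < 2 * e"
    by (auto simp: dist_real_def)
  then show False by (simp add: e_def)
qed

lemma dir_deriv_commute_inner:
  fixes F :: "'a::real_normed_vector \<Rightarrow> 'b::real_inner"
  assumes F: "smooth_in V F" and x: "x \<in> V"
  shows "dir_deriv v (dir_deriv w F) x = dir_deriv w (dir_deriv v F) x"
proof -
  have eq: "dir_deriv a (dir_deriv b F) x \<bullet> e = dir_deriv a (dir_deriv b (\<lambda>x. F x \<bullet> e)) x" for a b e
  proof -
    have "dir_deriv a (dir_deriv b F) x \<bullet> e = dir_deriv a (\<lambda>x. dir_deriv b F x \<bullet> e) x"
      by (rule dir_deriv_inner_const[OF smooth_in_dir_deriv[OF F] x, symmetric])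
    also have "\<dots> = dir_deriv a (dir_deriv b (\<lambda>x. F x \<bullet> e)) x"
    proof -
      have sm: "smooth_in V (\<lambda>x. dir_deriv b F x \<bullet> e)" by (intro smooth_in_inner smooth_in_dir_deriv F)
      show ?thesis
        using frechet_derivative_transform_within_open[OF differentiableI[OF smooth_in_has_derivative[OF sm x]] smooth_in_open[OF F] x,
           of "dir_deriv b (\<lambda>x. F x \<bullet> e)"] dir_deriv_inner_const[OF F] by metis
    qed
    finally show ?thesis .
  qed
  have "dir_deriv v (dir_deriv w F) x \<bullet> e = dir_deriv w (dir_deriv v F) x \<bullet> e" for e
    unfolding eq by (rule dir_deriv_commute[OF smooth_in_inner[OF F] x])
  then show ?thesis using vector_eq_rdot by blast
qed

section \<open>One-sided calculus in the half-plane\<close>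

text \<open>Every one-sided argument at a boundary point runs along such a ray: it stays in the half-plane when
its direction does not point out of it, and from an interior point any direction is allowed.\<close>

lemma half_plane_ray:
  assumes "open V" "x \<in> V" "x \<in> half_plane" "0 \<le> snd v \<or> 0 < snd x"
  obtains e where "e > 0" "\<And>t. 0 \<le> t \<Longrightarrow> t < e \<Longrightarrow> x + t *\<^sub>R v \<in> V \<inter> half_plane"
proof -
  define V' where "V' = (if 0 \<le> snd v then V else V \<inter> {x. 0 < snd x})"
  have "open {x::real\<times>real. 0 < snd x}" by (intro open_Collect_less continuous_intros)
  then have "open V'" using assms(1) by (auto simp: V'_def)
  moreover have "x \<in> V'" using assms by (auto simp: V'_def)
  ultimately obtain r where r: "r > 0" "ball x r \<subseteq> V'" using openE by blast
  have N: "norm v + 1 > 0" by (simp add: add_nonneg_pos)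
  show ?thesis
  proof
    show "r / (norm v + 1) > 0" using r N by simp
    fix t assume t: "0 \<le> t" "t < r / (norm v + 1)"
    have "dist x (x + t *\<^sub>R v) = t * norm v" using t by (simp add: dist_norm)
    also have "\<dots> \<le> t * (norm v + 1)" using t by (simp add: algebra_simps)
    also have "\<dots> < r" using t N by (simp add: field_simps)
    finally have "x + t *\<^sub>R v \<in> V'" using r by auto
    then show "x + t *\<^sub>R v \<in> V \<inter> half_plane"
      using t assms(3) by (auto simp: V'_def half_plane_def split: if_splits)
  qed
qed

text \<open>Derivatives are unique also at boundary points, because short segments in both positive coordinate
directions stay in \<open>D\<close>. This makes \<open>differential\<close> and the transition derivatives below well defined.\<close>

lemma half_plane_derivative_unique:
  fixes f :: "real \<times> real \<Rightarrow> 'b::real_normed_vector"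
  assumes "(f has_derivative f') (at x within D)" "(f has_derivative f'') (at x within D)"
    and "openin (top_of_set half_plane) D" "x \<in> D"
  shows "f' = f''"
proof (rule frechet_derivative_unique_within[OF assms(1,2)])
  fix i :: "real \<times> real" and e :: real
  assume i: "i \<in> Basis" and e: "0 < e"
  obtain T where T: "open T" "D = half_plane \<inter> T" using assms(3) by (auto simp: openin_open)
  have "0 \<le> snd i" using i by (auto simp: Basis_prod_def)
  then obtain r where r: "r > 0" "\<And>t. 0 \<le> t \<Longrightarrow> t < r \<Longrightarrow> x + t *\<^sub>R i \<in> T \<inter> half_plane"
    using half_plane_ray[of T x i] T assms(4) by blast
  let ?d = "min e r / 2"
  have "0 < \<bar>?d\<bar>" "\<bar>?d\<bar> < e" "x + ?d *\<^sub>R i \<in> D" using r e T by auto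
  then show "\<exists>d. 0 < \<bar>d\<bar> \<and> \<bar>d\<bar> < e \<and> x + d *\<^sub>R i \<in> D" by blast
qed

lemma half_plane_one_sided_min:
  fixes f :: "real \<times> real \<Rightarrow> real"
  assumes f: "(f has_derivative f') (at x within D)" and D: "openin (top_of_set half_plane) D" and x: "x \<in> D"
    and u: "0 \<le> snd u" and le: "\<And>t. 0 \<le> t \<Longrightarrow> x + t *\<^sub>R u \<in> D \<Longrightarrow> f x \<le> f (x + t *\<^sub>R u)"
  shows "0 \<le> f' u"
proof (rule ccontr)
  assume neg: "\<not> 0 \<le> f' u"
  obtain T where T: "open T" "D = half_plane \<inter> T" using D by (auto simp: openin_open)
  obtain r where r: "r > 0" "\<And>t. 0 \<le> t \<Longrightarrow> t < r \<Longrightarrow> x + t *\<^sub>R u \<in> T \<inter> half_plane"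
    using half_plane_ray[of T x u] T x u by blast
  let ?S = "{0..<r}"
  have "((\<lambda>t. x + t *\<^sub>R u) has_vector_derivative u) (at 0 within ?S)"
    by (auto intro!: derivative_eq_intros)
  moreover have "(f has_derivative f') (at (x + 0 *\<^sub>R u) within (\<lambda>t. x + t *\<^sub>R u) ` ?S)"
  proof -
    have "(f has_derivative f') (at (x + 0 *\<^sub>R u) within D)" using f by simp
    then show ?thesis by (rule has_derivative_subset) (use r T in auto)
  qed
  ultimately have "(f \<circ> (\<lambda>t. x + t *\<^sub>R u) has_vector_derivative f' u) (at 0 within ?S)"
    by (intro vector_derivative_diff_chain_within) auto
  then have "((\<lambda>t. f (x + t *\<^sub>R u)) has_real_derivative f' u) (at 0 within ?S)"
    by (simp add: has_real_derivative_iff_has_vector_derivative o_def)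
  from has_real_derivative_neg_dec_right[OF this] neg obtain d where d: "d > 0"
    "\<And>h. h > 0 \<Longrightarrow> 0 + h \<in> ?S \<Longrightarrow> h < d \<Longrightarrow> f (x + (0 + h) *\<^sub>R u) < f (x + 0 *\<^sub>R u)"
    by (meson linorder_not_le)
  define h where "h = min d r / 2"
  have h: "h > 0" "h < d" "h < r" using d r by (auto simp: h_def)
  then have "f (x + h *\<^sub>R u) < f x" using d(2)[of h] by simp
  moreover have "x + h *\<^sub>R u \<in> D" using r(2)[of h] h T by auto
  ultimately show False using le[of h] h by simp
qed

text \<open>Relations that hold on the surface can be differentiated up to the boundary, although the extension
\<open>g\<close> is unconstrained on the other side of it.\<close>

lemma dir_deriv_zero_on_half_plane:
  fixes g :: "real \<times> real \<Rightarrow> 'b::real_normed_vector"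
  assumes g: "smooth_in V g" and x: "x \<in> V \<inter> half_plane"
    and z: "\<And>y. y \<in> V \<inter> half_plane \<Longrightarrow> g y = 0"
  shows "dir_deriv v g x = 0"
proof -
  have "(g has_derivative frechet_derivative g (at x)) (at x within V \<inter> half_plane)"
    using smooth_in_has_derivative[OF g] x has_derivative_at_withinI by blast
  moreover have "(g has_derivative (\<lambda>v. 0)) (at x within V \<inter> half_plane)"
    by (rule has_derivative_transform[OF x z has_derivative_const[of 0]])
  moreover have "openin (top_of_set half_plane) (V \<inter> half_plane)"
    using smooth_in_open[OF g] by (auto simp: openin_open)
  ultimately show ?thesis using half_plane_derivative_unique x by metis
qed

lemma dir_deriv_zero_on_boundary:
  fixes g :: "real \<times> real \<Rightarrow> real"
  assumes g: "smooth_in V g" and p: "p \<in> V" "snd p = 0" and u: "snd u = 0"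
    and z: "\<And>q. q \<in> V \<Longrightarrow> snd q = 0 \<Longrightarrow> g q = 0"
  shows "dir_deriv u g p = 0"
proof -
  have p': "p \<in> half_plane" using p by (simp add: half_plane_def)
  obtain e1 where e1: "e1 > 0" "\<And>t. 0 \<le> t \<Longrightarrow> t < e1 \<Longrightarrow> p + t *\<^sub>R u \<in> V \<inter> half_plane"
    by (rule half_plane_ray[of V p u]) (use smooth_in_open[OF g] p p' u in auto)
  obtain e2 where e2: "e2 > 0" "\<And>t. 0 \<le> t \<Longrightarrow> t < e2 \<Longrightarrow> p + t *\<^sub>R (- u) \<in> V \<inter> half_plane"
    by (rule half_plane_ray[of V p "- u"]) (use smooth_in_open[OF g] p p' u in auto)
  have "\<forall>t. \<bar>0 - t\<bar> < min e1 e2 \<longrightarrow> g (p + 0 *\<^sub>R u) = g (p + t *\<^sub>R u)"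
  proof (intro allI impI)
    fix t assume "\<bar>0 - t\<bar> < min e1 e2"
    then have "p + t *\<^sub>R u \<in> V"
      using e1(2)[of t] e2(2)[of "- t"] by (cases "t \<ge> 0") auto
    then show "g (p + 0 *\<^sub>R u) = g (p + t *\<^sub>R u)" using z p u by simp
  qed
  moreover have "((\<lambda>t. g (p + t *\<^sub>R u)) has_real_derivative dir_deriv u g (p + 0 *\<^sub>R u)) (at 0)"
    using p by (intro dir_deriv_DERIV[OF g]) auto
  ultimately show ?thesis using DERIV_local_const[of _ _ 0 "min e1 e2"] e1 e2 by force
qed

text \<open>At a boundary maximum only the tangential first derivative has to vanish.\<close>

lemma dir_deriv_zero_at_max:
  fixes g :: "real \<times> real \<Rightarrow> real"
  assumes g: "smooth_in V g" and x: "x \<in> V \<inter> half_plane"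
    and le: "\<And>y. y \<in> V \<inter> half_plane \<Longrightarrow> g y \<le> g x" and v: "snd v = 0 \<or> 0 < snd x"
  shows "dir_deriv v g x = 0"
proof -
  obtain e1 where e1: "e1 > 0" "\<And>t. 0 \<le> t \<Longrightarrow> t < e1 \<Longrightarrow> x + t *\<^sub>R v \<in> V \<inter> half_plane"
    by (rule half_plane_ray[of V x v]) (use smooth_in_open[OF g] x v in auto)
  obtain e2 where e2: "e2 > 0" "\<And>t. 0 \<le> t \<Longrightarrow> t < e2 \<Longrightarrow> x + t *\<^sub>R (- v) \<in> V \<inter> half_plane"
    by (rule half_plane_ray[of V x "- v"]) (use smooth_in_open[OF g] x v in auto)
  let ?e = "min e1 e2"
  have "((\<lambda>t. g (x + t *\<^sub>R v)) has_real_derivative dir_deriv v g (x + 0 *\<^sub>R v)) (at 0)"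
    using x by (intro dir_deriv_DERIV[OF g]) auto
  moreover have "\<forall>t. \<bar>0 - t\<bar> < ?e \<longrightarrow> g (x + t *\<^sub>R v) \<le> g (x + 0 *\<^sub>R v)"
  proof (intro allI impI)
    fix t assume "\<bar>0 - t\<bar> < ?e"
    then have "x + t *\<^sub>R v \<in> V \<inter> half_plane"
      using e1(2)[of t] e2(2)[of "- t"] by (cases "t \<ge> 0") auto
    then show "g (x + t *\<^sub>R v) \<le> g (x + 0 *\<^sub>R v)" using le by simp
  qed
  ultimately show ?thesis using DERIV_local_max[of _ _ 0 ?e] e1 e2 by force
qed

lemma second_dir_deriv_at_max:
  fixes g :: "real \<times> real \<Rightarrow> real"
  assumes g: "smooth_in V g" and x: "x \<in> V \<inter> half_plane"
    and le: "\<And>y. y \<in> V \<inter> half_plane \<Longrightarrow> g y \<le> g x" and v: "0 \<le> snd v \<or> 0 < snd x"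
    and crit: "dir_deriv v g x = 0"
  shows "dir_deriv v (dir_deriv v g) x \<le> 0"
proof (rule ccontr)
  assume "\<not> ?thesis"
  then have pos: "dir_deriv v (dir_deriv v g) (x + 0 *\<^sub>R v) > 0" by simp
  obtain e where e: "e > 0" "\<And>t. 0 \<le> t \<Longrightarrow> t < e \<Longrightarrow> x + t *\<^sub>R v \<in> V \<inter> half_plane"
    by (rule half_plane_ray[of V x v]) (use smooth_in_open[OF g] x v in auto)
  have "((\<lambda>t. dir_deriv v g (x + t *\<^sub>R v)) has_real_derivative dir_deriv v (dir_deriv v g) (x + 0 *\<^sub>R v)) (at 0)"
    using x by (intro dir_deriv_DERIV[OF smooth_in_dir_deriv[OF g]]) auto
  from DERIV_pos_inc_right[OF this pos] obtain d where d: "d > 0"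
    "\<And>t. 0 < t \<Longrightarrow> t < d \<Longrightarrow> dir_deriv v g (x + t *\<^sub>R v) > 0" using crit by auto
  define s where "s = min d e / 2"
  have s: "0 < s" "s < d" "s < e" using d e by (auto simp: s_def)
  have "\<exists>t. 0 < t \<and> t < s \<and> g (x + s *\<^sub>R v) - g (x + 0 *\<^sub>R v) = (s - 0) * dir_deriv v g (x + t *\<^sub>R v)"
    using s e by (intro MVT2 dir_deriv_DERIV[OF g]) auto
  then obtain t where "0 < t" "t < s" "g (x + s *\<^sub>R v) - g x = s * dir_deriv v g (x + t *\<^sub>R v)" by auto
  then have "g (x + s *\<^sub>R v) - g x > 0" using d s by auto
  then show False using le[of "x + s *\<^sub>R v"] e s by auto
qed

section \<open>Coordinate vector fields\<close>

text \<open>A vector field acting on functions as a derivation.\<close>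

definition along :: "(real \<times> real \<Rightarrow> real \<times> real) \<Rightarrow> (real \<times> real \<Rightarrow> real) \<Rightarrow> real \<times> real \<Rightarrow> real" where
  "along v f x = dir_deriv (v x) f x"

definition smooth_field :: "(real \<times> real) set \<Rightarrow> (real \<times> real \<Rightarrow> real \<times> real) \<Rightarrow> bool" where
  "smooth_field V v \<longleftrightarrow> smooth_in V (\<lambda>x. fst (v x)) \<and> smooth_in V (\<lambda>x. snd (v x))"

lemma along_eqI: "(f has_derivative f') (at x) \<Longrightarrow> along v f x = f' (v x)"
  unfolding along_def using frechet_derivative_at by metis

lemma along_const: "along v (\<lambda>x. c) x = 0"
  by (simp add: along_def)

lemma along_add:
  assumes "smooth_in V f" "smooth_in V g" "x \<in> V"
  shows "along v (\<lambda>x. f x + g x) x = along v f x + along v g x"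
  using along_eqI[OF has_derivative_add[OF smooth_in_has_derivative[OF assms(1,3)] smooth_in_has_derivative[OF assms(2,3)]]]
  by (simp add: along_def)

lemma along_diff:
  assumes "smooth_in V f" "smooth_in V g" "x \<in> V"
  shows "along v (\<lambda>x. f x - g x) x = along v f x - along v g x"
  using along_eqI[OF has_derivative_diff[OF smooth_in_has_derivative[OF assms(1,3)] smooth_in_has_derivative[OF assms(2,3)]]]
  by (simp add: along_def)

lemma along_uminus:
  assumes "smooth_in V f" "x \<in> V"
  shows "along v (\<lambda>x. - f x) x = - along v f x"
  using along_eqI[OF has_derivative_minus[OF smooth_in_has_derivative[OF assms]]]
  by (simp add: along_def)

lemma along_mult:
  assumes "smooth_in V f" "smooth_in V g" "x \<in> V"
  shows "along v (\<lambda>x. f x * g x) x = along v f x * g x + f x * along v g x"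
  using along_eqI[OF has_derivative_mult[OF smooth_in_has_derivative[OF assms(1,3)] smooth_in_has_derivative[OF assms(2,3)]]]
  by (simp add: along_def)

lemma along_cong:
  assumes "smooth_in V f" "x \<in> V" "\<And>y. y \<in> V \<Longrightarrow> f y = g y"
  shows "along v f x = along v g x"
  unfolding along_def
  using frechet_derivative_transform_within_open[of f x V g] assms smooth_in_open[OF assms(1)]
    smooth_in_has_derivative[OF assms(1,2)] differentiableI by metis

lemma along_components:
  assumes "smooth_in V f" "x \<in> V"
  shows "along v f x = fst (v x) * dir_deriv (1,0) f x + snd (v x) * dir_deriv (0,1) f x"
  using dir_deriv_components[OF assms, of "v x"] by (simp add: along_def)

lemma smooth_in_along:
  assumes "smooth_in V f" "smooth_field V v"
  shows "smooth_in V (along v f)"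
proof -
  have "smooth_in V (\<lambda>x. fst (v x) * dir_deriv (1,0) f x + snd (v x) * dir_deriv (0,1) f x)"
    using assms by (intro smooth_in_add smooth_in_mult smooth_in_dir_deriv) (auto simp: smooth_field_def)
  then show ?thesis by (rule smooth_in_cong) (simp add: along_components[OF assms(1)])
qed

text \<open>The first two terms come from the variation of the field \<open>w\<close> and only involve first derivatives of
\<open>f\<close>; the last one is the second derivative with both directions frozen at \<open>x\<close>.\<close>

lemma along_along_components:
  assumes f: "smooth_in V f" and w: "smooth_field V w" and x: "x \<in> V"
  shows "along v (along w f) x = along v (\<lambda>x. fst (w x)) x * dir_deriv (1,0) f x
     + along v (\<lambda>x. snd (w x)) x * dir_deriv (0,1) f x
     + dir_deriv (v x) (dir_deriv (w x) f) x"
proof -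
  note sm = smooth_in_dir_deriv[OF f]
  have w': "smooth_in V (\<lambda>x. fst (w x))" "smooth_in V (\<lambda>x. snd (w x))"
    using w by (auto simp: smooth_field_def)
  have "along v (along w f) x = along v (\<lambda>x. fst (w x) * dir_deriv (1,0) f x + snd (w x) * dir_deriv (0,1) f x) x"
    by (rule along_cong[OF smooth_in_along[OF f w] x along_components[OF f]])
  also have "\<dots> = along v (\<lambda>x. fst (w x)) x * dir_deriv (1,0) f x + fst (w x) * along v (dir_deriv (1,0) f) x
    + (along v (\<lambda>x. snd (w x)) x * dir_deriv (0,1) f x + snd (w x) * along v (dir_deriv (0,1) f) x)"
    using w' sm by (simp add: along_add[of V] along_mult[of V] smooth_in_mult x)
  finally have "along v (along w f) x = along v (\<lambda>x. fst (w x)) x * dir_deriv (1,0) f x + fst (w x) * along v (dir_deriv (1,0) f) x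
    + (along v (\<lambda>x. snd (w x)) x * dir_deriv (0,1) f x + snd (w x) * along v (dir_deriv (0,1) f) x)" .
  moreover have "fst (w x) * along v (dir_deriv (1,0) f) x + snd (w x) * along v (dir_deriv (0,1) f) x
     = dir_deriv (v x) (dir_deriv (w x) f) x"
  proof -
    let ?c = "w x"
    have "dir_deriv (v x) (dir_deriv ?c f) x = along v (dir_deriv ?c f) x" by (simp add: along_def)
    also have "\<dots> = along v (\<lambda>y. fst ?c * dir_deriv (1,0) f y + snd ?c * dir_deriv (0,1) f y) x"
      by (rule along_cong[OF sm x]) (use dir_deriv_components[OF f, of _ "w x"] in simp)
    also have "\<dots> = fst ?c * along v (dir_deriv (1,0) f) x + snd ?c * along v (dir_deriv (0,1) f) x"
      using sm smooth_in_open[OF f] by (simp add: along_add[of V] along_mult[of V] smooth_in_mult x along_const smooth_in_const)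
    finally show ?thesis by simp
  qed
  ultimately show ?thesis by (simp add: algebra_simps)
qed

text \<open>At a critical point the first derivative terms drop out, and differentiating twice along a field is a
second derivative in a fixed direction.\<close>

lemma along_along_at_max:
  assumes g: "smooth_in V g" and v: "smooth_field V v" and x: "x \<in> V \<inter> half_plane"
    and le: "\<And>y. y \<in> V \<inter> half_plane \<Longrightarrow> g y \<le> g x" and vx: "0 \<le> snd (v x) \<or> 0 < snd x"
    and crit: "\<And>u. dir_deriv u g x = 0"
  shows "along v (along v g) x \<le> 0"
proof -
  have "along v (along v g) x = dir_deriv (v x) (dir_deriv (v x) g) x"
    using along_along_components[OF g v, of x v] x crit by simp
  also have "\<dots> \<le> 0" by (rule second_dir_deriv_at_max[OF g x le vx crit])
  finally show ?thesis .
qed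

text \<open>\<open>v\<close> and \<open>w\<close> are the partial derivatives \<open>\<partial>/\<partial>X\<close> and \<open>\<partial>/\<partial>Y\<close> of the local coordinates \<open>X\<close> and \<open>Y\<close>,
expressed in the original coordinates of \<open>V\<close>. This replaces a change of variables.\<close>

definition coordinate_frame ::
  "(real \<times> real) set \<Rightarrow> (real \<times> real \<Rightarrow> real) \<Rightarrow> (real \<times> real \<Rightarrow> real) \<Rightarrow>
   (real \<times> real \<Rightarrow> real \<times> real) \<Rightarrow> (real \<times> real \<Rightarrow> real \<times> real) \<Rightarrow> bool" where
  "coordinate_frame V X Y v w \<longleftrightarrow> smooth_in V X \<and> smooth_in V Y \<and> smooth_field V v \<and> smooth_field V w \<and>
     (\<forall>x\<in>V. along v X x = 1 \<and> along v Y x = 0 \<and> along w X x = 0 \<and> along w Y x = 1)"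

text \<open>The components of the two fields are the entries of the inverse Jacobian matrix of \<open>(X, Y)\<close>, by
Cramer's rule.\<close>

lemma coordinate_frame_exists:
  assumes X: "smooth_in V X" and Y: "smooth_in V Y"
    and J: "\<And>x. x \<in> V \<Longrightarrow> dir_deriv (1,0) X x * dir_deriv (0,1) Y x - dir_deriv (0,1) X x * dir_deriv (1,0) Y x \<noteq> 0"
  defines "J \<equiv> \<lambda>x. dir_deriv (1,0) X x * dir_deriv (0,1) Y x - dir_deriv (0,1) X x * dir_deriv (1,0) Y x"
  shows "coordinate_frame V X Y (\<lambda>x. (dir_deriv (0,1) Y x / J x, - dir_deriv (1,0) Y x / J x))
     (\<lambda>x. (- dir_deriv (0,1) X x / J x, dir_deriv (1,0) X x / J x))"
proof -
  have sJ: "smooth_in V J" unfolding J_def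
    by (intro smooth_in_diff smooth_in_mult smooth_in_dir_deriv X Y)
  have J0: "x \<in> V \<Longrightarrow> J x \<noteq> 0" for x using J by (simp add: J_def)
  have sm: "smooth_in V (\<lambda>x. dir_deriv u f x / J x)" "smooth_in V (\<lambda>x. - dir_deriv u f x / J x)"
    if "smooth_in V f" for u f
    using that J0 by (simp_all add: smooth_in_divide smooth_in_dir_deriv smooth_in_uminus sJ)
  have "along v X x = 1 \<and> along v Y x = 0 \<and> along w X x = 0 \<and> along w Y x = 1"
    if "x \<in> V" "v x = (dir_deriv (0,1) Y x / J x, - dir_deriv (1,0) Y x / J x)"
       "w x = (- dir_deriv (0,1) X x / J x, dir_deriv (1,0) X x / J x)" for x v w
  proof -
    have "along v X x = (dir_deriv (1,0) X x * dir_deriv (0,1) Y x - dir_deriv (0,1) X x * dir_deriv (1,0) Y x) / J x"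
      "along w Y x = (dir_deriv (1,0) X x * dir_deriv (0,1) Y x - dir_deriv (0,1) X x * dir_deriv (1,0) Y x) / J x"
      using that along_components[OF X that(1)] along_components[OF Y that(1)]
      by (simp_all add: diff_divide_distrib mult.commute)
    then have "along v X x = J x / J x" "along w Y x = J x / J x" by (simp_all only: J_def)
    moreover have "along v Y x = 0" "along w X x = 0"
      using that along_components[OF X that(1)] along_components[OF Y that(1)]
      by (simp_all add: algebra_simps)
    ultimately show ?thesis using J0[OF that(1)] by simp
  qed
  then show ?thesis
    unfolding coordinate_frame_def smooth_field_def fst_conv snd_conv
    using X Y sm by simp
qed

text \<open>The differentials of \<open>X\<close> and \<open>Y\<close> are linearly independent, since \<open>v\<close> and \<open>w\<close> form a dual basis.\<close>

lemma coordinate_frame_zero_vector: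
  assumes "coordinate_frame V X Y v w" "x \<in> V" "dir_deriv u X x = 0" "dir_deriv u Y x = 0"
  shows "u = 0"
proof -
  have X: "smooth_in V X" and Y: "smooth_in V Y"
    and e: "along v X x = 1" "along v Y x = 0" "along w X x = 0" "along w Y x = 1"
    using assms by (auto simp: coordinate_frame_def)
  define p q r s where "p = dir_deriv (1,0) X x" "q = dir_deriv (0,1) X x" "r = dir_deriv (1,0) Y x" "s = dir_deriv (0,1) Y x"
  note d = p_q_r_s_def
  have 1: "fst (v x) * p + snd (v x) * q = 1" "fst (v x) * r + snd (v x) * s = 0"
     "fst (w x) * p + snd (w x) * q = 0" "fst (w x) * r + snd (w x) * s = 1"
    using e along_components[OF X assms(2)] along_components[OF Y assms(2)] by (auto simp: d)
  have 2: "fst u * p + snd u * q = 0" "fst u * r + snd u * s = 0"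
    using assms(3,4) dir_deriv_components[OF X assms(2), of u] dir_deriv_components[OF Y assms(2), of u] by (auto simp: d)
  have "(p * s - q * r) * (fst (v x) * snd (w x) - snd (v x) * fst (w x)) = 1"
    using 1 by algebra
  then have nz: "p * s - q * r \<noteq> 0" by auto
  have "fst u * (p * s - q * r) = 0" "snd u * (p * s - q * r) = 0"
    using 2 by algebra+
  then show ?thesis using nz by (simp add: prod_eq_iff)
qed

text \<open>The commutator of two derivations is a derivation along some field \<open>u\<close>. It kills \<open>X\<close> and \<open>Y\<close>, because
\<open>v\<close> and \<open>w\<close> map them to constants, hence \<open>u = 0\<close>.\<close>

lemma coordinate_frame_commute:
  assumes fr: "coordinate_frame V X Y v w" and f: "smooth_in V f" and x: "x \<in> V"
  shows "along v (along w f) x = along w (along v f) x"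
proof -
  have X: "smooth_in V X" and Y: "smooth_in V Y" and v: "smooth_field V v" and w: "smooth_field V w"
    and e: "\<And>x. x \<in> V \<Longrightarrow> along v X x = 1" "\<And>x. x \<in> V \<Longrightarrow> along v Y x = 0"
      "\<And>x. x \<in> V \<Longrightarrow> along w X x = 0" "\<And>x. x \<in> V \<Longrightarrow> along w Y x = 1"
    using fr by (auto simp: coordinate_frame_def)
  define u where "u = (along v (\<lambda>x. fst (w x)) x - along w (\<lambda>x. fst (v x)) x,
       along v (\<lambda>x. snd (w x)) x - along w (\<lambda>x. snd (v x)) x)"
  have br: "along v (along w g) x - along w (along v g) x = dir_deriv u g x" if g: "smooth_in V g" for g
    using along_along_components[OF g w x, of v] along_along_components[OF g v x, of w]
      dir_deriv_commute[OF g x, of "v x" "w x"] dir_deriv_components[OF g x, of u]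
    by (simp add: u_def algebra_simps)
  have c: "along a (along b g) x = 0" if "smooth_in V g" "smooth_field V b" "\<And>x. x \<in> V \<Longrightarrow> along b g x = k" for a b g k
    using along_cong[OF smooth_in_along[OF that(1,2)] x that(3), of a] by (simp add: along_const)
  have "dir_deriv u X x = 0" "dir_deriv u Y x = 0"
    using br[OF X] br[OF Y] c[OF X w e(3)] c[OF X v e(1)] c[OF Y w e(4)] c[OF Y v e(2)] by simp_all
  then have "u = 0" by (rule coordinate_frame_zero_vector[OF fr x])
  moreover have "dir_deriv 0 f x = 0"
    using dir_deriv_components[OF f x, of 0] by simp
  ultimately show ?thesis using br[OF f] by simp
qed

lemma coordinate_frame_critical:
  assumes fr: "coordinate_frame V X Y v w" and g: "smooth_in V g" and x: "x \<in> V"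
    and 0: "along v g x = 0" "along w g x = 0"
  shows "dir_deriv u g x = 0"
proof -
  have X: "smooth_in V X" and Y: "smooth_in V Y"
    and e: "along v X x = 1" "along v Y x = 0" "along w X x = 0" "along w Y x = 1"
    using fr x by (auto simp: coordinate_frame_def)
  have lin: "linear (frechet_derivative h (at x))" if "smooth_in V h" for h :: "real \<times> real \<Rightarrow> real"
    using smooth_in_has_derivative[OF that x] has_derivative_linear by blast
  let ?u = "u - (dir_deriv u X x *\<^sub>R v x + dir_deriv u Y x *\<^sub>R w x)"
  have "dir_deriv ?u X x = 0" "dir_deriv ?u Y x = 0"
    using e by (simp_all add: linear_diff[OF lin] linear_add[OF lin] linear_scale[OF lin] X Y along_def)
  then have "?u = 0" by (rule coordinate_frame_zero_vector[OF fr x])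
  then have u: "u = dir_deriv u X x *\<^sub>R v x + dir_deriv u Y x *\<^sub>R w x" unfolding right_minus_eq .
  have "dir_deriv (\<alpha> *\<^sub>R v x + \<beta> *\<^sub>R w x) g x = 0" for \<alpha> \<beta>
    using 0 by (simp add: linear_add[OF lin] linear_scale[OF lin] g along_def)
  then show ?thesis using u by metis
qed

section \<open>Hilbert's argument at a maximum of the mean curvature\<close>

text \<open>Here \<open>A\<close>, \<open>B\<close>, \<open>C\<close> are the fourth derivatives \<open>z\<^sub>x\<^sub>x\<^sub>x\<^sub>x\<close>, \<open>z\<^sub>x\<^sub>x\<^sub>y\<^sub>y\<close>, \<open>z\<^sub>y\<^sub>y\<^sub>y\<^sub>y\<close> of a graph with principal curvatures
\<open>k\<close> and \<open>l\<close> and vanishing third derivatives. The equations are the second derivatives of the curvature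
equation and the inequalities are the second derivative test for the mean curvature. The combination
\<open>l * Rx + k * Ry\<close> is chosen such that the equations eliminate all fourth derivatives.\<close>

lemma hilbert_inequality:
  fixes k l :: real
  assumes k: "k > 0" and l: "l > 0"
    and Qx: "l * A + k * B = 4 * (k * l) * k\<^sup>2" and Qy: "l * B + k * C = 4 * (k * l) * l\<^sup>2"
    and Rx: "(k + l) * (A + B + 2 * k\<^sup>2 * l) - 3 * (k + l)\<^sup>2 * k\<^sup>2 \<le> 0"
    and Ry: "(k + l) * (C + B + 2 * l\<^sup>2 * k) - 3 * (k + l)\<^sup>2 * l\<^sup>2 \<le> 0"
  shows "k = l"
proof -
  have s: "k + l > 0" using k l by simp
  have "(k + l) * (A + B + 2 * k\<^sup>2 * l - 3 * (k + l) * k\<^sup>2) \<le> 0" using Rx by (simp add: algebra_simps power2_eq_square)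
  then have 1: "A + B + 2 * k\<^sup>2 * l - 3 * (k + l) * k\<^sup>2 \<le> 0" using s by (simp add: mult_le_0_iff)
  have "(k + l) * (C + B + 2 * l\<^sup>2 * k - 3 * (k + l) * l\<^sup>2) \<le> 0" using Ry by (simp add: algebra_simps power2_eq_square)
  then have 2: "C + B + 2 * l\<^sup>2 * k - 3 * (k + l) * l\<^sup>2 \<le> 0" using s by (simp add: mult_le_0_iff)
  have "l * (A + B + 2 * k\<^sup>2 * l - 3 * (k + l) * k\<^sup>2) + k * (C + B + 2 * l\<^sup>2 * k - 3 * (k + l) * l\<^sup>2) \<le> 0"
    using 1 2 k l by (intro add_nonpos_nonpos mult_nonneg_nonpos) auto
  moreover have "l * (A + B + 2 * k\<^sup>2 * l - 3 * (k + l) * k\<^sup>2) + k * (C + B + 2 * l\<^sup>2 * k - 3 * (k + l) * l\<^sup>2)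
     = (l * A + k * B) + (l * B + k * C) + 4 * k\<^sup>2 * l\<^sup>2 - 3 * (k * l) * (k + l)\<^sup>2"
    by (simp add: algebra_simps power2_eq_square)
  moreover have "\<dots> = (k * l) * (k - l)\<^sup>2"
    unfolding Qx Qy by (simp add: algebra_simps power2_eq_square)
  ultimately have "(k * l) * (k - l)\<^sup>2 \<le> 0" by simp
  then have "(k - l)\<^sup>2 \<le> 0" using k l by (simp add: mult_le_0_iff zero_less_mult_iff)
  then show ?thesis by simp
qed

text \<open>The graph \<open>Z\<close> over the coordinates \<open>X\<close>, \<open>Y\<close> has Gauss curvature \<open>(z\<^sub>x\<^sub>x * z\<^sub>y\<^sub>y - z\<^sub>x\<^sub>y\<^sup>2) / W\<^sup>2\<close> and mean curvature
\<open>M / (2 * W powr (3/2))\<close>. Both conditions are stated without roots and quotients, as \<open>Q = 0\<close> and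
\<open>R \<le> 0\<close> for polynomials in derivatives of \<open>Z\<close>, with equality \<open>R = 0\<close> at \<open>x\<close>. The relation \<open>Q = 0\<close>
and its derivatives hold up to the boundary. The assumptions \<open>bd\<close> are those of a free boundary point:
\<open>\<partial>/\<partial>X\<close> is tangent to the boundary, \<open>\<partial>/\<partial>Y\<close> points inwards at \<open>x\<close>, and \<open>Z\<close> has zero
derivative in the direction \<open>\<partial>/\<partial>Y\<close> along the boundary.\<close>

lemma umbilic_at_max_mean_curvature:
  fixes X Y Z :: "real \<times> real \<Rightarrow> real" and v w :: "real \<times> real \<Rightarrow> real \<times> real"
  assumes fr: "coordinate_frame V X Y v w" and Z: "smooth_in V Z" and x: "x \<in> V \<inter> half_plane"
  defines "zx \<equiv> along v Z" and "zy \<equiv> along w Z"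
  defines "zxx \<equiv> along v zx" and "zxy \<equiv> along v zy" and "zyy \<equiv> along w zy"
  defines "W \<equiv> \<lambda>p. 1 + zx p * zx p + zy p * zy p"
  defines "M \<equiv> \<lambda>p. (1 + zy p * zy p) * zxx p - 2 * (zx p * zy p * zxy p) + (1 + zx p * zx p) * zyy p"
  assumes 0: "zx x = 0" "zy x = 0" "zxy x = 0" and pos: "zxx x > 0" "zyy x > 0"
    and K: "\<And>p. p \<in> V \<inter> half_plane \<Longrightarrow> zxx p * zyy p - zxy p * zxy p = h * (W p * W p)"
    and H: "\<And>p. p \<in> V \<inter> half_plane \<Longrightarrow> M p * M p \<le> (zxx x + zyy x)\<^sup>2 * (W p * W p * W p)"
    and bd: "snd x = 0 \<Longrightarrow> snd (w x) > 0"
      "\<And>p. snd x = 0 \<Longrightarrow> p \<in> V \<Longrightarrow> snd p = 0 \<Longrightarrow> snd (v p) = 0"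
      "\<And>p. snd x = 0 \<Longrightarrow> p \<in> V \<Longrightarrow> snd p = 0 \<Longrightarrow> zy p = 0"
  shows "zxx x = zyy x"
proof (rule ccontr)
  assume ne: "zxx x \<noteq> zyy x"
  define k l where "k = zxx x" and "l = zyy x"
  have v: "smooth_field V v" and w: "smooth_field V w" and V: "open V"
    using fr by (auto simp: coordinate_frame_def smooth_in_open)
  have xV: "x \<in> V" using x by simp
  note al = smooth_in_along[OF _ v] smooth_in_along[OF _ w]
  have szx: "smooth_in V zx" and szy: "smooth_in V zy" unfolding zx_def zy_def by (intro al Z)+
  have szxx: "smooth_in V zxx" and szxy: "smooth_in V zxy" and szyy: "smooth_in V zyy"
    unfolding zxx_def zxy_def zyy_def by (intro al szx szy)+
  note [simp] = szx szy szxx szxy szyy smooth_in_const[OF V] smooth_in_mult smooth_in_add smooth_in_diff smooth_in_uminus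
  define a b c d where "a = along v zxx" and "b = along v zxy" and "c = along w zxy" and "d = along w zyy"
  have s3: "smooth_in V a" "smooth_in V b" "smooth_in V c" "smooth_in V d"
    unfolding a_def b_def c_def d_def by (intro al szxx szxy szyy)+
  note [simp] = s3
  note comm = coordinate_frame_commute[OF fr]
  \<comment> \<open>Commuting the two fields reduces mixed derivatives to \<open>a\<close>, \<open>b\<close>, \<open>c\<close>, \<open>d\<close>, which are \<open>z\<^sub>x\<^sub>x\<^sub>x\<close>, \<open>z\<^sub>x\<^sub>x\<^sub>y\<close>, \<open>z\<^sub>x\<^sub>y\<^sub>y\<close>, \<open>z\<^sub>y\<^sub>y\<^sub>y\<close>.\<close>
  have wzx: "along w zx p = zxy p" if "p \<in> V" for p
    unfolding zx_def zxy_def zy_def by (rule comm[OF Z that, symmetric])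
  have wzxx: "along w zxx p = b p" if "p \<in> V" for p
  proof -
    have "along w zxx p = along v (along w zx) p" unfolding zxx_def by (rule comm[OF szx that, symmetric])
    also have "\<dots> = b p" unfolding b_def by (rule along_cong[OF al(2)[OF szx] that wzx])
    finally show ?thesis .
  qed
  have vzyy: "along v zyy p = c p" if "p \<in> V" for p
    unfolding zyy_def c_def zxy_def by (rule comm[OF szy that])
  have wb: "along w b p = along v c p" if "p \<in> V" for p
    unfolding b_def c_def by (rule comm[OF szxy that, symmetric])
  have d0: "along v zx p = zxx p" "along v zy p = zxy p" "along w zy p = zyy p" for p
    by (simp_all only: zxx_def zxy_def zyy_def)
  have d0': "along v zxx p = a p" "along v zxy p = b p" "along w zxy p = c p" "along w zyy p = d p" for p
    by (simp_all only: a_def b_def c_def d_def)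
  note d1 = wzx wzxx vzyy d0 d0'
  note ru = along_uminus[of V] along_add[of V] along_diff[of V] along_mult[of V] along_const
  define Q where "Q = (\<lambda>p. zxx p * zyy p - zxy p * zxy p - h * (W p * W p))"
  have sW: "smooth_in V W" unfolding W_def by simp
  have sM: "smooth_in V M" unfolding M_def by simp
  have sQ: "smooth_in V Q" unfolding Q_def using sW by simp
  define R where "R = (\<lambda>p. M p * M p - (k + l)\<^sup>2 * (W p * W p * W p))"
  have sR: "smooth_in V R" unfolding R_def using sW sM by simp
  note [simp] = sW sM sQ sR
  have Wv: "along v W p = 2 * (zx p * zxx p + zy p * zxy p)"
   and Ww: "along w W p = 2 * (zx p * zxy p + zy p * zyy p)" if "p \<in> V" for p
    unfolding W_def using that by (simp_all add: ru d1 algebra_simps)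
  have Wvv: "along v (along v W) x = 2 * (k * k)"
    using along_cong[OF al(1)[OF sW] xV Wv, of v] xV by (simp add: ru d1 0 k_def)
  have Www: "along w (along w W) x = 2 * (l * l)"
    using along_cong[OF al(2)[OF sW] xV Ww, of w] xV by (simp add: ru d1 0 l_def)
  have W0: "W x = 1" "along v W x = 0" "along w W x = 0" using Wv[OF xV] Ww[OF xV] by (simp_all add: 0) (simp add: W_def 0)
  have Mv: "along v M p = (1 + zy p * zy p) * a p + 2 * (zy p * zxy p) * zxx p - 2 * (zxx p * zy p * zxy p + zx p * zxy p * zxy p + zx p * zy p * b p)
      + (1 + zx p * zx p) * c p + 2 * (zx p * zxx p) * zyy p"
   and Mw: "along w M p = (1 + zy p * zy p) * b p + 2 * (zy p * zyy p) * zxx p - 2 * (zxy p * zy p * zxy p + zx p * zyy p * zxy p + zx p * zy p * c p)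
      + (1 + zx p * zx p) * d p + 2 * (zx p * zxy p) * zyy p" if "p \<in> V" for p
    unfolding M_def using that by (simp_all add: ru d1 algebra_simps)
  have M0: "M x = k + l" "along v M x = a x + c x" "along w M x = b x + d x"
    using xV by (simp_all add: Mv Mw 0) (simp add: M_def 0 k_def l_def)
  have Mvv: "along v (along v M) x = along v a x + along v c x + 2 * k\<^sup>2 * l"
    using along_cong[OF al(1)[OF sM] xV Mv, of v] xV
    by (simp add: ru d1 0 k_def l_def power2_eq_square)
  have Mww: "along w (along w M) x = along w b x + along w d x + 2 * l\<^sup>2 * k"
    using along_cong[OF al(2)[OF sM] xV Mw, of w] xV
    by (simp add: ru d1 0 k_def l_def power2_eq_square)
  have Rv: "along v R p = 2 * (M p * along v M p) - 3 * (k + l)\<^sup>2 * (W p * W p * along v W p)"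
    and Rw: "along w R p = 2 * (M p * along w M p) - 3 * (k + l)\<^sup>2 * (W p * W p * along w W p)" if "p \<in> V" for p
    unfolding R_def using that by (simp_all add: ru algebra_simps)
  have Rvv: "along v (along v R) x = 2 * ((a x + c x)\<^sup>2 + (k + l) * along v (along v M) x) - 3 * (k + l)\<^sup>2 * along v (along v W) x"
    using along_cong[OF al(1)[OF sR] xV Rv, of v] xV
    by (simp add: ru al W0 M0 power2_eq_square algebra_simps)
  have Rww: "along w (along w R) x = 2 * ((b x + d x)\<^sup>2 + (k + l) * along w (along w M) x) - 3 * (k + l)\<^sup>2 * along w (along w W) x"
    using along_cong[OF al(2)[OF sR] xV Rw, of w] xV
    by (simp add: ru al W0 M0 power2_eq_square algebra_simps)
  have Qv: "along v Q p = a p * zyy p + zxx p * c p - 2 * (zxy p * b p) - 2 * (h * (W p * along v W p))"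
   and Qw: "along w Q p = b p * zyy p + zxx p * d p - 2 * (zxy p * c p) - 2 * (h * (W p * along w W p))" if "p \<in> V" for p
    unfolding Q_def using that by (simp_all add: ru d1 algebra_simps)
  have Qvv: "along v (along v Q) x = along v a x * l + 2 * (a x * c x) + k * along v c x - 2 * (b x)\<^sup>2 - 4 * (h * (k * k))"
    using along_cong[OF al(1)[OF sQ] xV Qv, of v] xV
    by (simp add: ru al d1 0 W0 Wvv k_def l_def power2_eq_square algebra_simps)
  have Qww: "along w (along w Q) x = along w b x * l + 2 * (b x * d x) + k * along w d x - 2 * (c x)\<^sup>2 - 4 * (h * (l * l))"
    using along_cong[OF al(2)[OF sQ] xV Qw, of w] xV
    by (simp add: ru al d1 0 W0 Www k_def l_def power2_eq_square algebra_simps)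
  have Qz: "Q p = 0" if "p \<in> V \<inter> half_plane" for p using K[OF that] by (simp add: Q_def)
  have Q1: "along u Q p = 0" if "p \<in> V \<inter> half_plane" for p u
    unfolding along_def by (rule dir_deriv_zero_on_half_plane[OF sQ that Qz])
  have Q2: "along v (along v Q) x = 0" "along w (along w Q) x = 0"
    unfolding along_def[of v "along v Q"] along_def[of w "along w Q"]
    by (rule dir_deriv_zero_on_half_plane[OF al(1)[OF sQ] x Q1], assumption,
        rule dir_deriv_zero_on_half_plane[OF al(2)[OF sQ] x Q1])
  have h: "h = k * l" using K[OF x] by (simp add: 0 W0 k_def l_def)
  have Rle: "R p \<le> R x" if "p \<in> V \<inter> half_plane" for p
    using H[OF that] by (simp add: R_def W0 M0 k_def l_def power2_eq_square)
  have kl: "k > 0" "l > 0" using pos by (simp_all add: k_def l_def)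
  have q1: "a x * l + k * c x = 0" and q2: "b x * l + k * d x = 0"
    using Qv[OF xV] Qw[OF xV] Q1[OF x] xV by (simp_all add: W0 0 k_def l_def)
  have xh: "0 \<le> snd x" using x by (simp add: half_plane_def)
  have Rc: "along v R x = 0 \<and> along w R x = 0 \<and> (0 \<le> snd (v x) \<or> 0 < snd x) \<and> (0 \<le> snd (w x) \<or> 0 < snd x)"
  proof (cases "snd x = 0")
    case False
    then have "0 < snd x" using xh by simp
    have "dir_deriv u R x = 0" for u
      by (rule dir_deriv_zero_at_max[OF sR x Rle]) (use \<open>0 < snd x\<close> in auto)
    then show ?thesis unfolding along_def using \<open>0 < snd x\<close> by simp
  next
    case True
    note bd = bd(1)[OF True] bd(2)[OF True] bd(3)[OF True]
    have tang: "along v g p = 0" if "smooth_in V g" "p \<in> V" "snd p = 0" "\<And>p. p \<in> V \<Longrightarrow> snd p = 0 \<Longrightarrow> g p = 0" for g p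
      unfolding along_def by (rule dir_deriv_zero_on_boundary[OF that(1,2)]) (use that bd(2) in auto)
    \<comment> \<open>Along the boundary \<open>z\<^sub>y = 0\<close>; differentiating tangentially gives \<open>z\<^sub>x\<^sub>y = 0\<close> and \<open>z\<^sub>x\<^sub>x\<^sub>y = 0\<close>.\<close>
    have zxy0: "zxy p = 0" if "p \<in> V" "snd p = 0" for p
      unfolding zxy_def using tang[OF szy that bd(3)] .
    have "b x = 0" unfolding b_def using tang[OF szxy xV True zxy0] .
    \<comment> \<open>The curvature equation, differentiated in the inward direction, gives \<open>z\<^sub>y\<^sub>y\<^sub>y = 0\<close>, so \<open>R\<close> is critical.\<close>
    then have "d x = 0" using q2 kl by simp
    then have Rw0: "along w R x = 0" using Rw[OF xV] xV \<open>b x = 0\<close> by (simp add: W0 M0)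
    have "along v R x = 0"
      unfolding along_def by (rule dir_deriv_zero_at_max[OF sR x Rle]) (use bd(2)[OF xV True] in auto)
    then show ?thesis using Rw0 bd(1) bd(2)[OF xV True] by simp
  qed
  then have crit: "dir_deriv u R x = 0" for u
    using coordinate_frame_critical[OF fr sR xV] by blast
  have r1: "a x + c x = 0" and r2: "b x + d x = 0"
    using Rc Rv[OF xV] Rw[OF xV] xV kl by (auto simp: W0 M0)
  \<comment> \<open>Two linear systems for \<open>(a, c)\<close> and \<open>(b, d)\<close>, with determinant \<open>l - k\<close>.\<close>
  have "a x * (l - k) = 0" "b x * (l - k) = 0" using q1 q2 r1 r2 by algebra+
  then have third: "a x = 0" "b x = 0" "c x = 0" "d x = 0"
    using ne r1 r2 by (auto simp: k_def l_def)
  have "along v (along v R) x \<le> 0" "along w (along w R) x \<le> 0"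
    using along_along_at_max[OF sR v x Rle _ crit] along_along_at_max[OF sR w x Rle _ crit] Rc by blast+
  then have "k = l"
    using hilbert_inequality[OF kl, of "along v a x" "along v c x" "along w d x"]
      Q2 Qvv Qww Rvv Rww wb[OF xV] third
    by (simp add: Mvv Mww Wvv Www h power2_eq_square algebra_simps)
  then show False using ne by (simp add: k_def l_def)
qed

section \<open>Linear algebra of tangent planes\<close>

text \<open>The remainder is orthogonal to all three vectors, and four nonzero pairwise orthogonal vectors do not
fit into dimension three.\<close>

lemma orthonormal_expansion:
  fixes e1 e2 e3 x :: "real^3"
  assumes "norm e1 = 1" "norm e2 = 1" "norm e3 = 1" "e1 \<bullet> e2 = 0" "e1 \<bullet> e3 = 0" "e2 \<bullet> e3 = 0"
  shows "x = (x \<bullet> e1) *\<^sub>R e1 + (x \<bullet> e2) *\<^sub>R e2 + (x \<bullet> e3) *\<^sub>R e3"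
proof (rule ccontr)
  assume ne: "\<not> ?thesis"
  define r where "r = x - ((x \<bullet> e1) *\<^sub>R e1 + (x \<bullet> e2) *\<^sub>R e2 + (x \<bullet> e3) *\<^sub>R e3)"
  have r0: "r \<noteq> 0" using ne by (simp add: r_def)
  have n: "e1 \<bullet> e1 = 1" "e2 \<bullet> e2 = 1" "e3 \<bullet> e3 = 1" using assms by (simp_all add: norm_eq_1)
  have r: "r \<bullet> e1 = 0" "r \<bullet> e2 = 0" "r \<bullet> e3 = 0"
    using assms n by (simp_all add: r_def inner_diff_left inner_diff_right inner_add_left inner_add_right inner_commute)
  have nz: "e1 \<noteq> 0" "e2 \<noteq> 0" "e3 \<noteq> 0" using n by auto
  have "e1 \<noteq> e2" "e1 \<noteq> e3" "e2 \<noteq> e3" "r \<noteq> e1" "r \<noteq> e2" "r \<noteq> e3" using assms n r by auto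
  then have "card {r, e1, e2, e3} = 4" by simp
  moreover have "independent {r, e1, e2, e3}"
    using assms r r0 nz
    by (intro pairwise_orthogonal_independent) (auto simp: pairwise_def orthogonal_def inner_commute)
  ultimately show False using independent_bound[of "{r, e1, e2, e3}"] by simp
qed

lemma orthonormal_frame_exists:
  fixes e3 :: "real^3"
  assumes "norm e3 = 1"
  obtains e1 e2 where "norm e1 = 1" "norm e2 = 1" "e1 \<bullet> e2 = 0" "e1 \<bullet> e3 = 0" "e2 \<bullet> e3 = 0"
proof -
  obtain y where y: "y \<noteq> 0" "orthogonal e3 y"
    using orthogonal_to_vector_exists[of e3] by auto
  define e1 where "e1 = y /\<^sub>R norm y"
  have 1: "norm e1 = 1" "e1 \<bullet> e3 = 0" using y by (auto simp: e1_def orthogonal_def inner_commute)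
  have "(norm (cross3 e3 e1))\<^sup>2 = 1\<^sup>2"
    using norm_cross_dot[of e3 e1] 1 assms by (simp add: inner_commute)
  then have "norm (cross3 e3 e1) = 1" by (simp only: power2_eq_iff_nonneg norm_ge_zero zero_le_one)
  then show ?thesis using that[of e1 "cross3 e3 e1"] 1 by (simp add: dot_cross_self inner_commute)
qed

text \<open>The spectral theorem for the plane orthogonal to \<open>\<eta>\<close>. When the matrix \<open>(p, r; r, q)\<close> in some orthonormal
basis is not diagonal, \<open>(r, k - p)\<close> is an eigenvector for the root \<open>k\<close> of the characteristic
polynomial, and its rotation by a right angle is one for the other root \<open>l\<close>.\<close>

lemma self_adjoint_eigenbasis:
  fixes \<eta> :: "real^3" and A :: "real^3 \<Rightarrow> real^3"
  assumes \<eta>: "norm \<eta> = 1"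
    and T: "\<And>Y. Y \<bullet> \<eta> = 0 \<Longrightarrow> A Y \<bullet> \<eta> = 0"
    and lin: "\<And>Y Z s t. Y \<bullet> \<eta> = 0 \<Longrightarrow> Z \<bullet> \<eta> = 0 \<Longrightarrow> A (s *\<^sub>R Y + t *\<^sub>R Z) = s *\<^sub>R A Y + t *\<^sub>R A Z"
    and sa: "\<And>Y Z. Y \<bullet> \<eta> = 0 \<Longrightarrow> Z \<bullet> \<eta> = 0 \<Longrightarrow> A Y \<bullet> Z = Y \<bullet> A Z"
  obtains e1 e2 k1 k2 where "norm e1 = 1" "norm e2 = 1" "e1 \<bullet> e2 = 0" "e1 \<bullet> \<eta> = 0" "e2 \<bullet> \<eta> = 0"
    "A e1 = k1 *\<^sub>R e1" "A e2 = k2 *\<^sub>R e2" "k2 \<le> k1"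
proof -
  obtain f g where fg: "norm f = 1" "norm g = 1" "f \<bullet> g = 0" "f \<bullet> \<eta> = 0" "g \<bullet> \<eta> = 0"
    using orthonormal_frame_exists[OF \<eta>] by blast
  define p q r where "p = A f \<bullet> f" and "q = A g \<bullet> g" and "r = A f \<bullet> g"
  have r': "A g \<bullet> f = r" using sa[OF fg(5,4)] by (simp add: r_def inner_commute)
  have Af: "A f = p *\<^sub>R f + r *\<^sub>R g" and Ag: "A g = r *\<^sub>R f + q *\<^sub>R g"
    using orthonormal_expansion[OF fg(1,2) \<eta> fg(3-5), of "A f"] orthonormal_expansion[OF fg(1,2) \<eta> fg(3-5), of "A g"]
      T[OF fg(4)] T[OF fg(5)] r' by (simp_all add: p_def q_def r_def)
  have fg': "f \<bullet> f = 1" "g \<bullet> g = 1" "g \<bullet> f = 0" using fg by (simp_all add: norm_eq_1 inner_commute)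
  have "\<exists>a b k l. a\<^sup>2 + b\<^sup>2 = 1 \<and> a * p + b * r = k * a \<and> a * r + b * q = k * b \<and> - b * p + a * r = l * (- b) \<and> - b * r + a * q = l * a"
  proof (cases "r = 0")
    case True
    then show ?thesis by (intro exI[of _ 1] exI[of _ 0] exI[of _ p] exI[of _ q]) simp
  next
    case False
    define D where "D = sqrt ((p - q)\<^sup>2 + 4 * r\<^sup>2)"
    define k where "k = (p + q + D) / 2"
    define l where "l = (p + q - D) / 2"
    define N where "N = sqrt (r\<^sup>2 + (k - p)\<^sup>2)"
    have D2: "D\<^sup>2 = (p - q)\<^sup>2 + 4 * r\<^sup>2" by (simp add: D_def)
    have kl: "k + l = p + q" "k * l = p * q - r\<^sup>2"
      using D2 by (simp_all add: k_def l_def field_simps power2_eq_square)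
    have N2: "N\<^sup>2 = r\<^sup>2 + (k - p)\<^sup>2" by (simp add: N_def)
    have "r\<^sup>2 + (k - p)\<^sup>2 > 0" using False by (simp add: add_pos_nonneg)
    then have N0: "N > 0" by (simp add: N_def)
    define a where "a = r / N"
    define b where "b = (k - p) / N"
    have ab: "a\<^sup>2 + b\<^sup>2 = 1" using N2 N0 unfolding a_def b_def power_divide
      by (metis add_divide_distrib div_self less_irrefl zero_less_power)
    have char: "r * r + (k - p) * q = k * (k - p)"
      using kl unfolding power2_eq_square by algebra
    have l: "l = p + q - k" using kl by simp
    have aN: "a * N = r" and bN: "b * N = k - p" using N0 by (simp_all add: a_def b_def)
    have "N * (a * p + b * r - k * a) = (a * N) * p + (b * N) * r - k * (a * N)"
      "N * (a * r + b * q - k * b) = (a * N) * r + (b * N) * q - k * (b * N)"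
      "N * (- b * p + a * r - l * (- b)) = - (b * N) * p + (a * N) * r + l * (b * N)"
      "N * (- b * r + a * q - l * a) = - (b * N) * r + (a * N) * q - l * (a * N)"
      by (simp_all add: algebra_simps)
    moreover have "r * r = k * (k - p) - (k - p) * q" using char by simp
    ultimately have "N * (a * p + b * r - k * a) = 0" "N * (a * r + b * q - k * b) = 0"
      "N * (- b * p + a * r - l * (- b)) = 0" "N * (- b * r + a * q - l * a) = 0"
      unfolding aN bN l by (simp_all add: algebra_simps)
    then have "a * p + b * r = k * a" "a * r + b * q = k * b"
      "- b * p + a * r = l * (- b)" "- b * r + a * q = l * a"
      using N0 by simp_all
    then show ?thesis using ab by blast
  qed
  then obtain a b k l where ab: "a\<^sup>2 + b\<^sup>2 = 1" and kl: "a * p + b * r = k * a" "a * r + b * q = k * b"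
      "- b * p + a * r = l * (- b)" "- b * r + a * q = l * a" by blast
  define u where "u = a *\<^sub>R f + b *\<^sub>R g"
  define v where "v = (- b) *\<^sub>R f + a *\<^sub>R g"
  have uv: "norm u = 1" "norm v = 1" "u \<bullet> v = 0" "u \<bullet> \<eta> = 0" "v \<bullet> \<eta> = 0"
    using ab fg fg' by (simp_all add: norm_eq_1 u_def v_def inner_add_left inner_add_right power2_eq_square algebra_simps)
  have "A u = a *\<^sub>R A f + b *\<^sub>R A g" "A v = (- b) *\<^sub>R A f + a *\<^sub>R A g"
    unfolding u_def v_def by (intro lin fg)+
  moreover have "a *\<^sub>R A f + b *\<^sub>R A g = (a * p + b * r) *\<^sub>R f + (a * r + b * q) *\<^sub>R g"
     "(- b) *\<^sub>R A f + a *\<^sub>R A g = (- b * p + a * r) *\<^sub>R f + (- b * r + a * q) *\<^sub>R g"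
    by (simp_all add: Af Ag algebra_simps)
  ultimately have "A u = (k * a) *\<^sub>R f + (k * b) *\<^sub>R g" "A v = (l * (- b)) *\<^sub>R f + (l * a) *\<^sub>R g"
    unfolding kl by simp_all
  then have Au: "A u = k *\<^sub>R u" "A v = l *\<^sub>R v"
    by (simp_all add: u_def v_def scaleR_add_right scaleR_diff_right)
  show ?thesis
  proof (cases "l \<le> k")
    case True
    then show ?thesis using that[of u v k l] uv Au by blast
  next
    case False
    then show ?thesis using that[of v u l k] uv Au by (simp add: inner_commute)
  qed
qed

text \<open>The eigenvalues of \<open>A\<close> read off from an arbitrary pair of vectors in the plane, as in the classical formula for the curvatures in terms of the two fundamental forms.\<close>

lemma eigenbasis_determinants:
  fixes \<eta> U W :: "real^3" and A :: "real^3 \<Rightarrow> real^3"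
  assumes e: "norm e1 = 1" "norm e2 = 1" "norm \<eta> = 1" "e1 \<bullet> e2 = 0" "e1 \<bullet> \<eta> = 0" "e2 \<bullet> \<eta> = 0"
    and lin: "\<And>Y Z s t. Y \<bullet> \<eta> = 0 \<Longrightarrow> Z \<bullet> \<eta> = 0 \<Longrightarrow> A (s *\<^sub>R Y + t *\<^sub>R Z) = s *\<^sub>R A Y + t *\<^sub>R A Z"
    and A: "A e1 = k1 *\<^sub>R e1" "A e2 = k2 *\<^sub>R e2" and UW: "U \<bullet> \<eta> = 0" "W \<bullet> \<eta> = 0"
  shows "(A U \<bullet> U) * (A W \<bullet> W) - (A U \<bullet> W)\<^sup>2 = k1 * k2 * ((U \<bullet> U) * (W \<bullet> W) - (U \<bullet> W)\<^sup>2)"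
    and "(A U \<bullet> U) * (W \<bullet> W) - 2 * (A U \<bullet> W) * (U \<bullet> W) + (A W \<bullet> W) * (U \<bullet> U)
       = (k1 + k2) * ((U \<bullet> U) * (W \<bullet> W) - (U \<bullet> W)\<^sup>2)"
proof -
  define a b c d where "a = U \<bullet> e1" and "b = U \<bullet> e2" and "c = W \<bullet> e1" and "d = W \<bullet> e2"
  have U: "U = a *\<^sub>R e1 + b *\<^sub>R e2" and W: "W = c *\<^sub>R e1 + d *\<^sub>R e2"
    using orthonormal_expansion[OF e, of U] orthonormal_expansion[OF e, of W] UW by (simp_all add: a_def b_def c_def d_def)
  have AU: "A U = (a * k1) *\<^sub>R e1 + (b * k2) *\<^sub>R e2" and AW: "A W = (c * k1) *\<^sub>R e1 + (d * k2) *\<^sub>R e2"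
    using lin[OF e(5,6)] by (simp_all add: U W A)
  have n: "e1 \<bullet> e1 = 1" "e2 \<bullet> e2 = 1" "e1 \<bullet> e2 = 0" "e2 \<bullet> e1 = 0" using e by (simp_all add: norm_eq_1 inner_commute)
  have i: "(s *\<^sub>R e1 + t *\<^sub>R e2) \<bullet> (s' *\<^sub>R e1 + t' *\<^sub>R e2) = s * s' + t * t'" for s t s' t'
    by (simp add: inner_add_left inner_add_right n)
  have g: "U \<bullet> U = a * a + b * b" "W \<bullet> W = c * c + d * d" "U \<bullet> W = a * c + b * d"
    "A U \<bullet> U = a * k1 * a + b * k2 * b" "A W \<bullet> W = c * k1 * c + d * k2 * d" "A U \<bullet> W = a * k1 * c + b * k2 * d"
    unfolding AU AW unfolding U W i by simp_all
  show "(A U \<bullet> U) * (A W \<bullet> W) - (A U \<bullet> W)\<^sup>2 = k1 * k2 * ((U \<bullet> U) * (W \<bullet> W) - (U \<bullet> W)\<^sup>2)"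
    unfolding g by algebra
  show "(A U \<bullet> U) * (W \<bullet> W) - 2 * (A U \<bullet> W) * (U \<bullet> W) + (A W \<bullet> W) * (U \<bullet> U)
       = (k1 + k2) * ((U \<bullet> U) * (W \<bullet> W) - (U \<bullet> W)\<^sup>2)"
    unfolding g by algebra
qed

text \<open>Orthogonality to \<open>\<eta>\<close> and \<open>U\<close> leaves a line, the norm leaves two opposite vectors, and the sign of the
product with \<open>W\<close> selects one of them.\<close>

lemma plane_normal_direction:
  fixes U W \<eta> :: "real^3"
  assumes \<eta>: "norm \<eta> = 1" and t: "U \<bullet> \<eta> = 0" "W \<bullet> \<eta> = 0" and ind: "\<And>a b. a *\<^sub>R U + b *\<^sub>R W = 0 \<Longrightarrow> a = 0 \<and> b = 0"
  shows "\<exists>!\<nu>. \<nu> \<bullet> \<eta> = 0 \<and> norm \<nu> = 1 \<and> \<nu> \<bullet> U = 0 \<and> \<nu> \<bullet> W < 0"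
proof -
  have U0: "U \<noteq> 0" using ind[of 1 0] by auto
  define e1 where "e1 = U /\<^sub>R norm U"
  have e1: "norm e1 = 1" "e1 \<bullet> \<eta> = 0" using U0 t by (auto simp: e1_def)
  have Ue: "U = norm U *\<^sub>R e1" using U0 by (simp add: e1_def)
  define e2 where "e2 = cross3 \<eta> e1"
  have e2: "e1 \<bullet> e2 = 0" "e2 \<bullet> \<eta> = 0" by (simp_all add: e2_def dot_cross_self)
  have "(norm e2)\<^sup>2 = 1\<^sup>2"
    using norm_cross_dot[of \<eta> e1] e1 \<eta> by (simp add: e2_def inner_commute)
  then have n2: "norm e2 = 1" by (simp only: power2_eq_iff_nonneg norm_ge_zero zero_le_one)
  note ex = orthonormal_expansion[OF e1(1) n2 \<eta> e2(1) e1(2) e2(2)]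
  have W: "W \<bullet> e2 \<noteq> 0"
  proof
    assume "W \<bullet> e2 = 0"
    then have "W = (W \<bullet> e1) *\<^sub>R e1" using ex[of W] t by simp
    moreover have "k *\<^sub>R e1 = (k / norm U) *\<^sub>R U" for k by (simp add: e1_def divide_inverse)
    ultimately have "((W \<bullet> e1) / norm U) *\<^sub>R U + (-1) *\<^sub>R W = 0" by simp
    then show False using ind[of "(W \<bullet> e1) / norm U" "-1"] by simp
  qed
  \<comment> \<open>The sign that turns \<open>e2\<close> against \<open>W\<close>.\<close>
  define s where "s = - sgn (W \<bullet> e2)"
  have s: "s * (W \<bullet> e2) < 0" "s = 1 \<or> s = -1" using W by (auto simp: s_def sgn_if)
  show ?thesis
  proof (rule ex1I[of _ "s *\<^sub>R e2"])
    have "e2 \<bullet> (norm U *\<^sub>R e1) = 0" using e2 by (simp add: inner_commute)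
    then have "e2 \<bullet> U = 0" using Ue by metis
    then show "(s *\<^sub>R e2) \<bullet> \<eta> = 0 \<and> norm (s *\<^sub>R e2) = 1 \<and> (s *\<^sub>R e2) \<bullet> U = 0 \<and> (s *\<^sub>R e2) \<bullet> W < 0"
      using s e2 n2 by (auto simp: inner_commute)
  next
    fix \<nu> assume \<nu>: "\<nu> \<bullet> \<eta> = 0 \<and> norm \<nu> = 1 \<and> \<nu> \<bullet> U = 0 \<and> \<nu> \<bullet> W < 0"
    then have "\<nu> \<bullet> e1 = 0" by (simp add: e1_def)
    then have \<nu>e: "\<nu> = (\<nu> \<bullet> e2) *\<^sub>R e2"
      using ex[of \<nu>] \<nu> by (metis add_0 add.right_neutral scaleR_zero_left)
    define k where "k = \<nu> \<bullet> e2"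
    have \<nu>k: "\<nu> = k *\<^sub>R e2" using \<nu>e unfolding k_def .
    have "\<bar>k\<bar> = 1" using \<nu> n2 by (simp add: \<nu>k)
    moreover have "k * (W \<bullet> e2) < 0" using \<nu> by (simp add: \<nu>k inner_commute)
    ultimately have "k = s" using s by (cases "k = 1") (auto simp: abs_if split: if_splits)
    then show "\<nu> = s *\<^sub>R e2" using \<nu>k by simp
  qed
qed

section \<open>Spheres as surfaces of revolution\<close>

text \<open>The family of all such curves, for varying \<open>A\<close> and \<open>B\<close>, is closed under differentiation.\<close>

lemma Ck_on_circular:
  fixes A B :: "'b::real_normed_vector"
  shows "Ck_on k (\<lambda>t::real. cos t *\<^sub>R A + sin t *\<^sub>R B) UNIV"
proof (induction k arbitrary: A B)
  case 0
  show ?case by (simp, intro continuous_intros)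
next
  case (Suc k)
  have d: "((\<lambda>t. cos t *\<^sub>R A + sin t *\<^sub>R B) has_derivative (\<lambda>v. (- sin t * v) *\<^sub>R A + (cos t * v) *\<^sub>R B)) (at t)" for t
    by (auto intro!: derivative_eq_intros simp: algebra_simps)
  have "dir_deriv v (\<lambda>t. cos t *\<^sub>R A + sin t *\<^sub>R B) = (\<lambda>t. cos t *\<^sub>R (v *\<^sub>R B) + sin t *\<^sub>R (- v *\<^sub>R A))" for v
    using fun_cong[OF frechet_derivative_at[OF d], of _ v] by (simp add: fun_eq_iff algebra_simps)
  then have "Ck_on k (dir_deriv v (\<lambda>t. cos t *\<^sub>R A + sin t *\<^sub>R B)) UNIV" for v
    by (simp only: Suc)
  then show ?case using differentiableI[OF d] unfolding Ck_on.simps by blast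
qed

text \<open>Spherical coordinates: \<open>t\<close> is the latitude, determined by the height, and \<open>\<theta>\<close> the longitude.\<close>

lemma spherical_zone_parametrisation:
  fixes q n u :: "real^3"
  assumes n: "norm n = 1" and u: "norm u = 1" "u \<bullet> n = 0" and R: "R > 0"
    and \<alpha>: "- (pi / 2) \<le> \<alpha>" "\<alpha> < \<beta>" "\<beta> \<le> pi / 2"
  shows "{x. dist q x = R \<and> R * sin \<alpha> \<le> n \<bullet> (x - q) \<and> n \<bullet> (x - q) \<le> R * sin \<beta>}
    = {q + (R * cos t) *\<^sub>R (cos \<theta> *\<^sub>R u + sin \<theta> *\<^sub>R cross3 n u) + (R * sin t) *\<^sub>R n | t \<theta>. t \<in> {\<alpha>..\<beta>}}"
    (is "?S = ?T")
proof -
  define w where "w = cross3 n u"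
  have w: "u \<bullet> w = 0" "w \<bullet> n = 0" by (simp_all add: w_def dot_cross_self)
  have "(norm w)\<^sup>2 = 1\<^sup>2"
    using norm_cross_dot[of n u] n u by (simp add: w_def inner_commute)
  then have nw: "norm w = 1" by (simp only: power2_eq_iff_nonneg norm_ge_zero zero_le_one)
  have i: "u \<bullet> u = 1" "w \<bullet> w = 1" "n \<bullet> n = 1" "w \<bullet> u = 0" "n \<bullet> u = 0" "n \<bullet> w = 0"
    using n u w nw by (simp_all add: norm_eq_1 inner_commute)
  note ex = orthonormal_expansion[OF u(1) nw n w(1) u(2) w(2)]
  have sq: "(a *\<^sub>R u + b *\<^sub>R w + c *\<^sub>R n) \<bullet> (a *\<^sub>R u + b *\<^sub>R w + c *\<^sub>R n) = a\<^sup>2 + b\<^sup>2 + c\<^sup>2" for a b c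
    by (simp add: inner_add_left inner_add_right i w u power2_eq_square)
  have "?T \<subseteq> ?S"
  proof
    fix x assume "x \<in> ?T"
    then obtain t \<theta> where t: "\<alpha> \<le> t" "t \<le> \<beta>"
      and x: "x = q + (R * cos t) *\<^sub>R (cos \<theta> *\<^sub>R u + sin \<theta> *\<^sub>R w) + (R * sin t) *\<^sub>R n"
      by (auto simp: w_def)
    have d: "x - q = (R * cos t * cos \<theta>) *\<^sub>R u + (R * cos t * sin \<theta>) *\<^sub>R w + (R * sin t) *\<^sub>R n"
      by (simp add: x algebra_simps)
    have "(x - q) \<bullet> (x - q) = (R * cos t * cos \<theta>)\<^sup>2 + (R * cos t * sin \<theta>)\<^sup>2 + (R * sin t)\<^sup>2"
      unfolding d by (rule sq)
    also have "\<dots> = R\<^sup>2 * (cos t)\<^sup>2 * ((cos \<theta>)\<^sup>2 + (sin \<theta>)\<^sup>2) + R\<^sup>2 * (sin t)\<^sup>2"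
      by algebra
    also have "\<dots> = R\<^sup>2 * ((cos t)\<^sup>2 + (sin t)\<^sup>2)"
      unfolding sin_cos_squared_add2[of \<theta>] by algebra
    also have "\<dots> = R\<^sup>2" unfolding sin_cos_squared_add2[of t] by (rule mult_1_right)
    finally have "(norm (x - q))\<^sup>2 = R\<^sup>2" by (simp add: power2_norm_eq_inner)
    then have "dist q x = R" using R by (simp add: dist_norm norm_minus_commute power2_eq_iff_nonneg)
    moreover have "n \<bullet> (x - q) = R * sin t" unfolding d by (simp add: inner_add_right i)
    moreover have "sin \<alpha> \<le> sin t" "sin t \<le> sin \<beta>"
      using t \<alpha> by (auto intro!: sin_monotone_2pi_le)
    ultimately show "x \<in> ?S" using R by simp
  qed
  moreover have "?S \<subseteq> ?T"
  proof
    fix x assume "x \<in> ?S"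
    then have x: "dist q x = R" "R * sin \<alpha> \<le> n \<bullet> (x - q)" "n \<bullet> (x - q) \<le> R * sin \<beta>" by auto
    define a b c where "a = (x - q) \<bullet> u" and "b = (x - q) \<bullet> w" and "c = (x - q) \<bullet> n"
    have d: "x - q = a *\<^sub>R u + b *\<^sub>R w + c *\<^sub>R n" unfolding a_def b_def c_def by (rule ex)
    have "(norm (x - q))\<^sup>2 = R\<^sup>2" using x by (simp add: dist_norm norm_minus_commute)
    then have abc: "a\<^sup>2 + b\<^sup>2 + c\<^sup>2 = R\<^sup>2" using sq[of a b c] by (simp add: power2_norm_eq_inner d)
    have c: "sin \<alpha> \<le> c / R" "c / R \<le> sin \<beta>" using x R by (simp_all add: c_def inner_commute field_simps)
    have c1: "- 1 \<le> c / R" "c / R \<le> 1" using c sin_ge_minus_one[of \<alpha>] sin_le_one[of \<beta>] by linarith+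
    define t where "t = arcsin (c / R)"
    have st: "sin t = c / R" unfolding t_def using c1 by (simp add: sin_arcsin)
    have tb: "- (pi / 2) \<le> t" "t \<le> pi / 2" unfolding t_def using arcsin_bounded[OF c1] by auto
    have t: "\<alpha> \<le> t" "t \<le> \<beta>"
      using c \<alpha> tb unfolding st[symmetric] by (auto simp: sin_mono_le_eq)
    have ct: "0 \<le> cos t" using tb by (intro cos_ge_zero) auto
    have cR: "c = R * sin t" using st R by simp
    have ab: "a\<^sup>2 + b\<^sup>2 = (R * cos t)\<^sup>2"
    proof -
      have "a\<^sup>2 + b\<^sup>2 = R\<^sup>2 * (1 - (sin t)\<^sup>2)" using abc by (simp add: cR power_mult_distrib algebra_simps)
      also have "\<dots> = (R * cos t)\<^sup>2" by (simp add: cos_squared_eq power_mult_distrib)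
      finally show ?thesis .
    qed
    have "\<exists>\<theta>. a = R * cos t * cos \<theta> \<and> b = R * cos t * sin \<theta>"
    proof (cases "cos t = 0")
      case True
      then show ?thesis using ab by (simp add: sum_power2_eq_zero_iff)
    next
      case False
      let ?r = "R * cos t"
      have r: "?r \<noteq> 0" using False R by simp
      have "(a / ?r)\<^sup>2 + (b / ?r)\<^sup>2 = 1"
        using ab r by (simp add: power_divide add_divide_distrib[symmetric])
      then obtain \<theta> where "a / ?r = cos \<theta>" "b / ?r = sin \<theta>" using sincos_total_2pi by metis
      then show ?thesis using r by (intro exI[of _ \<theta>]) (simp add: field_simps)
    qed
    then obtain \<theta> where ab': "a = R * cos t * cos \<theta>" "b = R * cos t * sin \<theta>" by blast
    have "x = q + (x - q)" by simp
    also have "\<dots> = q + (R * cos t) *\<^sub>R (cos \<theta> *\<^sub>R u + sin \<theta> *\<^sub>R cross3 n u) + (R * sin t) *\<^sub>R n"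
      unfolding d ab' cR w_def[symmetric] by (simp add: algebra_simps)
    finally show "x \<in> ?T" using t by auto
  qed
  ultimately show ?thesis by blast
qed

lemma surface_of_revolution_spherical_zone:
  fixes q n :: "real^3"
  assumes n: "norm n = 1" and R: "R > 0" and \<alpha>: "- (pi / 2) \<le> \<alpha>" "\<alpha> < \<beta>" "\<beta> \<le> pi / 2"
  shows "surface_of_revolution q n {x. dist q x = R \<and> R * sin \<alpha> \<le> n \<bullet> (x - q) \<and> n \<bullet> (x - q) \<le> R * sin \<beta>}"
proof -
  obtain u where u: "norm u = 1" "u \<bullet> n = 0"
    using orthonormal_frame_exists[OF n] by blast
  define \<gamma> where "\<gamma> = (\<lambda>t. (R * cos t, R * sin t))"
  have \<gamma>: "\<gamma> = (\<lambda>t. cos t *\<^sub>R (R, 0) + sin t *\<^sub>R (0, R))" by (simp add: \<gamma>_def fun_eq_iff)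
  have "Ck_on k \<gamma> UNIV" for k unfolding \<gamma> by (rule Ck_on_circular)
  then have sm: "smooth_on {\<alpha>..\<beta>} \<gamma>"
    unfolding smooth_on_def by (intro ballI exI[of _ UNIV] exI[of _ \<gamma>]) simp
  have vd: "vector_derivative \<gamma> (at t within {\<alpha>..\<beta>}) \<noteq> 0" if "t \<in> {\<alpha>..\<beta>}" for t
  proof -
    have "(\<gamma> has_vector_derivative (- R * sin t, R * cos t)) (at t within {\<alpha>..\<beta>})"
      unfolding \<gamma>_def by (intro has_vector_derivative_Pair)
        (auto intro!: derivative_eq_intros simp: has_real_derivative_iff_has_vector_derivative[symmetric])
    then have "vector_derivative \<gamma> (at t within {\<alpha>..\<beta>}) = (- R * sin t, R * cos t)"
      using that \<alpha> vector_derivative_within_closed_interval by blast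
    moreover have "(- R * sin t, R * cos t) \<noteq> 0"
    proof
      assume "(- R * sin t, R * cos t) = 0"
      then have "sin t = 0" "cos t = 0" using R by (auto simp: zero_prod_def)
      then show False using sin_cos_squared_add[of t] by simp
    qed
    ultimately show ?thesis by simp
  qed
  have f0: "fst (\<gamma> t) \<ge> 0" if "t \<in> {\<alpha>..\<beta>}" for t
    using that \<alpha> R cos_ge_zero[of t] by (auto simp: \<gamma>_def)
  have f1: "fst (\<gamma> t) > 0" if "t \<in> {\<alpha><..<\<beta>}" for t
    using that \<alpha> R cos_gt_zero_pi[of t] by (auto simp: \<gamma>_def)
  have "{x. dist q x = R \<and> R * sin \<alpha> \<le> n \<bullet> (x - q) \<and> n \<bullet> (x - q) \<le> R * sin \<beta>}
     = {q + fst (\<gamma> t) *\<^sub>R (cos \<theta> *\<^sub>R u + sin \<theta> *\<^sub>R cross3 n u) + snd (\<gamma> t) *\<^sub>R n | t \<theta>. t \<in> {\<alpha>..\<beta>}}"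
    unfolding spherical_zone_parametrisation[OF n u R \<alpha>] by (simp add: \<gamma>_def)
  then show ?thesis
    unfolding surface_of_revolution_def using u \<alpha>(2) sm vd f0 f1 by blast
qed

text \<open>The radial projection of a convex open half-space.\<close>

lemma connected_open_hemisphere:
  fixes q m :: "real^3"
  assumes "R > 0"
  shows "connected {x. dist q x = R \<and> 0 < m \<bullet> (x - q)}"
proof -
  let ?H = "{y. 0 < m \<bullet> y}" and ?f = "\<lambda>y. q + (R / norm y) *\<^sub>R y"
  have "continuous_on ?H ?f"
    by (intro continuous_intros) auto
  moreover have "connected ?H" by (intro convex_connected convex_halfspace_gt)
  ultimately have "connected (?f ` ?H)" by (rule connected_continuous_image)
  moreover have "?f ` ?H = {x. dist q x = R \<and> 0 < m \<bullet> (x - q)}"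
  proof
    show "?f ` ?H \<subseteq> {x. dist q x = R \<and> 0 < m \<bullet> (x - q)}"
    proof
      fix x assume "x \<in> ?f ` ?H"
      then obtain y where y: "0 < m \<bullet> y" "x = q + (R / norm y) *\<^sub>R y" by blast
      have "norm y > 0" using y by auto
      then show "x \<in> {x. dist q x = R \<and> 0 < m \<bullet> (x - q)}" using y assms by (simp add: dist_norm)
    qed
    show "{x. dist q x = R \<and> 0 < m \<bullet> (x - q)} \<subseteq> ?f ` ?H"
    proof
      fix x assume x: "x \<in> {x. dist q x = R \<and> 0 < m \<bullet> (x - q)}"
      then have "x = ?f (x - q)" using assms by (simp add: dist_norm norm_minus_commute)
      then show "x \<in> ?f ` ?H" using x by blast
    qed
  qed
  ultimately show ?thesis by simp
qed

text \<open>A point of the equator is the limit of the points obtained by turning it towards the pole \<open>m\<close>.\<close>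

lemma closed_hemisphere_subset_closure:
  fixes q m :: "real^3"
  assumes R: "R > 0" and m: "norm m = 1"
    and C: "closed C" "{x. dist q x = R \<and> 0 < m \<bullet> (x - q)} \<subseteq> C"
  shows "{x. dist q x = R \<and> 0 \<le> m \<bullet> (x - q)} \<subseteq> C"
proof
  fix x assume x: "x \<in> {x. dist q x = R \<and> 0 \<le> m \<bullet> (x - q)}"
  show "x \<in> C"
  proof (cases "m \<bullet> (x - q) = 0")
    case False
    then show ?thesis using x C by auto
  next
    case True
    define d where "d = x - q"
    let ?g = "\<lambda>\<theta>. q + (cos \<theta> *\<^sub>R d + (R * sin \<theta>) *\<^sub>R m)"
    have "norm d = R" using x by (simp add: d_def dist_norm norm_minus_commute)
    then have dd: "d \<bullet> d = R * R" by (metis power2_norm_eq_inner power2_eq_square)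
    have mm: "m \<bullet> m = 1" using m by (simp add: norm_eq_1)
    have md: "m \<bullet> d = 0" "d \<bullet> m = 0" using True by (simp_all add: d_def inner_commute)
    have inC: "?g \<theta> \<in> C" if "0 < \<theta>" "\<theta> < pi" for \<theta>
    proof -
      let ?y = "cos \<theta> *\<^sub>R d + (R * sin \<theta>) *\<^sub>R m"
      have "?y \<bullet> ?y = cos \<theta> * (cos \<theta> * (R * R)) + R * sin \<theta> * (R * sin \<theta>)"
        by (simp add: inner_add_left inner_add_right dd mm md)
      also have "\<dots> = R\<^sup>2 * ((cos \<theta>)\<^sup>2 + (sin \<theta>)\<^sup>2)" by algebra
      also have "\<dots> = R\<^sup>2" unfolding sin_cos_squared_add2 by (rule mult_1_right)
      finally have "(norm ?y)\<^sup>2 = R\<^sup>2" by (simp only: power2_norm_eq_inner)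
      then have "norm ?y = R" using R by (simp only: power2_eq_iff_nonneg norm_ge_zero less_imp_le)
      moreover have "dist q (q + y) = norm y" for y by (simp add: dist_norm)
      ultimately have "dist q (?g \<theta>) = R" by simp
      moreover have "0 < m \<bullet> ?y" using that R sin_gt_zero by (simp add: inner_add_right mm md)
      then have "0 < m \<bullet> (?g \<theta> - q)" by simp
      ultimately show ?thesis using C(2) by blast
    qed
    have "(?g \<longlongrightarrow> ?g 0) (at_right 0)" by (intro tendsto_intros)
    moreover have "eventually (\<lambda>\<theta>. ?g \<theta> \<in> C) (at_right 0)"
      using eventually_at_right_less[of 0] eventually_at_rightI[of 0 pi "\<lambda>\<theta>. ?g \<theta> \<in> C"] inC by simp
    ultimately have "?g 0 \<in> C" by (intro Lim_in_closed_set[OF C(1)]) auto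
    then show ?thesis by (simp add: d_def)
  qed
qed

section \<open>Charts and differentials\<close>

locale surface_atlas =
  fixes X :: "'a topology" and \<A> :: "'a chart set"
  assumes atlas: "smooth_atlas X \<A>"

begin

lemma chart: "c \<in> \<A> \<Longrightarrow> surface_chart X c"
  using atlas by (simp add: smooth_atlas_def)

lemma chart_exists: "p \<in> topspace X \<Longrightarrow> \<exists>c\<in>\<A>. p \<in> fst c"
  using atlas by (auto simp: smooth_atlas_def)

lemma chart_domain_open: "c \<in> \<A> \<Longrightarrow> openin X (fst c)"
  using chart by (simp add: surface_chart_def)

lemma chart_domain_subset: "c \<in> \<A> \<Longrightarrow> fst c \<subseteq> topspace X"
  using chart_domain_open openin_subset by blast

lemma chart_homeomorphic:
  "c \<in> \<A> \<Longrightarrow> homeomorphic_map (subtopology X (fst c)) (top_of_set (snd c ` fst c)) (snd c)"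
  using chart by (simp add: surface_chart_def)

lemma chart_inj: "c \<in> \<A> \<Longrightarrow> inj_on (snd c) (fst c)"
  using homeomorphic_imp_injective_map[OF chart_homeomorphic] chart_domain_subset
  by (simp add: Int_absorb1)

lemma local_rep_chart: "c \<in> \<A> \<Longrightarrow> p \<in> fst c \<Longrightarrow> local_rep c F (snd c p) = F p"
  using chart_inj by (simp add: local_rep_def)

lemma chart_image_open: "c \<in> \<A> \<Longrightarrow> openin (top_of_set half_plane) (snd c ` fst c)"
  using chart by (simp add: surface_chart_def)

lemma chart_half_plane: "c \<in> \<A> \<Longrightarrow> p \<in> fst c \<Longrightarrow> snd c p \<in> half_plane"
  using openin_subset[OF chart_image_open, of c] by auto

lemma chart_image_of_open:
  assumes "c \<in> \<A>" "openin X U" "U \<subseteq> fst c"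
  shows "openin (top_of_set half_plane) (snd c ` U)"
proof -
  have "openin (subtopology X (fst c)) U" using assms by (auto simp: openin_subtopology)
  then have "openin (top_of_set (snd c ` fst c)) (snd c ` U)"
    using homeomorphic_imp_open_map[OF chart_homeomorphic[OF assms(1)]] by (simp add: open_map_def)
  then show ?thesis using chart_image_open[OF assms(1)] openin_trans by blast
qed

lemma chart_preimage_open:
  assumes "c \<in> \<A>" "open V"
  shows "openin X {p \<in> fst c. snd c p \<in> V}"
proof -
  have "continuous_map (subtopology X (fst c)) (top_of_set (snd c ` fst c)) (snd c)"
    using homeomorphic_imp_continuous_map[OF chart_homeomorphic[OF assms(1)]] .
  moreover have "openin (top_of_set (snd c ` fst c)) (snd c ` fst c \<inter> V)"
    using assms(2) by (simp add: openin_open_Int)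
  ultimately have "openin (subtopology X (fst c)) {p \<in> topspace (subtopology X (fst c)). snd c p \<in> snd c ` fst c \<inter> V}"
    by (rule openin_continuous_map_preimage)
  moreover have "{p \<in> topspace (subtopology X (fst c)). snd c p \<in> snd c ` fst c \<inter> V} = {p \<in> fst c. snd c p \<in> V}"
    using chart_domain_subset[OF assms(1)] by auto
  ultimately show ?thesis using openin_trans_full[OF _ chart_domain_open[OF assms(1)]] by simp
qed

lemma chart_neighbourhood:
  assumes "c \<in> \<A>" "p \<in> fst c"
  obtains V where "open V" "snd c p \<in> V" "V \<inter> half_plane \<subseteq> snd c ` fst c"
  using chart_image_open[OF assms(1)] assms(2) unfolding openin_open by blast

text \<open>Only the extension \<open>g\<close> of a coordinate expression to an open set of the plane has to be continuous. Used
for the immersion and for the mean curvature, whose definition by eigenvalues does not show any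
regularity.\<close>

lemma continuous_map_chartwise:
  fixes F :: "'a \<Rightarrow> 'b::topological_space"
  assumes loc: "\<And>p. p \<in> topspace X \<Longrightarrow> \<exists>c\<in>\<A>. \<exists>V g. p \<in> fst c \<and> snd c p \<in> V \<and> open V \<and>
    continuous_on V g \<and> (\<forall>q\<in>fst c. snd c q \<in> V \<longrightarrow> F q = g (snd c q))"
  shows "continuous_map X euclidean F"
  unfolding continuous_map_def
proof (intro conjI allI impI)
  fix U :: "'b set" assume "openin euclidean U"
  then have U: "open U" by simp
  show "openin X {x \<in> topspace X. F x \<in> U}"
  proof (subst openin_subopen, intro ballI)
    fix p assume p: "p \<in> {x \<in> topspace X. F x \<in> U}"
    then have "p \<in> topspace X" by simp
    from loc[OF this] obtain c V g where c: "c \<in> \<A>" "p \<in> fst c" and V: "snd c p \<in> V" "open V" "continuous_on V g"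
      and eq: "\<And>q. q \<in> fst c \<Longrightarrow> snd c q \<in> V \<Longrightarrow> F q = g (snd c q)" by blast
    have o: "open (V \<inter> g -` U)" by (rule continuous_open_preimage[OF V(3,2) U])
    let ?S = "{q \<in> fst c. snd c q \<in> V \<inter> g -` U}"
    have "openin X ?S" by (rule chart_preimage_open[OF c(1) o])
    moreover have "p \<in> ?S" using c V p eq[of p] by simp
    moreover have "?S \<subseteq> {x \<in> topspace X. F x \<in> U}" using eq chart_domain_subset[OF c(1)] by auto
    ultimately show "\<exists>T. openin X T \<and> p \<in> T \<and> T \<subseteq> {x \<in> topspace X. F x \<in> U}" by blast
  qed
qed simp

text \<open>\<open>G\<close> is a smooth extension of the coordinate expression of \<open>F\<close> across the boundary of the half-plane.\<close>

definition extends :: "'a chart \<Rightarrow> (real \<times> real) set \<Rightarrow> (real \<times> real \<Rightarrow> 'b) \<Rightarrow> ('a \<Rightarrow> 'b::real_normed_vector) \<Rightarrow> bool" where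
  "extends c V G F \<longleftrightarrow> smooth_in V G \<and> (\<forall>q\<in>fst c. snd c q \<in> V \<longrightarrow> G (snd c q) = F q)"

lemma extends_subset: "extends c V G F \<Longrightarrow> open U \<Longrightarrow> U \<subseteq> V \<Longrightarrow> extends c U G F"
  by (auto simp: extends_def smooth_in_subset)

lemma local_extension:
  assumes "c \<in> \<A>" "p \<in> fst c" "smooth_map \<A> F"
  obtains V G where "extends c V G F" "snd c p \<in> V"
proof -
  have "smooth_on (snd c ` fst c) (local_rep c F)" using assms by (simp add: smooth_map_def)
  then obtain V G where V: "open V" "snd c p \<in> V" "\<forall>k. Ck_on k G V" "\<forall>y\<in>V \<inter> snd c ` fst c. G y = local_rep c F y"
    using assms(2) unfolding smooth_on_def by blast
  have "extends c V G F"
    unfolding extends_def smooth_in_def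
  proof (intro conjI ballI impI V(1,3))
    fix q assume q: "q \<in> fst c" "snd c q \<in> V"
    then have "G (snd c q) = local_rep c F (snd c q)" using V(4) by blast
    then show "G (snd c q) = F q" by (simp add: local_rep_chart[OF assms(1) q(1)])
  qed
  then show ?thesis using that V(2) by blast
qed

lemma extension_has_derivative:
  assumes c: "c \<in> \<A>" "q \<in> fst c" "snd c q \<in> V" and G: "extends c V G F"
  shows "(local_rep c F has_derivative frechet_derivative G (at (snd c q))) (at (snd c q) within snd c ` fst c)"
proof -
  have sm: "smooth_in V G" using G by (simp add: extends_def)
  obtain d where d: "d > 0" "ball (snd c q) d \<subseteq> V" using smooth_in_open[OF sm] c(3) openE by blast
  have "(G has_derivative frechet_derivative G (at (snd c q))) (at (snd c q) within snd c ` fst c)"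
    using smooth_in_has_derivative[OF sm c(3)] has_derivative_at_withinI by blast
  then show ?thesis
  proof (rule has_derivative_transform_within[OF _ d(1)])
    show "snd c q \<in> snd c ` fst c" using c by simp
    fix y assume y: "y \<in> snd c ` fst c" "dist y (snd c q) < d"
    then obtain r where r: "r \<in> fst c" "y = snd c r" by blast
    have "y \<in> V" using y d by (auto simp: dist_commute)
    then show "G y = local_rep c F y" using G r by (simp add: extends_def local_rep_chart[OF c(1) r(1)])
  qed
qed

lemma has_derivative_differential:
  assumes "c \<in> \<A>" "q \<in> fst c" "smooth_map \<A> F"
  shows "(local_rep c F has_derivative differential c F q) (at (snd c q) within snd c ` fst c)"
proof -
  obtain V G where "extends c V G F" "snd c q \<in> V" using local_extension[OF assms] .
  from extension_has_derivative[OF assms(1,2) this(2,1)]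
  have "local_rep c F differentiable (at (snd c q) within snd c ` fst c)" by (rule differentiableI)
  then show ?thesis unfolding differential_def by (simp add: frechet_derivative_works)
qed

lemma linear_differential:
  "c \<in> \<A> \<Longrightarrow> q \<in> fst c \<Longrightarrow> smooth_map \<A> F \<Longrightarrow> linear (differential c F q)"
  using has_derivative_differential has_derivative_linear by blast

lemma differential_eq:
  assumes c: "c \<in> \<A>" "q \<in> fst c" and d: "(local_rep c F has_derivative D) (at (snd c q) within snd c ` fst c)"
  shows "differential c F q = D"
proof -
  have "(local_rep c F has_derivative differential c F q) (at (snd c q) within snd c ` fst c)"
    using differentiableI[OF d] unfolding differential_def by (simp add: frechet_derivative_works)
  then show ?thesis using half_plane_derivative_unique[OF _ d chart_image_open[OF c(1)]] c(2) by blast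
qed

text \<open>At every surface point in its domain the extension computes the differential.\<close>

lemma differential_extension:
  assumes "c \<in> \<A>" "q \<in> fst c" "snd c q \<in> V" "extends c V G F"
  shows "differential c F q = frechet_derivative G (at (snd c q))"
  by (rule differential_eq[OF assms(1,2) extension_has_derivative[OF assms]])

text \<open>The derivative of the change of coordinates from \<open>c\<close> to \<open>d\<close>, taken within the overlap, which is
relatively open in the half-plane.\<close>

definition transition :: "'a chart \<Rightarrow> 'a chart \<Rightarrow> 'a \<Rightarrow> real \<times> real \<Rightarrow> real \<times> real" where
  "transition c d p = frechet_derivative (local_rep c (snd d)) (at (snd c p) within snd c ` (fst c \<inter> fst d))"

lemma overlap_open:
  assumes "c \<in> \<A>" "d \<in> \<A>"
  shows "openin (top_of_set half_plane) (snd c ` (fst c \<inter> fst d))"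
  using chart_image_of_open[OF assms(1)] chart_domain_open assms by (simp add: openin_Int)

lemma has_derivative_transition:
  assumes "c \<in> \<A>" "d \<in> \<A>" "p \<in> fst c" "p \<in> fst d"
  shows "(local_rep c (snd d) has_derivative transition c d p) (at (snd c p) within snd c ` (fst c \<inter> fst d))"
proof -
  let ?D = "snd c ` (fst c \<inter> fst d)"
  have p: "snd c p \<in> ?D" using assms by simp
  have "smooth_on ?D (local_rep c (snd d))" using atlas assms by (simp add: smooth_atlas_def)
  then obtain V G where V: "open V" "snd c p \<in> V" "\<forall>k. Ck_on k G V" "\<forall>y\<in>V \<inter> ?D. G y = local_rep c (snd d) y"
    using p unfolding smooth_on_def by blast
  then have sm: "smooth_in V G" by (simp add: smooth_in_def)
  obtain r where r: "r > 0" "ball (snd c p) r \<subseteq> V" using V openE by blast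
  have "(G has_derivative frechet_derivative G (at (snd c p))) (at (snd c p) within ?D)"
    using smooth_in_has_derivative[OF sm V(2)] has_derivative_at_withinI by blast
  then have "(local_rep c (snd d) has_derivative frechet_derivative G (at (snd c p))) (at (snd c p) within ?D)"
    by (rule has_derivative_transform_within[OF _ r(1) p]) (use r V(4) in \<open>auto simp: dist_commute subset_iff\<close>)
  from differentiableI[OF this] show ?thesis
    unfolding transition_def by (simp add: frechet_derivative_works)
qed

text \<open>The chain rule. It shows that the notions of the surface do not depend on the chart.\<close>

lemma differential_transition:
  assumes "c \<in> \<A>" "d \<in> \<A>" "p \<in> fst c" "p \<in> fst d" "smooth_map \<A> F"
  shows "differential c F p v = differential d F p (transition c d p v)"
proof -
  let ?D = "snd c ` (fst c \<inter> fst d)"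
  let ?T = "local_rep c (snd d)"
  have im: "?T ` ?D \<subseteq> snd d ` fst d"
    by (auto simp: local_rep_chart[OF assms(1)] simp del: surj_pair)
  have "(local_rep d F has_derivative differential d F p) (at (snd d p) within snd d ` fst d)"
    using has_derivative_differential assms by blast
  then have "(local_rep d F has_derivative differential d F p) (at (?T (snd c p)) within ?T ` ?D)"
    using has_derivative_subset[OF _ im] by (simp add: local_rep_chart[OF assms(1,3)])
  from diff_chain_within[OF has_derivative_transition[OF assms(1-4)] this]
  have "((local_rep d F \<circ> ?T) has_derivative (differential d F p \<circ> transition c d p)) (at (snd c p) within ?D)" .
  moreover have "snd c p \<in> ?D" using assms by simp
  moreover have "(local_rep d F \<circ> ?T) y = local_rep c F y" if "y \<in> ?D" for y
    using that by (auto simp: local_rep_chart[OF assms(1)] local_rep_chart[OF assms(2)])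
  ultimately have 1: "(local_rep c F has_derivative (differential d F p \<circ> transition c d p)) (at (snd c p) within ?D)"
    by (metis (no_types, lifting) has_derivative_transform)
  have "(local_rep c F has_derivative differential c F p) (at (snd c p) within ?D)"
    by (rule has_derivative_subset[OF has_derivative_differential[OF assms(1,3,5)]]) auto
  from half_plane_derivative_unique[OF this 1 overlap_open[OF assms(1,2)]]
  show ?thesis using assms by auto
qed

end

section \<open>Tangent planes and the Weingarten map\<close>

locale immersed_surface = surface_atlas X \<A> for X :: "'a topology" and \<A> +
  fixes \<phi> \<eta> :: "'a \<Rightarrow> real^3"
  assumes imm: "immersion \<A> \<phi>" and nor: "unit_normal_field X \<A> \<phi> \<eta>"

begin

abbreviation "shape \<equiv> weingarten \<A> \<phi> \<eta>"
abbreviation "mean_curv \<equiv> H1 \<A> \<phi> \<eta>"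
abbreviation "gauss_curv \<equiv> H2 \<A> \<phi> \<eta>"

lemma smooth_immersion: "smooth_map \<A> \<phi>"
  using imm by (simp add: immersion_def)

lemma smooth_normal: "smooth_map \<A> \<eta>"
  using nor by (simp add: unit_normal_field_def)

lemma inj_differential: "c \<in> \<A> \<Longrightarrow> p \<in> fst c \<Longrightarrow> inj (differential c \<phi> p)"
  using imm by (simp add: immersion_def)

lemma in_topspace: "c \<in> \<A> \<Longrightarrow> p \<in> fst c \<Longrightarrow> p \<in> topspace X"
  using chart_domain_subset by blast

lemma norm_normal: "p \<in> topspace X \<Longrightarrow> norm (\<eta> p) = 1"
  using nor by (simp add: unit_normal_field_def)

lemma differential_orthogonal:
  assumes "c \<in> \<A>" "p \<in> fst c"
  shows "differential c \<phi> p v \<bullet> \<eta> p = 0"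
proof -
  have "differential c \<phi> p v \<in> tangent_space \<A> \<phi> p"
    using assms unfolding tangent_space_def by blast
  moreover have "\<forall>Y\<in>tangent_space \<A> \<phi> p. \<eta> p \<bullet> Y = 0"
    using nor in_topspace[OF assms] by (simp add: unit_normal_field_def)
  ultimately have "\<eta> p \<bullet> differential c \<phi> p v = 0" by simp
  then show ?thesis by (simp add: inner_commute)
qed

text \<open>An inclusion of subspaces of the same dimension two.\<close>

lemma range_differential:
  assumes "c \<in> \<A>" "p \<in> fst c"
  shows "range (differential c \<phi> p) = {Y. Y \<bullet> \<eta> p = 0}"
proof -
  have lin: "linear (differential c \<phi> p)" by (rule linear_differential[OF assms smooth_immersion])
  have ne: "\<eta> p \<noteq> 0" using norm_normal[OF in_topspace[OF assms]] by auto
  have "dim (range (differential c \<phi> p)) = dim (UNIV :: (real \<times> real) set)"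
    using inj_differential[OF assms] by (intro dim_image_eq[OF lin]) (simp add: span_UNIV)
  moreover have "dim {Y. \<eta> p \<bullet> Y = 0} = DIM(real^3) - 1"
    by (rule dim_hyperplane[OF ne])
  ultimately have "dim (range (differential c \<phi> p)) = dim {Y. \<eta> p \<bullet> Y = 0}" by simp
  moreover have "range (differential c \<phi> p) \<subseteq> {Y. \<eta> p \<bullet> Y = 0}"
    using differential_orthogonal[OF assms] by (auto simp: inner_commute)
  moreover have "subspace (range (differential c \<phi> p))"
    using linear_subspace_image[OF lin subspace_UNIV] .
  moreover have "subspace {Y. \<eta> p \<bullet> Y = 0}" by (rule subspace_hyperplane)
  ultimately have "range (differential c \<phi> p) = {Y. \<eta> p \<bullet> Y = 0}"
    by (intro subspace_dim_equal) auto
  then show ?thesis by (simp add: inner_commute)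
qed

lemma tangent_space_eq:
  assumes "p \<in> topspace X"
  shows "tangent_space \<A> \<phi> p = {Y. Y \<bullet> \<eta> p = 0}"
proof -
  obtain c where c: "c \<in> \<A>" "p \<in> fst c" using chart_exists[OF assms] by blast
  have "Y \<in> tangent_space \<A> \<phi> p \<longleftrightarrow> (\<exists>c\<in>\<A>. p \<in> fst c \<and> Y \<bullet> \<eta> p = 0)" for Y
    using range_differential by (simp add: tangent_space_def cong: bex_cong conj_cong)
  then show ?thesis using c by blast
qed

lemma tangent_vector_differential:
  assumes "c \<in> \<A>" "p \<in> fst c" "Y \<bullet> \<eta> p = 0"
  obtains v where "Y = differential c \<phi> p v"
proof -
  have "Y \<in> range (differential c \<phi> p)" unfolding range_differential[OF assms(1,2)] using assms(3) by simp
  then show ?thesis by (rule rangeE) (rule that)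
qed

lemma differential_independent:
  assumes c: "c \<in> \<A>" "p \<in> fst c" and z: "a *\<^sub>R differential c \<phi> p (1,0) + b *\<^sub>R differential c \<phi> p (0,1) = 0"
  shows "a = 0 \<and> b = 0"
proof -
  have l: "linear (differential c \<phi> p)" by (rule linear_differential[OF c smooth_immersion])
  have "differential c \<phi> p (a *\<^sub>R (1,0) + b *\<^sub>R (0,1)) = differential c \<phi> p 0"
    using z by (simp only: linear_add[OF l] linear_scale[OF l] linear_0[OF l])
  then have "a *\<^sub>R (1,0) + b *\<^sub>R (0,1) = (0 :: real \<times> real)"
    using inj_differential[OF c] by (simp only: inj_eq)
  then show ?thesis by (simp add: prod_eq_iff)
qed

text \<open>Another chart \<open>d\<close> with a vector \<open>v'\<close> representing the same tangent vector gives the same derivative: by the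
chain rule and the injectivity of the differential of \<open>\<phi>\<close>, the transition map carries \<open>v'\<close> to \<open>v\<close>.\<close>

lemma deriv_along_differential:
  assumes c: "c \<in> \<A>" "p \<in> fst c" and F: "smooth_map \<A> F"
  shows "deriv_along \<A> \<phi> F p (differential c \<phi> p v) = differential c F p v"
  unfolding deriv_along_def
proof (rule the_equality)
  show "\<exists>c'\<in>\<A>. p \<in> fst c' \<and> (\<exists>v'. differential c' \<phi> p v' = differential c \<phi> p v \<and> differential c' F p v' = differential c F p v)"
    using c by blast
next
  fix z assume "\<exists>d\<in>\<A>. p \<in> fst d \<and> (\<exists>v'. differential d \<phi> p v' = differential c \<phi> p v \<and> differential d F p v' = z)"
  then obtain d v' where d: "d \<in> \<A>" "p \<in> fst d" and e: "differential d \<phi> p v' = differential c \<phi> p v" "differential d F p v' = z"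
    by blast
  have "differential c \<phi> p (transition d c p v') = differential c \<phi> p v"
    using differential_transition[OF d(1) c(1) d(2) c(2) smooth_immersion] e by simp
  then have "transition d c p v' = v" using inj_differential[OF c] by (simp add: inj_eq)
  then show "z = differential c F p v"
    using differential_transition[OF d(1) c(1) d(2) c(2) F] e by simp
qed

text \<open>Differentiate \<open>\<eta> \<bullet> \<eta> = 1\<close>.\<close>

lemma normal_derivative_orthogonal:
  assumes c: "c \<in> \<A>" "p \<in> fst c"
  shows "differential c \<eta> p v \<bullet> \<eta> p = 0"
proof -
  obtain V N where N: "extends c V N \<eta>" "snd c p \<in> V"
    using local_extension[OF c smooth_normal] .
  obtain U where U: "open U" "snd c p \<in> U" "U \<inter> half_plane \<subseteq> snd c ` fst c"
    using chart_neighbourhood[OF c] .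
  let ?V = "V \<inter> U"
  have ext: "extends c ?V N \<eta>" using extends_subset[OF N(1), of ?V] U N by (auto simp: extends_def smooth_in_def)
  then have sm: "smooth_in ?V N" by (simp add: extends_def)
  let ?g = "\<lambda>x. N x \<bullet> N x - 1"
  have sg: "smooth_in ?V (\<lambda>x. N x \<bullet> N x)" by (rule smooth_in_inner_fields[OF sm sm])
  have x: "snd c p \<in> ?V \<inter> half_plane" using N U chart_half_plane[OF c] by simp
  have "dir_deriv v ?g (snd c p) = 0"
  proof (rule dir_deriv_zero_on_half_plane[OF _ x])
    show "smooth_in ?V ?g" using sg by (intro smooth_in_diff smooth_in_const smooth_in_open[OF sm])
    fix y assume y: "y \<in> ?V \<inter> half_plane"
    then obtain q where q: "q \<in> fst c" "y = snd c q" using U by blast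
    then have "N y = \<eta> q" using ext y by (simp add: extends_def)
    then show "N y \<bullet> N y - 1 = 0" using norm_normal[OF in_topspace[OF c(1) q(1)]] by (simp add: norm_eq_1)
  qed
  moreover have "frechet_derivative ?g (at (snd c p)) = frechet_derivative (\<lambda>x. N x \<bullet> N x) (at (snd c p))"
  proof -
    have "(?g has_derivative (\<lambda>v. frechet_derivative (\<lambda>x. N x \<bullet> N x) (at (snd c p)) v - 0)) (at (snd c p))"
      using x by (intro has_derivative_diff smooth_in_has_derivative[OF sg] has_derivative_const) auto
    then show ?thesis using frechet_derivative_at by fastforce
  qed
  moreover have "dir_deriv v (\<lambda>x. N x \<bullet> N x) (snd c p) = 2 * (dir_deriv v N (snd c p) \<bullet> N (snd c p))"
    using dir_deriv_inner_fields[OF sm sm, of "snd c p" v] x by (simp add: inner_commute)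
  moreover have "N (snd c p) = \<eta> p" using N c by (simp add: extends_def)
  moreover have "differential c \<eta> p v = dir_deriv v N (snd c p)"
    using differential_extension[OF c _ ext] x by simp
  ultimately show ?thesis by simp
qed

text \<open>The derivative of \<open>\<eta>\<close> is tangential, so up to sign it is the vector that the definition asks for.\<close>

lemma weingarten_differential:
  assumes c: "c \<in> \<A>" "p \<in> fst c"
  shows "shape p (differential c \<phi> p v) = - differential c \<eta> p v"
  unfolding weingarten_def deriv_along_differential[OF c smooth_normal] tangent_space_eq[OF in_topspace[OF c]]
proof (rule the_equality)
  show "- differential c \<eta> p v \<in> {Y. Y \<bullet> \<eta> p = 0} \<and> (\<forall>W\<in>{Y. Y \<bullet> \<eta> p = 0}. - differential c \<eta> p v \<bullet> W = - differential c \<eta> p v \<bullet> W)"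
    using normal_derivative_orthogonal[OF c] by simp
next
  fix Z assume Z: "Z \<in> {Y. Y \<bullet> \<eta> p = 0} \<and> (\<forall>W\<in>{Y. Y \<bullet> \<eta> p = 0}. Z \<bullet> W = - differential c \<eta> p v \<bullet> W)"
  let ?W = "Z + differential c \<eta> p v"
  have "?W \<bullet> \<eta> p = 0" using Z normal_derivative_orthogonal[OF c] by (simp add: inner_add_left)
  then have "Z \<bullet> ?W = - differential c \<eta> p v \<bullet> ?W" using Z by blast
  then have "?W \<bullet> ?W = 0" by (simp add: inner_add_left)
  then show "Z = - differential c \<eta> p v" by (simp add: eq_neg_iff_add_eq_0)
qed

lemma weingarten_tangent:
  assumes "p \<in> topspace X" "Y \<bullet> \<eta> p = 0"
  shows "shape p Y \<bullet> \<eta> p = 0"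
proof -
  obtain c where c: "c \<in> \<A>" "p \<in> fst c" using chart_exists[OF assms(1)] by blast
  obtain v where "Y = differential c \<phi> p v" using tangent_vector_differential[OF c assms(2)] .
  then show ?thesis using weingarten_differential[OF c] normal_derivative_orthogonal[OF c] by simp
qed

lemma weingarten_linear:
  assumes "p \<in> topspace X" "Y \<bullet> \<eta> p = 0" "Z \<bullet> \<eta> p = 0"
  shows "shape p (s *\<^sub>R Y + t *\<^sub>R Z) = s *\<^sub>R shape p Y + t *\<^sub>R shape p Z"
proof -
  obtain c where c: "c \<in> \<A>" "p \<in> fst c" using chart_exists[OF assms(1)] by blast
  obtain v where v: "Y = differential c \<phi> p v" using tangent_vector_differential[OF c assms(2)] .
  obtain w where w: "Z = differential c \<phi> p w" using tangent_vector_differential[OF c assms(3)] .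
  have l: "linear (differential c \<phi> p)" "linear (differential c \<eta> p)"
    using linear_differential[OF c] smooth_immersion smooth_normal by blast+
  have "s *\<^sub>R Y + t *\<^sub>R Z = differential c \<phi> p (s *\<^sub>R v + t *\<^sub>R w)"
    by (simp add: v w linear_add[OF l(1)] linear_scale[OF l(1)])
  then show ?thesis
    by (simp add: weingarten_differential[OF c] v w linear_add[OF l(2)] linear_scale[OF l(2)])
qed

text \<open>\<open>G\<close> and \<open>N\<close> extend immersion and normal to the same open set \<open>V\<close>, whose intersection with the half-plane
consists of coordinates of surface points; relations between \<open>G\<close> and \<open>N\<close> are available only there.\<close>

definition parametrised :: "'a chart \<Rightarrow> (real \<times> real) set \<Rightarrow> (real \<times> real \<Rightarrow> real^3) \<Rightarrow> (real \<times> real \<Rightarrow> real^3) \<Rightarrow> bool" where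
  "parametrised c V G N \<longleftrightarrow> c \<in> \<A> \<and> extends c V G \<phi> \<and> extends c V N \<eta> \<and> V \<inter> half_plane \<subseteq> snd c ` fst c"

lemma parametrised_exists:
  assumes c: "c \<in> \<A>" "p \<in> fst c"
  obtains V G N where "parametrised c V G N" "snd c p \<in> V"
proof -
  obtain V1 G where 1: "extends c V1 G \<phi>" "snd c p \<in> V1" using local_extension[OF c smooth_immersion] .
  obtain V2 N where 2: "extends c V2 N \<eta>" "snd c p \<in> V2" using local_extension[OF c smooth_normal] .
  obtain V3 where 3: "open V3" "snd c p \<in> V3" "V3 \<inter> half_plane \<subseteq> snd c ` fst c"
    using chart_neighbourhood[OF c] .
  have o: "open (V1 \<inter> V2 \<inter> V3)" using 1 2 3 by (auto simp: extends_def smooth_in_def)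
  have "parametrised c (V1 \<inter> V2 \<inter> V3) G N"
    unfolding parametrised_def using c(1) extends_subset[OF 1(1) o] extends_subset[OF 2(1) o] 3(3) by blast
  then show ?thesis using that 1 2 3 by blast
qed

lemma parametrised_subset:
  assumes "parametrised c V G N" "open U" "U \<subseteq> V"
  shows "parametrised c U G N"
proof -
  have "extends c U G \<phi>" "extends c U N \<eta>"
    using assms(1) by (auto simp: parametrised_def intro: extends_subset[OF _ assms(2,3)])
  moreover have "U \<inter> half_plane \<subseteq> snd c ` fst c"
    using assms(1,3) unfolding parametrised_def by (meson Int_mono order_refl order_trans)
  ultimately show ?thesis using assms(1) by (simp add: parametrised_def)
qed

lemma parametrised_point:
  assumes "parametrised c V G N" "y \<in> V \<inter> half_plane"
  obtains q where "q \<in> fst c" "q \<in> topspace X" "y = snd c q" "G y = \<phi> q" "N y = \<eta> q"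
    "differential c \<phi> q = frechet_derivative G (at y)" "differential c \<eta> q = frechet_derivative N (at y)"
proof -
  obtain q where q: "q \<in> fst c" "y = snd c q" using assms by (auto simp: parametrised_def)
  have c: "c \<in> \<A>" and G: "extends c V G \<phi>" and N: "extends c V N \<eta>" using assms by (auto simp: parametrised_def)
  have y: "snd c q \<in> V" using q assms by simp
  show ?thesis
    by (rule that[OF q(1) in_topspace[OF c q(1)] q(2)])
       (use G N q y differential_extension[OF c q(1) y] in \<open>auto simp: extends_def\<close>)
qed

text \<open>Differentiate \<open>N \<bullet> dG(w) = 0\<close> in the direction \<open>v\<close>.\<close>

lemma second_fundamental_form:
  assumes par: "parametrised c V G N" and y: "y \<in> V \<inter> half_plane"
  shows "- (dir_deriv v N y \<bullet> dir_deriv w G y) = N y \<bullet> dir_deriv v (dir_deriv w G) y"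
proof -
  have G: "smooth_in V G" and N: "smooth_in V N" and c: "c \<in> \<A>" using par by (auto simp: parametrised_def extends_def)
  have "dir_deriv v (\<lambda>x. N x \<bullet> dir_deriv w G x) y = 0"
  proof (rule dir_deriv_zero_on_half_plane[OF smooth_in_inner_fields[OF N smooth_in_dir_deriv[OF G]] y])
    fix z assume z: "z \<in> V \<inter> half_plane"
    obtain q where q: "q \<in> fst c" "N z = \<eta> q" "differential c \<phi> q = frechet_derivative G (at z)"
      using parametrised_point[OF par z] by metis
    show "N z \<bullet> dir_deriv w G z = 0"
      using differential_orthogonal[OF c q(1), of w] q by (simp add: inner_commute)
  qed
  then show ?thesis
    using dir_deriv_inner_fields[OF N smooth_in_dir_deriv[OF G, of w], of y v] y by simp
qed

text \<open>By \<open>second_fundamental_form\<close> this is the symmetry of second derivatives.\<close>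

lemma weingarten_self_adjoint:
  assumes "p \<in> topspace X" "Y \<bullet> \<eta> p = 0" "Z \<bullet> \<eta> p = 0"
  shows "shape p Y \<bullet> Z = Y \<bullet> shape p Z"
proof -
  obtain c where c: "c \<in> \<A>" "p \<in> fst c" using chart_exists[OF assms(1)] by blast
  obtain v where v: "Y = differential c \<phi> p v" using tangent_vector_differential[OF c assms(2)] .
  obtain w where w: "Z = differential c \<phi> p w" using tangent_vector_differential[OF c assms(3)] .
  obtain V G N where par: "parametrised c V G N" "snd c p \<in> V" using parametrised_exists[OF c] .
  have y: "snd c p \<in> V \<inter> half_plane" using par chart_half_plane[OF c] by simp
  have G: "smooth_in V G" and e: "extends c V G \<phi>" "extends c V N \<eta>" using par by (auto simp: parametrised_def extends_def)
  note d = differential_extension[OF c par(2) e(1)] differential_extension[OF c par(2) e(2)]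
  show ?thesis
    using second_fundamental_form[OF par(1) y, of v w] second_fundamental_form[OF par(1) y, of w v]
      dir_deriv_commute_inner[OF G par(2), of v w]
    unfolding v w weingarten_differential[OF c] unfolding d by (simp add: inner_commute)
qed

section \<open>Principal curvatures\<close>

text \<open>The eigenvalues found by \<open>self_adjoint_eigenbasis\<close> are all principal curvatures, hence equal to the
maximum \<open>kappa1\<close> and the minimum \<open>kappa2\<close>.\<close>

lemma principal_basis:
  assumes p: "p \<in> topspace X"
  obtains e1 e2 where "norm e1 = 1" "norm e2 = 1" "e1 \<bullet> e2 = 0" "e1 \<bullet> \<eta> p = 0" "e2 \<bullet> \<eta> p = 0"
    "shape p e1 = kappa1 \<A> \<phi> \<eta> p *\<^sub>R e1" "shape p e2 = kappa2 \<A> \<phi> \<eta> p *\<^sub>R e2"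
proof -
  have lin: "shape p (s *\<^sub>R Y + t *\<^sub>R Z) = s *\<^sub>R shape p Y + t *\<^sub>R shape p Z"
    if "Y \<bullet> \<eta> p = 0" "Z \<bullet> \<eta> p = 0" for Y Z s t by (rule weingarten_linear[OF p that])
  obtain e1 e2 k1 k2 where e: "norm e1 = 1" "norm e2 = 1" "e1 \<bullet> e2 = 0" "e1 \<bullet> \<eta> p = 0" "e2 \<bullet> \<eta> p = 0"
    and A: "shape p e1 = k1 *\<^sub>R e1" "shape p e2 = k2 *\<^sub>R e2" and k: "k2 \<le> k1"
    using self_adjoint_eigenbasis[where A="shape p", OF norm_normal[OF p] weingarten_tangent[OF p]
      lin weingarten_self_adjoint[OF p]] by blast
  have n: "e1 \<bullet> e1 = 1" "e2 \<bullet> e2 = 1" "e2 \<bullet> e1 = 0" "e1 \<noteq> 0" "e2 \<noteq> 0"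
    using e by (simp_all add: norm_eq_1 inner_commute) (use e in force)+
  have "principal_curvatures \<A> \<phi> \<eta> p = {k1, k2}"
  proof
    show "{k1, k2} \<subseteq> principal_curvatures \<A> \<phi> \<eta> p"
    proof -
      have "k1 \<in> principal_curvatures \<A> \<phi> \<eta> p" "k2 \<in> principal_curvatures \<A> \<phi> \<eta> p"
        unfolding principal_curvatures_def tangent_space_eq[OF p] using e(4,5) n(4,5) A by blast+
      then show ?thesis by simp
    qed
    show "principal_curvatures \<A> \<phi> \<eta> p \<subseteq> {k1, k2}"
    proof
      fix k assume "k \<in> principal_curvatures \<A> \<phi> \<eta> p"
      then obtain Y where Y: "Y \<bullet> \<eta> p = 0" "Y \<noteq> 0" "shape p Y = k *\<^sub>R Y"
        unfolding principal_curvatures_def tangent_space_eq[OF p] by blast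
      define a b where "a = Y \<bullet> e1" and "b = Y \<bullet> e2"
      have Ye: "Y = a *\<^sub>R e1 + b *\<^sub>R e2"
        using orthonormal_expansion[OF e(1,2) norm_normal[OF p] e(3-5), of Y] Y(1) unfolding a_def b_def
        by (metis add.right_neutral scaleR_zero_left)
      have "k *\<^sub>R Y = a *\<^sub>R k1 *\<^sub>R e1 + b *\<^sub>R k2 *\<^sub>R e2"
        using lin[OF e(4,5), of a b] Y(3) A Ye by simp
      then have "(k *\<^sub>R Y) \<bullet> e1 = a * k1" "(k *\<^sub>R Y) \<bullet> e2 = b * k2"
        using e n by (simp_all add: inner_add_left)
      then have "k * a = a * k1" "k * b = b * k2" by (simp_all add: a_def b_def)
      moreover have "a \<noteq> 0 \<or> b \<noteq> 0" using Y(2) Ye by auto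
      ultimately show "k \<in> {k1, k2}" by auto
    qed
  qed
  then have "kappa1 \<A> \<phi> \<eta> p = k1" "kappa2 \<A> \<phi> \<eta> p = k2"
    using k by (simp_all add: kappa1_def kappa2_def)
  then show ?thesis using that[OF e] A by simp
qed

lemma curvature_from_basis:
  assumes p: "p \<in> topspace X" and UW: "U \<bullet> \<eta> p = 0" "W \<bullet> \<eta> p = 0"
    and AU: "shape p U = U'" and AW: "shape p W = W'"
  shows "(U' \<bullet> U) * (W' \<bullet> W) - (U' \<bullet> W)\<^sup>2 = gauss_curv p * ((U \<bullet> U) * (W \<bullet> W) - (U \<bullet> W)\<^sup>2)" (is ?K)
    and "(U' \<bullet> U) * (W \<bullet> W) - 2 * (U' \<bullet> W) * (U \<bullet> W) + (W' \<bullet> W) * (U \<bullet> U)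
       = 2 * mean_curv p * ((U \<bullet> U) * (W \<bullet> W) - (U \<bullet> W)\<^sup>2)" (is ?H)
proof -
  have "?K \<and> ?H"
  proof (rule principal_basis[OF p])
    fix e1 e2
    assume e: "norm e1 = 1" "norm e2 = 1" "e1 \<bullet> e2 = 0" "e1 \<bullet> \<eta> p = 0" "e2 \<bullet> \<eta> p = 0"
      and A: "shape p e1 = kappa1 \<A> \<phi> \<eta> p *\<^sub>R e1" "shape p e2 = kappa2 \<A> \<phi> \<eta> p *\<^sub>R e2"
    have 1: "shape p (s *\<^sub>R Y + t *\<^sub>R Z) = s *\<^sub>R shape p Y + t *\<^sub>R shape p Z"
      if "Y \<bullet> \<eta> p = 0" "Z \<bullet> \<eta> p = 0" for Y Z s t by (rule weingarten_linear[OF p that])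
    show "?K \<and> ?H"
      unfolding H1_def H2_def AU[symmetric] AW[symmetric]
      using eigenbasis_determinants[where A="shape p" and \<eta>="\<eta> p" and U=U and W=W,
          OF e(1,2) norm_normal[OF p] e(3-5) _ A UW] 1
      by (simp del: AU AW)
  qed
  then show ?K ?H by blast+
qed

text \<open>In dimension two the eigenvalues of \<open>P1\<close> are \<open>kappa2\<close> and \<open>kappa1\<close>.\<close>

lemma mean_curvature_positive:
  assumes P: "P1_positive_definite X \<A> \<phi> \<eta>" and p: "p \<in> topspace X"
  shows "mean_curv p > 0"
proof (rule principal_basis[OF p])
  fix e1 e2
  assume e: "norm e1 = 1" "norm e2 = 1" "e1 \<bullet> e2 = 0" "e1 \<bullet> \<eta> p = 0" "e2 \<bullet> \<eta> p = 0"
    and A: "shape p e1 = kappa1 \<A> \<phi> \<eta> p *\<^sub>R e1" "shape p e2 = kappa2 \<A> \<phi> \<eta> p *\<^sub>R e2"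
  have ee: "e1 \<bullet> e1 = 1" "e2 \<bullet> e2 = 1" "e1 \<noteq> 0" "e2 \<noteq> 0" using e by (auto simp: norm_eq_1)
  have pos: "P1 \<A> \<phi> \<eta> p Y \<bullet> Y > 0" if "Y \<bullet> \<eta> p = 0" "Y \<noteq> 0" for Y
    using P p that tangent_space_eq[OF p] by (simp add: P1_positive_definite_def)
  have "kappa2 \<A> \<phi> \<eta> p > 0" "kappa1 \<A> \<phi> \<eta> p > 0"
    using pos[OF e(4) ee(3)] pos[OF e(5) ee(4)]
    unfolding P1_def A H1_def by (simp_all add: inner_diff_left ee)
  then show ?thesis by (simp add: H1_def)
qed

section \<open>The surface as a graph\<close>

text \<open>In the coordinates \<open>X = G \<bullet> e1\<close> and \<open>Y = G \<bullet> e2\<close> the surface is the graph of \<open>Z = G \<bullet> e3\<close>, with coordinate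
tangent vectors \<open>e1 + zx * e3\<close> and \<open>e2 + zy * e3\<close>. Since \<open>\<eta>\<close> is a multiple of \<open>(- zx, - zy, 1)\<close>, the
second fundamental form is \<open>\<eta> \<bullet> e3\<close> times the Hessian of \<open>Z\<close>, and the Gram determinant is \<open>W\<close>. The
product with \<open>\<eta> \<bullet> e3\<close> in the mean curvature formula keeps track of the orientation.\<close>

lemma graph_curvature:
  assumes par: "parametrised c V G N"
    and e: "norm e1 = 1" "norm e2 = 1" "norm e3 = 1" "e1 \<bullet> e2 = 0" "e1 \<bullet> e3 = 0" "e2 \<bullet> e3 = 0"
    and fr: "coordinate_frame V (\<lambda>x. G x \<bullet> e1) (\<lambda>x. G x \<bullet> e2) v w"
    and y: "y \<in> V \<inter> half_plane" and q: "q \<in> fst c" "y = snd c q"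
  defines "zx \<equiv> along v (\<lambda>x. G x \<bullet> e3) y" and "zy \<equiv> along w (\<lambda>x. G x \<bullet> e3) y"
    and "zxx \<equiv> along v (along v (\<lambda>x. G x \<bullet> e3)) y"
    and "zxy \<equiv> along v (along w (\<lambda>x. G x \<bullet> e3)) y"
    and "zyy \<equiv> along w (along w (\<lambda>x. G x \<bullet> e3)) y"
  defines "W \<equiv> 1 + zx * zx + zy * zy"
  defines "M \<equiv> (1 + zy * zy) * zxx - 2 * (zx * zy * zxy) + (1 + zx * zx) * zyy"
  shows "dir_deriv (v y) G y = e1 + zx *\<^sub>R e3" "dir_deriv (w y) G y = e2 + zy *\<^sub>R e3"
    and "(\<eta> q \<bullet> e3)\<^sup>2 * W = 1"
    and "shape q (e1 + zx *\<^sub>R e3) \<bullet> (e2 + zy *\<^sub>R e3) = (\<eta> q \<bullet> e3) * zxy"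
    and "zxx * zyy - zxy * zxy = gauss_curv q * (W * W)"
    and "(\<eta> q \<bullet> e3) * M = 2 * mean_curv q * W"
    and "M * M = (2 * mean_curv q)\<^sup>2 * (W * W * W)"
proof -
  have c: "c \<in> \<A>" and G: "smooth_in V G" and N: "smooth_in V N" and eG: "extends c V G \<phi>" and eN: "extends c V N \<eta>"
    using par by (auto simp: parametrised_def extends_def)
  have yV: "y \<in> V" using y by simp
  have Ny: "N y = \<eta> q" using eN q yV by (simp add: extends_def)
  have dG: "differential c \<phi> q = frechet_derivative G (at y)" and dN: "differential c \<eta> q = frechet_derivative N (at y)"
    using differential_extension[OF c q(1) _ eG] differential_extension[OF c q(1) _ eN] q yV by simp_all
  have qX: "q \<in> topspace X" using in_topspace[OF c q(1)] .
  have v: "smooth_field V v" and w: "smooth_field V w"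
    and a: "\<And>x. x \<in> V \<Longrightarrow> along v (\<lambda>x. G x \<bullet> e1) x = 1" "\<And>x. x \<in> V \<Longrightarrow> along v (\<lambda>x. G x \<bullet> e2) x = 0"
      "\<And>x. x \<in> V \<Longrightarrow> along w (\<lambda>x. G x \<bullet> e1) x = 0" "\<And>x. x \<in> V \<Longrightarrow> along w (\<lambda>x. G x \<bullet> e2) x = 1"
    using fr by (auto simp: coordinate_frame_def)
  have al: "along u (\<lambda>x. G x \<bullet> e) y = dir_deriv (u y) G y \<bullet> e" for u e
    unfolding along_def by (rule dir_deriv_inner_const[OF G yV])
  define U1 where "U1 = dir_deriv (v y) G y"
  define U2 where "U2 = dir_deriv (w y) G y"
  have U1: "U1 = e1 + zx *\<^sub>R e3" and U2: "U2 = e2 + zy *\<^sub>R e3"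
    using orthonormal_expansion[OF e, of U1] orthonormal_expansion[OF e, of U2] a[OF yV]
    by (simp_all add: U1_def U2_def al zx_def zy_def)
  then show g: "dir_deriv (v y) G y = e1 + zx *\<^sub>R e3" "dir_deriv (w y) G y = e2 + zy *\<^sub>R e3"
    by (simp_all add: U1_def U2_def)
  define \<nu> where "\<nu> = \<eta> q \<bullet> e3"
  have tan: "dir_deriv u G y \<bullet> \<eta> q = 0" for u
    using differential_orthogonal[OF c q(1)] dG by simp
  have t1: "U1 \<bullet> \<eta> q = 0" "U2 \<bullet> \<eta> q = 0" unfolding U1_def U2_def by (rule tan)+
  then have n12: "\<eta> q \<bullet> e1 = - zx * \<nu>" "\<eta> q \<bullet> e2 = - zy * \<nu>"
    unfolding U1 U2 by (simp_all add: inner_add_left inner_commute[of "\<eta> q"] \<nu>_def)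
  have "\<eta> q = (\<eta> q \<bullet> e1) *\<^sub>R e1 + (\<eta> q \<bullet> e2) *\<^sub>R e2 + (\<eta> q \<bullet> e3) *\<^sub>R e3"
    by (rule orthonormal_expansion[OF e])
  then have "\<eta> q \<bullet> \<eta> q = (\<eta> q \<bullet> e1) * (\<eta> q \<bullet> e1) + (\<eta> q \<bullet> e2) * (\<eta> q \<bullet> e2) + (\<eta> q \<bullet> e3) * (\<eta> q \<bullet> e3)"
    by (metis (no_types, lifting) inner_add_right inner_scaleR_right)
  then have nW: "\<nu>\<^sup>2 * W = 1"
    using norm_normal[OF qX] unfolding n12 \<nu>_def[symmetric] by (simp add: norm_eq_1 W_def power2_eq_square algebra_simps)
  then show "(\<eta> q \<bullet> e3)\<^sup>2 * W = 1" by (simp add: \<nu>_def)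
  have II: "- (dir_deriv (\<alpha> y) N y \<bullet> dir_deriv (\<beta> y) G y) = \<nu> * along \<alpha> (along \<beta> (\<lambda>x. G x \<bullet> e3)) y"
    if \<beta>: "smooth_field V \<beta>" and k1: "\<And>x. x \<in> V \<Longrightarrow> along \<beta> (\<lambda>x. G x \<bullet> e1) x = k1"
      and k2: "\<And>x. x \<in> V \<Longrightarrow> along \<beta> (\<lambda>x. G x \<bullet> e2) x = k2" for \<alpha> \<beta> k1 k2
  proof -
    \<comment> \<open>The derivative of \<open>dG(\<beta>)\<close> along \<open>\<alpha>\<close> is \<open>B\<close>; the summand \<open>dG(\<kappa>)\<close>, which is tangential, comes from the variation of \<open>\<beta>\<close>. The coordinates \<open>X\<close> and \<open>Y\<close> have constant derivatives along \<open>\<beta>\<close>, so \<open>B\<close> is a multiple of \<open>e3\<close>.\<close>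
    let ?\<kappa> = "(along \<alpha> (\<lambda>x. fst (\<beta> x)) y, along \<alpha> (\<lambda>x. snd (\<beta> x)) y)"
    let ?B = "dir_deriv ?\<kappa> G y + dir_deriv (\<alpha> y) (dir_deriv (\<beta> y) G) y"
    have B: "?B \<bullet> e = along \<alpha> (along \<beta> (\<lambda>x. G x \<bullet> e)) y" for e
    proof -
      have sm: "smooth_in V (\<lambda>x. G x \<bullet> e)" by (rule smooth_in_inner[OF G])
      have "dir_deriv (\<alpha> y) (dir_deriv (\<beta> y) (\<lambda>x. G x \<bullet> e)) y = dir_deriv (\<alpha> y) (dir_deriv (\<beta> y) G) y \<bullet> e"
      proof -
        have "along \<alpha> (dir_deriv (\<beta> y) (\<lambda>x. G x \<bullet> e)) y = along \<alpha> (\<lambda>x. dir_deriv (\<beta> y) G x \<bullet> e) y"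
          by (rule along_cong[OF smooth_in_dir_deriv[OF sm] yV dir_deriv_inner_const[OF G]])
        also have "\<dots> = dir_deriv (\<alpha> y) (dir_deriv (\<beta> y) G) y \<bullet> e"
          unfolding along_def by (rule dir_deriv_inner_const[OF smooth_in_dir_deriv[OF G] yV])
        finally show ?thesis by (simp only: along_def)
      qed
      moreover have "dir_deriv ?\<kappa> G y \<bullet> e = fst ?\<kappa> * dir_deriv (1,0) (\<lambda>x. G x \<bullet> e) y + snd ?\<kappa> * dir_deriv (0,1) (\<lambda>x. G x \<bullet> e) y"
        using dir_deriv_components[OF sm yV, of ?\<kappa>] dir_deriv_inner_const[OF G yV] by simp
      ultimately show ?thesis
        using along_along_components[OF sm \<beta> yV, of \<alpha>] by (simp add: inner_add_left)
    qed
    have z: "along \<alpha> (along \<beta> (\<lambda>x. G x \<bullet> e)) y = 0" if "\<And>x. x \<in> V \<Longrightarrow> along \<beta> (\<lambda>x. G x \<bullet> e) x = k" for e k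
      using along_cong[OF smooth_in_along[OF smooth_in_inner[OF G] \<beta>] yV that, of \<alpha>] by (simp add: along_const)
    have "?B = (?B \<bullet> e1) *\<^sub>R e1 + (?B \<bullet> e2) *\<^sub>R e2 + (?B \<bullet> e3) *\<^sub>R e3"
      by (rule orthonormal_expansion[OF e])
    moreover have "along \<alpha> (along \<beta> (\<lambda>x. G x \<bullet> e1)) y = 0" "along \<alpha> (along \<beta> (\<lambda>x. G x \<bullet> e2)) y = 0"
      by (rule z, rule k1, assumption, rule z, rule k2, assumption)
    ultimately have "?B = along \<alpha> (along \<beta> (\<lambda>x. G x \<bullet> e3)) y *\<^sub>R e3"
      unfolding B by simp
    then have "\<eta> q \<bullet> ?B = \<nu> * along \<alpha> (along \<beta> (\<lambda>x. G x \<bullet> e3)) y"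
      by (metis \<nu>_def inner_scaleR_right mult.commute)
    moreover have "\<eta> q \<bullet> dir_deriv ?\<kappa> G y = 0" using tan by (simp add: inner_commute)
    ultimately show ?thesis
      using second_fundamental_form[OF par y, of "\<alpha> y" "\<beta> y"] Ny by (simp add: inner_add_right)
  qed
  define A1 where "A1 = shape q U1"
  define A2 where "A2 = shape q U2"
  have A: "A1 = - dir_deriv (v y) N y" "A2 = - dir_deriv (w y) N y"
    using weingarten_differential[OF c q(1)] unfolding A1_def A2_def U1_def U2_def dG dN by blast+
  have 11: "A1 \<bullet> U1 = \<nu> * zxx" and 12: "A1 \<bullet> U2 = \<nu> * zxy" and 22: "A2 \<bullet> U2 = \<nu> * zyy"
    using II[OF v a(1,2), of v] II[OF w a(3,4), of v] II[OF w a(3,4), of w]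
    unfolding A U1_def U2_def zxx_def zxy_def zyy_def by simp_all
  then show "shape q (e1 + zx *\<^sub>R e3) \<bullet> (e2 + zy *\<^sub>R e3) = (\<eta> q \<bullet> e3) * zxy"
    by (simp add: A1_def U1 U2 \<nu>_def)
  have ee: "e1 \<bullet> e1 = 1" "e2 \<bullet> e2 = 1" "e3 \<bullet> e3 = 1" "e2 \<bullet> e1 = 0" "e3 \<bullet> e1 = 0" "e3 \<bullet> e2 = 0"
    using e by (simp_all add: norm_eq_1 inner_commute)
  have gr: "U1 \<bullet> U1 = 1 + zx * zx" "U2 \<bullet> U2 = 1 + zy * zy" "U1 \<bullet> U2 = zx * zy"
    unfolding U1 U2 by (simp_all add: inner_add_left inner_add_right e ee)
  have det: "(U1 \<bullet> U1) * (U2 \<bullet> U2) - (U1 \<bullet> U2)\<^sup>2 = W"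
    unfolding gr W_def by (simp add: algebra_simps power2_eq_square)
  note cb = curvature_from_basis[OF qX t1 A1_def[symmetric] A2_def[symmetric], unfolded det]
  have K: "\<nu>\<^sup>2 * (zxx * zyy - zxy * zxy) = gauss_curv q * W"
    using cb(1) unfolding 11 12 22 by (simp add: power2_eq_square algebra_simps)
  have nM: "\<nu> * M = 2 * mean_curv q * W"
    using cb(2) unfolding 11 12 22 gr M_def by (simp add: algebra_simps)
  then show "(\<eta> q \<bullet> e3) * M = 2 * mean_curv q * W" by (simp add: \<nu>_def)
  have "(\<nu>\<^sup>2 * W) * (zxx * zyy - zxy * zxy) = gauss_curv q * (W * W)"
    using K by (simp add: mult_ac)
  then show "zxx * zyy - zxy * zxy = gauss_curv q * (W * W)" using nW by simp
  have "(\<nu>\<^sup>2 * W) * (M * M) = W * (\<nu> * M)\<^sup>2" by (simp add: power2_eq_square mult_ac)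
  then show "M * M = (2 * mean_curv q)\<^sup>2 * (W * W * W)"
    unfolding nM nW by (simp add: power2_eq_square mult_ac)
qed

text \<open>At \<open>p\<close> the functions \<open>X\<close> and \<open>Y\<close> restrict to coordinates of the tangent plane, so their Jacobian
determinant \<open>J\<close> is nonzero there, and by continuity on a neighbourhood.\<close>

lemma graph_parametrisation:
  assumes c: "c \<in> \<A>" "p \<in> fst c"
    and e: "norm e1 = 1" "norm e2 = 1" "e1 \<bullet> e2 = 0" "e1 \<bullet> \<eta> p = 0" "e2 \<bullet> \<eta> p = 0"
  obtains V G N v w where "parametrised c V G N" "snd c p \<in> V"
    "coordinate_frame V (\<lambda>x. G x \<bullet> e1) (\<lambda>x. G x \<bullet> e2) v w"
proof -
  obtain V0 G N where par: "parametrised c V0 G N" "snd c p \<in> V0" using parametrised_exists[OF c] .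
  let ?x = "snd c p"
  have G: "smooth_in V0 G" and eG: "extends c V0 G \<phi>" using par by (auto simp: parametrised_def extends_def)
  define X' Y' where "X' = (\<lambda>x. G x \<bullet> e1)" and "Y' = (\<lambda>x. G x \<bullet> e2)"
  have sX: "smooth_in V0 X'" and sY: "smooth_in V0 Y'" unfolding X'_def Y'_def by (rule smooth_in_inner[OF G])+
  define J where "J = (\<lambda>x. dir_deriv (1,0) X' x * dir_deriv (0,1) Y' x - dir_deriv (0,1) X' x * dir_deriv (1,0) Y' x)"
  have sJ: "smooth_in V0 J" unfolding J_def
    by (intro smooth_in_diff smooth_in_mult smooth_in_dir_deriv sX sY)
  have d: "differential c \<phi> p = frechet_derivative G (at ?x)"
    by (rule differential_extension[OF c par(2) eG])
  obtain u1 where u1: "e1 = differential c \<phi> p u1" using tangent_vector_differential[OF c e(4)] .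
  obtain u2 where u2: "e2 = differential c \<phi> p u2" using tangent_vector_differential[OF c e(5)] .
  have ee: "e1 \<bullet> e1 = 1" "e2 \<bullet> e2 = 1" "e2 \<bullet> e1 = 0" using e by (simp_all add: norm_eq_1 inner_commute)
  have D: "dir_deriv u1 X' ?x = 1" "dir_deriv u1 Y' ?x = 0" "dir_deriv u2 X' ?x = 0" "dir_deriv u2 Y' ?x = 1"
    unfolding X'_def Y'_def dir_deriv_inner_const[OF G par(2)] d[symmetric] u1[symmetric] u2[symmetric]
    using e ee by simp_all
  have "J ?x * (fst u1 * snd u2 - snd u1 * fst u2) = 1"
    using D dir_deriv_components[OF sX par(2), of u1] dir_deriv_components[OF sY par(2), of u1]
      dir_deriv_components[OF sX par(2), of u2] dir_deriv_components[OF sY par(2), of u2]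
    unfolding J_def real_scaleR_def by algebra
  then have J0: "J ?x \<noteq> 0" by auto
  define V where "V = V0 \<inter> J -` (- {0})"
  have oV: "open V"
    unfolding V_def by (rule continuous_open_preimage[OF smooth_in_continuous_on[OF sJ] smooth_in_open[OF G]]) auto
  have sub: "V \<subseteq> V0" by (auto simp: V_def)
  have xV: "?x \<in> V" using par J0 by (auto simp: V_def)
  have fr: "coordinate_frame V X' Y' (\<lambda>x. (dir_deriv (0,1) Y' x / J x, - dir_deriv (1,0) Y' x / J x))
     (\<lambda>x. (- dir_deriv (0,1) X' x / J x, dir_deriv (1,0) X' x / J x))"
    unfolding J_def
    by (rule coordinate_frame_exists[OF smooth_in_subset[OF sX oV sub] smooth_in_subset[OF sY oV sub]])
       (simp add: V_def J_def)
  show ?thesis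
    by (rule that[OF parametrised_subset[OF par(1) oV sub] xV fr[unfolded X'_def Y'_def]])
qed

text \<open>Over a neighbourhood of \<open>p\<close> the formula for the mean curvature of a graph over the tangent plane at \<open>p\<close>
has smooth ingredients.\<close>

lemma continuous_mean_curvature: "continuous_map X euclideanreal (mean_curv)"
proof (rule continuous_map_chartwise)
  fix p assume pX: "p \<in> topspace X"
  obtain c where c: "c \<in> \<A>" "p \<in> fst c" using chart_exists[OF pX] by blast
  obtain e1 e2 where e: "norm e1 = 1" "norm e2 = 1" "e1 \<bullet> e2 = 0" "e1 \<bullet> \<eta> p = 0" "e2 \<bullet> \<eta> p = 0"
    using orthonormal_frame_exists[OF norm_normal[OF pX]] .
  obtain V G N v w where par: "parametrised c V G N" and xV: "snd c p \<in> V"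
    and fr: "coordinate_frame V (\<lambda>x. G x \<bullet> e1) (\<lambda>x. G x \<bullet> e2) v w"
    by (rule graph_parametrisation[OF c e])
  let ?e3 = "\<eta> p"
  let ?Z = "\<lambda>x. G x \<bullet> ?e3"
  have G: "smooth_in V G" and N: "smooth_in V N" and eN: "extends c V N \<eta>" using par by (auto simp: parametrised_def extends_def)
  have v: "smooth_field V v" and w: "smooth_field V w" using fr by (auto simp: coordinate_frame_def)
  define zx zy where "zx = along v ?Z" and "zy = along w ?Z"
  define zxx zxy zyy where "zxx = along v zx" and "zxy = along v zy" and "zyy = along w zy"
  have sz: "smooth_in V zx" "smooth_in V zy" unfolding zx_def zy_def
    by (intro smooth_in_along[OF smooth_in_inner[OF G]] v w)+
  have szz: "smooth_in V zxx" "smooth_in V zxy" "smooth_in V zyy" unfolding zxx_def zxy_def zyy_def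
    by (intro smooth_in_along sz v w)+
  note one = smooth_in_const[OF smooth_in_open[OF G]]
  define W where "W = (\<lambda>y. 1 + zx y * zx y + zy y * zy y)"
  define M where "M = (\<lambda>y. (1 + zy y * zy y) * zxx y - 2 * (zx y * zy y * zxy y) + (1 + zx y * zx y) * zyy y)"
  define g where "g = (\<lambda>y. (N y \<bullet> ?e3) * M y / (2 * W y))"
  have W0: "W y > 0" for y
  proof -
    have "0 \<le> zx y * zx y" "0 \<le> zy y * zy y" by simp_all
    then show ?thesis unfolding W_def by linarith
  qed
  have sW: "smooth_in V W" unfolding W_def by (intro smooth_in_add smooth_in_mult sz one)
  have sM: "smooth_in V M" unfolding M_def by (intro smooth_in_add smooth_in_diff smooth_in_mult sz szz one)
  have "smooth_in V (\<lambda>y. (N y \<bullet> ?e3) * M y)" by (intro smooth_in_mult smooth_in_inner[OF N] sM)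
  moreover have "smooth_in V (\<lambda>y. 2 * W y)" by (intro smooth_in_mult one sW)
  moreover have "2 * W y \<noteq> 0" for y using W0[of y] by simp
  ultimately have sg: "smooth_in V g" unfolding g_def by (rule smooth_in_divide)
  have Hg: "mean_curv q = g (snd c q)" if q: "q \<in> fst c" "snd c q \<in> V" for q
  proof -
    have y: "snd c q \<in> V \<inter> half_plane" using q chart_half_plane[OF c(1)] by simp
    have Nq: "N (snd c q) = \<eta> q" using eN q by (simp add: extends_def)
    have "(\<eta> q \<bullet> ?e3) * M (snd c q) = 2 * mean_curv q * W (snd c q)"
      using graph_curvature(6)[OF par e(1,2) norm_normal[OF pX] e(3-5) fr y q(1) refl]
      by (simp add: M_def W_def zx_def zy_def zxx_def zxy_def zyy_def)
    then show ?thesis using W0[of "snd c q"] Nq by (simp add: g_def field_simps)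
  qed
  then show "\<exists>c\<in>\<A>. \<exists>V g. p \<in> fst c \<and> snd c p \<in> V \<and> open V \<and> continuous_on V g \<and>
      (\<forall>q\<in>fst c. snd c q \<in> V \<longrightarrow> mean_curv q = g (snd c q))"
    using c xV smooth_in_open[OF G] smooth_in_continuous_on[OF sg] by blast
qed

section \<open>The outward conormal\<close>

lemma transition_nonzero:
  assumes c: "c \<in> \<A>" "d \<in> \<A>" "p \<in> fst c" "p \<in> fst d" and v: "transition c d p v = 0"
  shows "v = 0"
proof -
  have "differential c \<phi> p v = differential c \<phi> p 0"
    using differential_transition[OF c smooth_immersion] v
      linear_0[OF linear_differential[OF c(1,3) smooth_immersion]] linear_0[OF linear_differential[OF c(2,4) smooth_immersion]] by simp
  then show ?thesis using inj_differential[OF c(1,3)] by (simp only: inj_eq)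
qed

lemma linear_transition:
  assumes c: "c \<in> \<A>" "d \<in> \<A>" "p \<in> fst c" "p \<in> fst d"
  shows "linear (transition c d p)"
  using has_derivative_transition[OF c] has_derivative_linear by blast

text \<open>Otherwise the transition derivative would map the plane into a line and fail to be injective.\<close>

lemma transition_snd_nonzero:
  assumes c: "c \<in> \<A>" "d \<in> \<A>" "p \<in> fst c" "p \<in> fst d"
  shows "snd (transition c d p (1,0)) \<noteq> 0 \<or> snd (transition c d p (0,1)) \<noteq> 0"
proof (rule ccontr)
  let ?T = "transition c d p"
  assume "\<not> ?thesis"
  then have s: "snd (?T (1,0)) = 0" "snd (?T (0,1)) = 0" by auto
  define a b where "a = fst (?T (1,0))" and "b = fst (?T (0,1))"
  have T: "?T (1,0) = (a, 0)" "?T (0,1) = (b, 0)" using s by (simp_all add: a_def b_def prod_eq_iff)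
  have l: "linear ?T" by (rule linear_transition[OF c])
  have "?T (b *\<^sub>R (1,0) + (- a) *\<^sub>R (0,1)) = 0"
    unfolding linear_add[OF l] linear_scale[OF l] T by (simp add: zero_prod_def)
  then have "b *\<^sub>R (1,0) + (- a) *\<^sub>R (0,1) = (0 :: real \<times> real)" by (rule transition_nonzero[OF c])
  then have "?T (1,0) = 0" using T by (simp add: zero_prod_def)
  then have "(1, 0) = (0 :: real \<times> real)" by (rule transition_nonzero[OF c])
  then show False by (simp add: zero_prod_def)
qed

lemma snd_local_rep_nonneg:
  assumes c: "c \<in> \<A>" "d \<in> \<A>" and y: "y \<in> snd c ` (fst c \<inter> fst d)"
  shows "0 \<le> snd (local_rep c (snd d) y)"
  using y chart_half_plane[OF c(2)] by (auto simp: local_rep_chart[OF c(1)] half_plane_def)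

text \<open>If \<open>p\<close> were interior in the chart \<open>d\<close>, the second coordinate of the transition from \<open>d\<close> to \<open>c\<close> would be
nonnegative near \<open>p\<close> with an interior zero minimum there. Its derivative would vanish, against
\<open>transition_snd_nonzero\<close>.\<close>

lemma boundary_chart_independent:
  assumes c: "c \<in> \<A>" "d \<in> \<A>" "p \<in> fst c" "p \<in> fst d" and b: "snd (snd c p) = 0"
  shows "snd (snd d p) = 0"
proof (rule ccontr)
  assume "snd (snd d p) \<noteq> 0"
  then have pos: "0 < snd (snd d p)" using chart_half_plane[OF c(2,4)] by (simp add: half_plane_def)
  let ?D = "snd d ` (fst d \<inter> fst c)" and ?\<tau> = "local_rep d (snd c)" and ?T = "transition d c p"
  have D: "openin (top_of_set half_plane) ?D" using overlap_open c by blast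
  have x: "snd d p \<in> ?D" using c by blast
  have snd: "((\<lambda>y. snd (?\<tau> y)) has_derivative (\<lambda>u. snd (?T u))) (at (snd d p) within ?D)"
    using has_derivative_transition[OF c(2,1,4,3)] by (rule has_derivative_snd)
  have v0: "snd (?\<tau> (snd d p)) = 0" using b by (simp add: local_rep_chart[OF c(2,4)])
  have ge: "0 \<le> snd (?T u)" if "0 \<le> snd u" for u
    by (rule half_plane_one_sided_min[OF snd D x that]) (use v0 snd_local_rep_nonneg[OF c(2,1)] in auto)
  obtain T where T: "open T" "?D = half_plane \<inter> T" using D by (auto simp: openin_open)
  let ?S = "T \<inter> {y. 0 < snd y}"
  have "open {y::real\<times>real. 0 < snd y}" by (intro open_Collect_less continuous_intros)
  then have S: "open ?S" using T by blast
  have SD: "?S \<subseteq> ?D" unfolding T(2) by (auto simp: half_plane_def)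
  have xS: "snd d p \<in> ?S" using x pos T by auto
  have "((\<lambda>y. snd (?\<tau> y)) has_derivative (\<lambda>u. snd (?T u))) (at (snd d p))"
    using has_derivative_subset[OF snd SD] unfolding at_within_open[OF xS S] .
  then have "(\<lambda>u. snd (?T u)) = (\<lambda>u. 0)"
    by (rule differential_zero_maxmin[OF xS S])
      (unfold v0, intro disjI2 ballI snd_local_rep_nonneg[OF c(2,1)], erule subsetD[OF SD])
  then have "snd (?T u) = 0" for u by (rule fun_cong)
  then show False using transition_snd_nonzero[OF c(2,1,4,3)] by simp
qed

text \<open>The second coordinate of the transition map is zero along the boundary and nonnegative inside, so its
derivative is zero in the tangential and nonnegative in the inward direction. By
\<open>transition_snd_nonzero\<close> it is not zero in both.\<close>

lemma transition_boundary:
  assumes c: "c \<in> \<A>" "d \<in> \<A>" "p \<in> fst c" "p \<in> fst d" and b: "snd (snd c p) = 0"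
  shows "snd (transition c d p (1,0)) = 0" "snd (transition c d p (0,1)) > 0"
proof -
  let ?D = "snd c ` (fst c \<inter> fst d)" and ?\<tau> = "local_rep c (snd d)" and ?T = "transition c d p"
  have D: "openin (top_of_set half_plane) ?D" using overlap_open c by blast
  have x: "snd c p \<in> ?D" using c by blast
  have snd: "((\<lambda>y. snd (?\<tau> y)) has_derivative (\<lambda>u. snd (?T u))) (at (snd c p) within ?D)"
    using has_derivative_transition[OF c] by (rule has_derivative_snd)
  have bz: "snd (?\<tau> y) = 0" if "y \<in> ?D" "snd y = 0" for y
    using that boundary_chart_independent[OF c(1,2)] by (auto simp: local_rep_chart[OF c(1)])
  have v0: "snd (?\<tau> (snd c p)) = 0" using bz[OF x b] .
  have ge: "0 \<le> snd (?T u)" if "0 \<le> snd u" for u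
    by (rule half_plane_one_sided_min[OF snd D x that]) (use v0 snd_local_rep_nonneg[OF c(1,2)] in auto)
  have "0 \<le> - snd (?T (1,0))"
    by (rule half_plane_one_sided_min[OF has_derivative_minus[OF snd] D x])
       (use v0 bz b in auto)
  moreover have "0 \<le> snd (?T (1,0))" "0 \<le> snd (?T (0,1))" using ge by auto
  ultimately show 1: "snd (?T (1,0)) = 0" by linarith
  show "snd (?T (0,1)) > 0"
    using transition_snd_nonzero[OF c] 1 \<open>0 \<le> snd (?T (0,1))\<close> by simp
qed

text \<open>By \<open>transition_boundary\<close> the conditions on the conormal in one chart imply those in any other, so the
description in the definition, which leaves the chart open, determines a unique vector.\<close>

lemma outward_conormal_in_chart:
  assumes c: "c \<in> \<A>" "p \<in> fst c" and b: "snd (snd c p) = 0"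
  defines "\<nu> \<equiv> outward_conormal \<A> \<phi> p"
  shows "\<nu> \<bullet> \<eta> p = 0" "norm \<nu> = 1" "\<nu> \<bullet> differential c \<phi> p (1,0) = 0" "\<nu> \<bullet> differential c \<phi> p (0,1) < 0"
proof -
  let ?P = "\<lambda>d \<nu>. \<nu> \<bullet> differential d \<phi> p (1,0) = 0 \<and> \<nu> \<bullet> differential d \<phi> p (0,1) < 0"
  have "?P c \<nu>" if d: "d \<in> \<A>" "p \<in> fst d" and P: "?P d \<nu>" for d \<nu>
  proof -
    let ?T = "transition c d p"
    define \<alpha> \<beta> \<gamma> where "\<alpha> = fst (?T (1,0))" and "\<beta> = fst (?T (0,1))" and "\<gamma> = snd (?T (0,1))"
    have T: "?T (1,0) = \<alpha> *\<^sub>R (1,0)" "?T (0,1) = \<beta> *\<^sub>R (1,0) + \<gamma> *\<^sub>R (0,1)" and "\<gamma> > 0"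
      using transition_boundary[OF c(1) d(1) c(2) d(2) b] by (simp_all add: prod_eq_iff \<alpha>_def \<beta>_def \<gamma>_def)
    have l: "linear (differential d \<phi> p)" by (rule linear_differential[OF d smooth_immersion])
    have "differential c \<phi> p (1,0) = \<alpha> *\<^sub>R differential d \<phi> p (1,0)"
      "differential c \<phi> p (0,1) = \<beta> *\<^sub>R differential d \<phi> p (1,0) + \<gamma> *\<^sub>R differential d \<phi> p (0,1)"
      unfolding differential_transition[OF c(1) d(1) c(2) d(2) smooth_immersion] T linear_add[OF l] linear_scale[OF l] by simp_all
    then show ?thesis using P \<open>\<gamma> > 0\<close> by (simp add: inner_add_right mult_pos_neg)
  qed
  then have iff: "(\<exists>d\<in>\<A>. p \<in> fst d \<and> ?P d \<nu>) \<longleftrightarrow> ?P c \<nu>" for \<nu> using c by blast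
  have pX: "p \<in> topspace X" using in_topspace[OF c] .
  have "\<nu> = (THE \<nu>. \<nu> \<bullet> \<eta> p = 0 \<and> norm \<nu> = 1 \<and> ?P c \<nu>)"
    unfolding \<nu>_def outward_conormal_def iff tangent_space_eq[OF pX] by simp
  moreover have "\<exists>!\<nu>. \<nu> \<bullet> \<eta> p = 0 \<and> norm \<nu> = 1 \<and> ?P c \<nu>"
    by (rule plane_normal_direction[OF norm_normal[OF pX] differential_orthogonal[OF c] differential_orthogonal[OF c]
        differential_independent[OF c]])
  ultimately have "\<nu> \<bullet> \<eta> p = 0 \<and> norm \<nu> = 1 \<and> ?P c \<nu>" using theI'[of "\<lambda>\<nu>. \<nu> \<bullet> \<eta> p = 0 \<and> norm \<nu> = 1 \<and> ?P c \<nu>"] by simp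
  then show "\<nu> \<bullet> \<eta> p = 0" "norm \<nu> = 1" "\<nu> \<bullet> differential c \<phi> p (1,0) = 0" "\<nu> \<bullet> differential c \<phi> p (0,1) < 0"
    by blast+
qed

text \<open>The free boundary condition in the form used below: up to sign, \<open>n\<close> is the outward conormal.\<close>

lemma boundary_normal:
  assumes fb: "free_boundary_in_slab X \<A> \<phi> n a b" and c: "c \<in> \<A>" "q \<in> fst c" and bd: "snd (snd c q) = 0"
  shows "outward_conormal \<A> \<phi> q = slab_normal n a (\<phi> q)" "\<phi> q \<in> plane n a \<union> plane n b"
    "n \<bullet> \<eta> q = 0" "n \<bullet> differential c \<phi> q (1,0) = 0" "n \<bullet> differential c \<phi> q (0,1) \<noteq> 0"
proof -
  have q: "q \<in> surface_boundary \<A>" using c bd by (auto simp: surface_boundary_def)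
  show 1: "outward_conormal \<A> \<phi> q = slab_normal n a (\<phi> q)" and "\<phi> q \<in> plane n a \<union> plane n b"
    using fb q by (auto simp: free_boundary_in_slab_def)
  show "n \<bullet> \<eta> q = 0" "n \<bullet> differential c \<phi> q (1,0) = 0" "n \<bullet> differential c \<phi> q (0,1) \<noteq> 0"
    using outward_conormal_in_chart[OF c bd] unfolding 1 by (auto simp: slab_normal_def split: if_splits)
qed

section \<open>Total umbilicity\<close>

text \<open>The choice of the frame makes the hypotheses of \<open>umbilic_at_max_mean_curvature\<close> true. At an interior point
\<open>e1\<close> and \<open>e2\<close> are principal directions. At a boundary point \<open>e2\<close> is the inward conormal; then \<open>e2\<close> is
tangent to the surface all along the nearby boundary, being \<open>n\<close> or \<open>- n\<close>, which gives \<open>zy = 0\<close> there.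
Choosing \<open>e3 = \<eta> p\<close> makes the signs of the second derivatives positive.\<close>

lemma max_mean_curvature_umbilic:
  assumes fb: "free_boundary_in_slab X \<A> \<phi> n a b"
    and h: "h > 0" and K: "\<And>q. q \<in> topspace X \<Longrightarrow> gauss_curv q = h"
    and P: "P1_positive_definite X \<A> \<phi> \<eta>"
    and p: "p \<in> topspace X" and mx: "\<And>q. q \<in> topspace X \<Longrightarrow> mean_curv q \<le> mean_curv p"
  shows "(mean_curv p)\<^sup>2 = h"
proof -
  obtain c where c: "c \<in> \<A>" "p \<in> fst c" using chart_exists[OF p] by blast
  let ?x = "snd c p"
  have xh: "?x \<in> half_plane" using chart_half_plane[OF c] .
  have Hpos: "q \<in> topspace X \<Longrightarrow> mean_curv q > 0" for q by (rule mean_curvature_positive[OF P])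
  have "\<exists>e1 e2. norm e1 = 1 \<and> norm e2 = 1 \<and> e1 \<bullet> e2 = 0 \<and> e1 \<bullet> \<eta> p = 0 \<and> e2 \<bullet> \<eta> p = 0 \<and>
     (snd ?x \<noteq> 0 \<longrightarrow> shape p e1 \<bullet> e2 = 0) \<and>
     (snd ?x = 0 \<longrightarrow> (e2 = n \<or> e2 = - n) \<and> e2 \<bullet> differential c \<phi> p (0,1) > 0)"
  proof (cases "snd ?x = 0")
    case False
    show ?thesis
    proof (rule principal_basis[OF p], intro exI conjI)
      fix e1 e2
      assume e: "norm e1 = 1" "norm e2 = 1" "e1 \<bullet> e2 = 0" "e1 \<bullet> \<eta> p = 0" "e2 \<bullet> \<eta> p = 0"
        and A: "shape p e1 = kappa1 \<A> \<phi> \<eta> p *\<^sub>R e1"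
      show "norm e1 = 1" "norm e2 = 1" "e1 \<bullet> e2 = 0" "e1 \<bullet> \<eta> p = 0" "e2 \<bullet> \<eta> p = 0" by fact+
      show "snd ?x \<noteq> 0 \<longrightarrow> shape p e1 \<bullet> e2 = 0" using e A by simp
    qed (use False in auto)
  next
    case True
    note oc = outward_conormal_in_chart[OF c True]
    define e2 where "e2 = - outward_conormal \<A> \<phi> p"
    define U where "U = differential c \<phi> p (1,0)"
    have U0: "U \<noteq> 0"
    proof
      assume "U = 0"
      then have "1 *\<^sub>R differential c \<phi> p (1,0) + 0 *\<^sub>R differential c \<phi> p (0,1) = 0" by (simp add: U_def)
      then show False using differential_independent[OF c] by fastforce
    qed
    define e1 where "e1 = U /\<^sub>R norm U"
    have "norm e1 = 1" "e1 \<bullet> e2 = 0" "e1 \<bullet> \<eta> p = 0"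
      using U0 oc(3) differential_orthogonal[OF c] by (auto simp: e1_def e2_def U_def inner_commute)
    moreover have "e2 = n \<or> e2 = - n"
      using boundary_normal(1)[OF fb c True] by (auto simp: e2_def slab_normal_def)
    ultimately show ?thesis using oc True
      by (intro exI[of _ e1] exI[of _ e2]) (auto simp: e2_def)
  qed
  then obtain e1 e2 where e: "norm e1 = 1" "norm e2 = 1" "e1 \<bullet> e2 = 0" "e1 \<bullet> \<eta> p = 0" "e2 \<bullet> \<eta> p = 0"
    and intr: "snd ?x \<noteq> 0 \<Longrightarrow> shape p e1 \<bullet> e2 = 0"
    and bdr: "snd ?x = 0 \<Longrightarrow> (e2 = n \<or> e2 = - n) \<and> e2 \<bullet> differential c \<phi> p (0,1) > 0" by blast
  obtain V G N v w where par: "parametrised c V G N" and xV: "?x \<in> V"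
    and fr: "coordinate_frame V (\<lambda>x. G x \<bullet> e1) (\<lambda>x. G x \<bullet> e2) v w"
    by (rule graph_parametrisation[OF c e])
  let ?e3 = "\<eta> p"
  let ?Z = "\<lambda>x. G x \<bullet> ?e3"
  have G: "smooth_in V G" and eG: "extends c V G \<phi>" using par by (auto simp: parametrised_def extends_def)
  have v: "smooth_field V v" and w: "smooth_field V w" using fr by (auto simp: coordinate_frame_def)
  have e3: "norm ?e3 = 1" "?e3 \<bullet> ?e3 = 1" using norm_normal[OF p] by (simp_all add: norm_eq_1)
  define zx zy where "zx = along v ?Z" and "zy = along w ?Z"
  define zxx zxy zyy where "zxx = along v zx" and "zxy = along v zy" and "zyy = along w zy"
  note zdef = zx_def zy_def zxx_def zxy_def zyy_def
  have szy: "smooth_in V zy" unfolding zy_def by (intro smooth_in_along[OF smooth_in_inner[OF G]] w)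
  define W where "W = (\<lambda>y. 1 + zx y * zx y + zy y * zy y)"
  define M where "M = (\<lambda>y. (1 + zy y * zy y) * zxx y - 2 * (zx y * zy y * zxy y) + (1 + zx y * zx y) * zyy y)"
  note gc = graph_curvature[OF par e(1,2) e3(1) e(3-5) fr]
  have x: "?x \<in> V \<inter> half_plane" using xV xh by simp
  note gx = gc[OF x c(2) refl, folded zdef[THEN fun_cong]]
  have z0: "zx ?x = 0" "zy ?x = 0"
  proof -
    have "dir_deriv u G ?x \<bullet> ?e3 = 0" for u
      using differential_orthogonal[OF c, of u] differential_extension[OF c xV eG] by simp
    then show "zx ?x = 0" "zy ?x = 0"
      by (simp_all add: zx_def zy_def along_def dir_deriv_inner_const[OF G xV])
  qed
  have bv: "snd (v y) = 0 \<and> zy y = 0" if y: "snd ?x = 0" "y \<in> V" "snd y = 0" for y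
  proof -
    have yh: "y \<in> V \<inter> half_plane" using y by (simp add: half_plane_def)
    obtain q where q: "q \<in> fst c" "q \<in> topspace X" "y = snd c q" "differential c \<phi> q = frechet_derivative G (at y)"
      using parametrised_point[OF par yh] by metis
    have bq: "snd (snd c q) = 0" using q y by simp
    note bn = boundary_normal[OF fb c(1) q(1) bq]
    have e2n: "e2 \<bullet> \<eta> q = 0" "e2 \<bullet> dir_deriv (1,0) G y = 0" "e2 \<bullet> dir_deriv (0,1) G y \<noteq> 0"
      using bdr[OF y(1)] bn(3-5) q(4) by auto
    have Y: "dir_deriv u (\<lambda>x. G x \<bullet> e2) y = dir_deriv u G y \<bullet> e2" for u
      by (rule dir_deriv_inner_const[OF G y(2)])
    have "along v (\<lambda>x. G x \<bullet> e2) y = 0" using fr y(2) by (simp add: coordinate_frame_def)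
    then have "snd (v y) * (dir_deriv (0,1) G y \<bullet> e2) = 0"
      using along_components[OF smooth_in_inner[OF G] y(2), of v e2] e2n(2) unfolding Y by (simp add: inner_commute)
    then have "snd (v y) = 0" using e2n(3) by (simp add: inner_commute)
    moreover have "zy y = 0"
    proof -
      have "dir_deriv (w y) G y \<bullet> \<eta> q = 0"
        using differential_orthogonal[OF c(1) q(1), of "w y"] q(4) by simp
      moreover have "dir_deriv (w y) G y = e2 + zy y *\<^sub>R ?e3"
        using gc(2)[OF yh q(1,3)] by (simp add: zy_def)
      ultimately have "zy y * (?e3 \<bullet> \<eta> q) = 0" using e2n(1) by (simp add: inner_add_left)
      moreover have "(\<eta> q \<bullet> ?e3)\<^sup>2 * W y = 1"
        using gc(3)[OF yh q(1,3)] by (simp add: W_def zdef)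
      then have "\<eta> q \<bullet> ?e3 \<noteq> 0" by auto
      ultimately show "zy y = 0" by (simp add: inner_commute)
    qed
    ultimately show ?thesis by simp
  qed
  have zxy0: "zxy ?x = 0"
  proof (cases "snd ?x = 0")
    case False
    have "shape p (e1 + zx ?x *\<^sub>R ?e3) \<bullet> (e2 + zy ?x *\<^sub>R ?e3) = (?e3 \<bullet> ?e3) * zxy ?x"
      using gc(4)[OF x c(2) refl] by (simp add: zdef)
    then show ?thesis using intr[OF False] e3 by (simp add: z0)
  next
    case True
    show ?thesis unfolding zxy_def along_def
      by (rule dir_deriv_zero_on_boundary[OF szy xV True]) (use bv[OF True] xV True in auto)
  qed
  have W1: "W ?x = 1" by (simp add: W_def z0)
  have Kq: "zxx y * zyy y - zxy y * zxy y = h * (W y * W y)"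
    and Mq: "M y * M y \<le> (2 * mean_curv p)\<^sup>2 * (W y * W y * W y)" if y: "y \<in> V \<inter> half_plane" for y
  proof -
    obtain q where q: "q \<in> fst c" "q \<in> topspace X" "y = snd c q" using parametrised_point[OF par y] by metis
    show "zxx y * zyy y - zxy y * zxy y = h * (W y * W y)"
      using gc(5)[OF y q(1,3)] K[OF q(2)] by (simp add: W_def zdef)
    have M: "M y * M y = (2 * mean_curv q)\<^sup>2 * (W y * W y * W y)"
      using gc(7)[OF y q(1,3)] by (simp add: M_def W_def zdef)
    have "0 \<le> W y" by (simp add: W_def)
    moreover have "(2 * mean_curv q)\<^sup>2 \<le> (2 * mean_curv p)\<^sup>2"
      using mx[OF q(2)] Hpos[OF q(2)] by (intro power_mono) auto
    ultimately show "M y * M y \<le> (2 * mean_curv p)\<^sup>2 * (W y * W y * W y)"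
      unfolding M by (intro mult_right_mono) auto
  qed
  have sum: "zxx ?x + zyy ?x = 2 * mean_curv p"
    using gc(6)[OF x c(2) refl] e3 W1 by (simp add: M_def W_def zdef[symmetric] z0)
  have prod: "zxx ?x * zyy ?x = h" using Kq[OF x] by (simp add: W1 zxy0)
  have pos: "zxx ?x > 0" "zyy ?x > 0"
  proof -
    have "zxx ?x * zyy ?x > 0" "zxx ?x + zyy ?x > 0" using prod h sum Hpos[OF p] by simp_all
    then show "zxx ?x > 0" "zyy ?x > 0" by (auto simp: zero_less_mult_iff)
  qed
  have wpos: "snd (w ?x) > 0" if b: "snd ?x = 0"
  proof -
    have Y: "dir_deriv u (\<lambda>x. G x \<bullet> e2) ?x = dir_deriv u G ?x \<bullet> e2" for u
      by (rule dir_deriv_inner_const[OF G xV])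
    have d: "differential c \<phi> p = frechet_derivative G (at ?x)" by (rule differential_extension[OF c xV eG])
    have "dir_deriv (1,0) G ?x \<bullet> e2 = 0" "dir_deriv (0,1) G ?x \<bullet> e2 > 0"
      using bdr[OF b] boundary_normal(4)[OF fb c b] by (auto simp: d inner_commute)
    moreover have "along w (\<lambda>x. G x \<bullet> e2) ?x = 1" using fr xV by (simp add: coordinate_frame_def)
    ultimately have "snd (w ?x) * (dir_deriv (0,1) G ?x \<bullet> e2) = 1"
      using along_components[OF smooth_in_inner[OF G] xV, of w e2] unfolding Y by simp
    then show ?thesis using \<open>dir_deriv (0,1) G ?x \<bullet> e2 > 0\<close> by (metis zero_less_mult_pos2 zero_less_one)
  qed
  have "zxx ?x = zyy ?x"
  proof (rule umbilic_at_max_mean_curvature[OF fr smooth_in_inner[OF G, of ?e3] x, folded zdef, where h=h])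
    show "zx ?x = 0" "zy ?x = 0" "zxy ?x = 0" "zxx ?x > 0" "zyy ?x > 0" by fact+
    show "snd (w ?x) > 0" if "snd ?x = 0" by (rule wpos[OF that])
    show "snd (v y) = 0" "zy y = 0" if "snd ?x = 0" "y \<in> V" "snd y = 0" for y using bv[OF that] by simp_all
    fix y assume y: "y \<in> V \<inter> half_plane"
    show "zxx y * zyy y - zxy y * zxy y = h * ((1 + zx y * zx y + zy y * zy y) * (1 + zx y * zx y + zy y * zy y))"
      using Kq[OF y] by (simp only: W_def)
    show "((1 + zy y * zy y) * zxx y - 2 * (zx y * zy y * zxy y) + (1 + zx y * zx y) * zyy y) *
        ((1 + zy y * zy y) * zxx y - 2 * (zx y * zy y * zxy y) + (1 + zx y * zx y) * zyy y)
      \<le> (zxx ?x + zyy ?x)\<^sup>2 * ((1 + zx y * zx y + zy y * zy y) * (1 + zx y * zx y + zy y * zy y) * (1 + zx y * zx y + zy y * zy y))"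
      using Mq[OF y] by (simp only: W_def M_def sum)
  qed
  then have "(2 * mean_curv p)\<^sup>2 = 4 * h" using sum prod by (simp add: power2_eq_square)
  then show ?thesis by (simp add: power2_eq_square)
qed

text \<open>Everywhere \<open>H1\<^sup>2\<close> is at most its maximal value \<open>h = kappa1 * kappa2\<close>, which forces \<open>kappa1 = kappa2\<close>.\<close>

lemma totally_umbilic:
  assumes comp: "compact_space X" and ne: "topspace X \<noteq> {}"
    and fb: "free_boundary_in_slab X \<A> \<phi> n a b"
    and h: "h > 0" and K: "\<And>q. q \<in> topspace X \<Longrightarrow> gauss_curv q = h"
    and P: "P1_positive_definite X \<A> \<phi> \<eta>"
    and q: "q \<in> topspace X" and Y: "Y \<bullet> \<eta> q = 0"
  shows "shape q Y = sqrt h *\<^sub>R Y"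
proof -
  let ?H = "mean_curv"
  have "compactin euclideanreal (?H ` topspace X)"
    using image_compactin[OF _ continuous_mean_curvature] comp by (simp add: compact_space_def)
  then have "compact (?H ` topspace X)" by simp
  then obtain p where p: "p \<in> topspace X" "\<And>q. q \<in> topspace X \<Longrightarrow> ?H q \<le> ?H p"
    using compact_attains_sup[of "?H ` topspace X"] ne by auto
  have Hp: "(?H p)\<^sup>2 = h" by (rule max_mean_curvature_umbilic[OF fb h K P p])
  have pos: "?H q > 0" by (rule mean_curvature_positive[OF P q])
  define k1 k2 where "k1 = kappa1 \<A> \<phi> \<eta> q" and "k2 = kappa2 \<A> \<phi> \<eta> q"
  have H: "?H q = (k1 + k2) / 2" and kk: "k1 * k2 = h" using K[OF q] by (simp_all add: H1_def H2_def k1_def k2_def)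
  have le: "(?H q)\<^sup>2 \<le> (?H p)\<^sup>2" using p(2)[OF q] pos by (intro power_mono) auto
  have "(k1 - k2)\<^sup>2 = 4 * (?H q)\<^sup>2 - 4 * h"
    unfolding H kk[symmetric] by (simp add: power2_eq_square field_simps)
  then have "(k1 - k2)\<^sup>2 \<le> 0" using le Hp by simp
  then have k: "k1 = k2" by simp
  then have "k1 = sqrt h" using kk pos H by (simp add: real_sqrt_mult_self flip: kk)
  show ?thesis
  proof (rule principal_basis[OF q])
    fix e1 e2
    assume e: "norm e1 = 1" "norm e2 = 1" "e1 \<bullet> e2 = 0" "e1 \<bullet> \<eta> q = 0" "e2 \<bullet> \<eta> q = 0"
      and A: "shape q e1 = kappa1 \<A> \<phi> \<eta> q *\<^sub>R e1" "shape q e2 = kappa2 \<A> \<phi> \<eta> q *\<^sub>R e2"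
    have "Y = (Y \<bullet> e1) *\<^sub>R e1 + (Y \<bullet> e2) *\<^sub>R e2 + (Y \<bullet> \<eta> q) *\<^sub>R \<eta> q"
      by (rule orthonormal_expansion[OF e(1,2) norm_normal[OF q] e(3-5)])
    then obtain s t where Yst: "Y = s *\<^sub>R e1 + t *\<^sub>R e2" using Y by auto
    show ?thesis
      unfolding Yst weingarten_linear[OF q e(4,5)] A k1_def[symmetric] k2_def[symmetric] k[symmetric] \<open>k1 = sqrt h\<close>
      by (simp add: algebra_simps)
  qed
qed

text \<open>The derivative of \<open>\<eta> + k * \<phi>\<close> is zero, so this map is locally constant on the connected surface.\<close>

lemma umbilic_on_sphere:
  assumes conn: "connected_space X" and ne: "topspace X \<noteq> {}" and k: "k > 0"
    and umb: "\<And>q Y. q \<in> topspace X \<Longrightarrow> Y \<bullet> \<eta> q = 0 \<Longrightarrow> shape q Y = k *\<^sub>R Y"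
  obtains q0 where "\<And>p. p \<in> topspace X \<Longrightarrow> \<phi> p = q0 - (1 / k) *\<^sub>R \<eta> p"
proof -
  let ?F = "\<lambda>p. \<eta> p + k *\<^sub>R \<phi> p"
  have loc: "\<exists>U. openin X U \<and> p \<in> U \<and> (\<forall>q\<in>U. ?F q = ?F p)" if p: "p \<in> topspace X" for p
  proof -
    obtain c where c: "c \<in> \<A>" "p \<in> fst c" using chart_exists[OF p] by blast
    obtain V0 G N where par0: "parametrised c V0 G N" "snd c p \<in> V0" using parametrised_exists[OF c] .
    have "open V0" using par0 by (auto simp: parametrised_def extends_def smooth_in_def)
    then obtain r where r: "r > 0" "ball (snd c p) r \<subseteq> V0" using par0(2) openE by blast
    \<comment> \<open>A ball, so that its intersection with the half-plane is convex.\<close>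
    let ?V = "ball (snd c p) r"
    have par: "parametrised c ?V G N" by (rule parametrised_subset[OF par0(1) open_ball r(2)])
    have G: "smooth_in ?V G" and N: "smooth_in ?V N" and eG: "extends c ?V G \<phi>" and eN: "extends c ?V N \<eta>"
      using par by (auto simp: parametrised_def extends_def)
    have "half_plane = {x. 0 \<le> (0, 1) \<bullet> x}" by (auto simp: half_plane_def)
    then have "convex half_plane" by (metis convex_halfspace_ge)
    then have cv: "convex (?V \<inter> half_plane)" by (intro convex_Int convex_ball)
    have "((\<lambda>y. N y + k *\<^sub>R G y) has_derivative (\<lambda>u. 0)) (at y within ?V \<inter> half_plane)"
      if y: "y \<in> ?V \<inter> half_plane" for y
    proof -
      obtain q where q: "q \<in> fst c" "q \<in> topspace X" "differential c \<phi> q = frechet_derivative G (at y)"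
          "differential c \<eta> q = frechet_derivative N (at y)"
        using parametrised_point[OF par y] by metis
      have z: "dir_deriv u N y + k *\<^sub>R dir_deriv u G y = 0" for u
        using umb[OF q(2) differential_orthogonal[OF c(1) q(1)], of u] weingarten_differential[OF c(1) q(1), of u]
        unfolding q(3,4) by (metis add.right_inverse)
      have "y \<in> ?V" using y by blast
      then have "((\<lambda>y. N y + k *\<^sub>R G y) has_derivative (\<lambda>u. dir_deriv u N y + k *\<^sub>R dir_deriv u G y)) (at y)"
        by (intro has_derivative_add has_derivative_scaleR_right smooth_in_has_derivative[OF N] smooth_in_has_derivative[OF G])
      then show ?thesis unfolding z by (rule has_derivative_at_withinI)
    qed
    from has_derivative_zero_constant[OF cv this] obtain z where z: "\<And>y. y \<in> ?V \<inter> half_plane \<Longrightarrow> N y + k *\<^sub>R G y = z"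
      by blast
    let ?U = "{q \<in> fst c. snd c q \<in> ?V}"
    have "?F q = z" if "q \<in> ?U" for q
    proof -
      have "snd c q \<in> ?V \<inter> half_plane" using that chart_half_plane[OF c(1), of q] by blast
      moreover have "N (snd c q) = \<eta> q" "G (snd c q) = \<phi> q" using that eG eN by (auto simp: extends_def)
      ultimately show ?thesis using z by metis
    qed
    moreover have "p \<in> ?U" using c r by simp
    moreover have "openin X ?U" by (rule chart_preimage_open[OF c(1) open_ball])
    ultimately show ?thesis by (intro exI[of _ ?U]) metis
  qed
  obtain p0 where p0: "p0 \<in> topspace X" using ne by blast
  let ?T = "{p \<in> topspace X. ?F p = ?F p0}"
  have "openin X ?T"
  proof (subst openin_subopen, intro ballI)
    fix p assume "p \<in> ?T"
    then have p: "p \<in> topspace X" "?F p = ?F p0" by auto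
    obtain U where U: "openin X U" "p \<in> U" "\<forall>q\<in>U. ?F q = ?F p" using loc[OF p(1)] by blast
    have "U \<subseteq> ?T" using openin_subset[OF U(1)] U(3) unfolding p(2) by blast
    then show "\<exists>U. openin X U \<and> p \<in> U \<and> U \<subseteq> ?T" using U(1,2) by blast
  qed
  moreover have "openin X (topspace X - ?T)"
  proof (subst openin_subopen, intro ballI)
    fix p assume "p \<in> topspace X - ?T"
    then have p: "p \<in> topspace X" "?F p \<noteq> ?F p0" by auto
    obtain U where U: "openin X U" "p \<in> U" "\<forall>q\<in>U. ?F q = ?F p" using loc[OF p(1)] by blast
    have "q \<notin> ?T" if "q \<in> U" for q
    proof
      assume "q \<in> ?T"
      then have "?F q = ?F p0" by blast
      moreover have "?F q = ?F p" using U(3) that by blast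
      ultimately show False using p(2) by argo
    qed
    then have "U \<subseteq> topspace X - ?T" using openin_subset[OF U(1)] by blast
    then show "\<exists>U. openin X U \<and> p \<in> U \<and> U \<subseteq> topspace X - ?T" using U(1,2) by blast
  qed
  then have "closedin X ?T" by (auto simp: closedin_def)
  ultimately have "?T = topspace X"
    using conn p0 unfolding connected_space_clopen_in by blast
  then have F: "?F p = ?F p0" if "p \<in> topspace X" for p using that by blast
  show ?thesis
  proof (rule that[of "(1 / k) *\<^sub>R ?F p0"])
    fix p assume "p \<in> topspace X"
    from F[OF this, symmetric] have "(1 / k) *\<^sub>R ?F p0 = (1 / k) *\<^sub>R ?F p" by (rule arg_cong)
    also have "\<dots> = \<phi> p + (1 / k) *\<^sub>R \<eta> p" using k by (simp add: scaleR_add_right)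
    finally show "\<phi> p = (1 / k) *\<^sub>R ?F p0 - (1 / k) *\<^sub>R \<eta> p" by simp
  qed
qed

section \<open>The image of the surface\<close>

text \<open>The map \<open>\<Psi>(y, r) = q0 + (1 + r) * (G y - q0)\<close> adds the radial direction to the immersion and has an
invertible derivative at \<open>r = 0\<close>, so its image contains a ball. The points of that ball on the sphere
must have \<open>r = 0\<close>.\<close>

lemma spherical_image_open_at_interior:
  assumes R: "R > 0" and sph: "\<And>q. q \<in> topspace X \<Longrightarrow> \<phi> q = q0 - R *\<^sub>R \<eta> q"
    and c: "c \<in> \<A>" "p \<in> fst c" and int: "0 < snd (snd c p)"
  obtains e where "e > 0" "\<And>z. dist q0 z = R \<Longrightarrow> dist z (\<phi> p) < e \<Longrightarrow> z \<in> \<phi> ` topspace X"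
proof -
  obtain V0 G N where par0: "parametrised c V0 G N" "snd c p \<in> V0" using parametrised_exists[OF c] .
  let ?x = "snd c p"
  define V where "V = V0 \<inter> {y. 0 < snd y}"
  have "open V0" using par0 by (auto simp: parametrised_def extends_def smooth_in_def)
  moreover have "open {y::real\<times>real. 0 < snd y}" by (intro open_Collect_less continuous_intros)
  ultimately have oV: "open V" unfolding V_def by blast
  have par: "parametrised c V G N" by (rule parametrised_subset[OF par0(1) oV]) (auto simp: V_def)
  have xV: "?x \<in> V" using par0 int by (simp add: V_def)
  have G: "smooth_in V G" and eG: "extends c V G \<phi>" using par by (auto simp: parametrised_def extends_def)
  have pX: "p \<in> topspace X" using in_topspace[OF c] .
  have Gx: "G ?x = \<phi> p" using eG c xV by (simp add: extends_def)
  have d: "differential c \<phi> p = frechet_derivative G (at ?x)" by (rule differential_extension[OF c xV eG])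
  let ?\<Psi> = "\<lambda>w :: (real \<times> real) \<times> real. q0 + (1 + snd w) *\<^sub>R (G (fst w) - q0)"
  let ?D = "\<lambda>w :: (real \<times> real) \<times> real. dir_deriv (fst w) G ?x + snd w *\<^sub>R (\<phi> p - q0)"
  let ?S = "V \<times> (UNIV :: real set)"
  have cont: "continuous_on ?S ?\<Psi>"
  proof -
    have "continuous_on ?S (G \<circ> fst)"
      by (rule continuous_on_compose) (auto intro!: continuous_intros smooth_in_continuous_on[OF G])
    then show ?thesis unfolding o_def by (intro continuous_intros)
  qed
  have der: "(?\<Psi> has_derivative ?D) (at (?x, 0))"
  proof -
    have "(G has_derivative frechet_derivative G (at ?x)) (at (fst (?x, 0::real)))"
      using smooth_in_has_derivative[OF G xV] by simp
    then have "((\<lambda>w. G (fst w)) has_derivative (\<lambda>w. dir_deriv (fst w) G ?x)) (at (?x, 0::real))"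
      by (rule has_derivative_compose[OF has_derivative_fst[OF has_derivative_ident]])
    then show ?thesis by (auto intro!: derivative_eq_intros simp: Gx)
  qed
  have lin: "linear ?D" using der has_derivative_linear by blast
  have "surj ?D"
  proof -
    have "\<exists>w. Y = ?D w" for Y
    proof -
      let ?n = "\<eta> p"
      have nn: "?n \<bullet> ?n = 1" using norm_normal[OF pX] by (simp add: norm_eq_1)
      have "(Y - (Y \<bullet> ?n) *\<^sub>R ?n) \<bullet> ?n = 0" by (simp add: inner_diff_left nn)
      then obtain u where "Y - (Y \<bullet> ?n) *\<^sub>R ?n = differential c \<phi> p u" using tangent_vector_differential[OF c] by blast
      then have "Y = dir_deriv u G ?x + (Y \<bullet> ?n) *\<^sub>R ?n" by (simp add: d diff_eq_eq)
      also have "\<dots> = ?D (u, - (Y \<bullet> ?n) / R)" using R sph[OF pX] by simp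
      finally show ?thesis by blast
    qed
    then show ?thesis unfolding surj_def by (rule allI)
  qed
  then obtain g where g: "linear g" "?D \<circ> g = id" using linear_surjective_right_inverse[OF lin] by blast
  let ?T = "V \<times> {-1<..<1::real}"
  have oT: "open ?T" using oV by (intro open_Times) auto
  have "?\<Psi> (?x, 0) \<in> interior (?\<Psi> ` ?T)"
  proof (rule sussmann_open_mapping[OF _ cont _ der _ g(2)])
    show "open ?S" using oV by (intro open_Times) auto
    show "bounded_linear g" using g(1) by (simp add: linear_conv_bounded_linear)
    show "(?x, 0) \<in> interior ?T" using oT xV by (simp add: interior_open)
  qed (use xV in auto)
  then obtain e where e: "e > 0" "ball (\<phi> p) e \<subseteq> ?\<Psi> ` ?T"
    by (auto simp: mem_interior Gx)
  show ?thesis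
  proof (rule that[OF e(1)])
    fix z assume z: "dist q0 z = R" "dist z (\<phi> p) < e"
    then have "z \<in> ?\<Psi> ` ?T" using e(2) by (auto simp: dist_commute)
    then obtain y r where y: "y \<in> V" "-1 < r" "z = q0 + (1 + r) *\<^sub>R (G y - q0)" by auto
    have "y \<in> V \<inter> half_plane" using y by (auto simp: V_def half_plane_def)
    then obtain q where q: "q \<in> topspace X" "G y = \<phi> q" using parametrised_point[OF par] by metis
    have "norm (G y - q0) = R" using sph[OF q(1)] norm_normal[OF q(1)] R q(2) by simp
    moreover have "norm (z - q0) = R" using z by (simp add: dist_norm norm_minus_commute)
    ultimately have "\<bar>1 + r\<bar> * R = R" using y(3) by simp
    then have "\<bar>1 + r\<bar> = 1" using R by simp
    then have "r = 0" using y(2) by linarith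
    then show "z \<in> \<phi> ` topspace X" using y(3) q by simp
  qed
qed

text \<open>Inside a connected subset of the sphere that contains no image of a boundary point, the image of the
surface is open by \<open>spherical_image_open_at_interior\<close> and closed by compactness. Without boundary
this applies to the whole sphere. Otherwise \<open>\<phi> - q0\<close>, a multiple of \<open>\<eta>\<close>, is orthogonal to \<open>n\<close> along the
boundary. The centre therefore lies in the plane of any boundary point, the slab confines the image to a
closed hemisphere with pole \<open>m\<close>, and the argument applies to the open one.\<close>

lemma spherical_image:
  assumes R: "R > 0" and sph: "\<And>q. q \<in> topspace X \<Longrightarrow> \<phi> q = q0 - R *\<^sub>R \<eta> q"
    and comp: "compact_space X" and ne: "topspace X \<noteq> {}"
    and n1: "norm n = 1" and fb: "free_boundary_in_slab X \<A> \<phi> n a b"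
  shows "surface_of_revolution q0 n (\<phi> ` topspace X)"
proof -
  let ?I = "\<phi> ` topspace X"
  have dI: "dist q0 z = R" if "z \<in> ?I" for z
    using that sph norm_normal R by (auto simp: dist_norm)
  have "continuous_map X euclidean \<phi>"
  proof (rule continuous_map_chartwise)
    fix p assume "p \<in> topspace X"
    then obtain c where c: "c \<in> \<A>" "p \<in> fst c" using chart_exists by blast
    obtain V G where G: "extends c V G \<phi>" "snd c p \<in> V" using local_extension[OF c smooth_immersion] .
    have sm: "smooth_in V G" and eq: "\<forall>q\<in>fst c. snd c q \<in> V \<longrightarrow> \<phi> q = G (snd c q)"
      using G(1) by (simp_all add: extends_def)
    show "\<exists>c\<in>\<A>. \<exists>V g. p \<in> fst c \<and> snd c p \<in> V \<and> open V \<and> continuous_on V g \<and>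
        (\<forall>q\<in>fst c. snd c q \<in> V \<longrightarrow> \<phi> q = g (snd c q))"
      using c G(2) eq smooth_in_open[OF sm] smooth_in_continuous_on[OF sm] by blast
  qed
  then have "compactin euclidean ?I"
    using image_compactin[OF _ _, of X "topspace X" euclidean \<phi>] comp by (simp add: compact_space_def)
  then have cl: "closed ?I" by (simp add: compact_imp_closed)
  have int: "\<exists>e>0. \<forall>z. dist q0 z = R \<and> dist z (\<phi> p) < e \<longrightarrow> z \<in> ?I"
    if "c \<in> \<A>" "p \<in> fst c" "0 < snd (snd c p)" for c p
    using spherical_image_open_at_interior[OF R sph that] by metis
  have clopen: "S \<subseteq> ?I" if S: "connected S" "S \<subseteq> {x. dist q0 x = R}" "S \<inter> ?I \<noteq> {}"
    and ip: "\<And>p. p \<in> topspace X \<Longrightarrow> \<phi> p \<in> S \<Longrightarrow> p \<notin> surface_boundary \<A>" for S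
  proof -
    have "openin (top_of_set S) (S \<inter> ?I)"
      unfolding openin_euclidean_subtopology_iff
    proof (intro conjI ballI)
      fix z assume "z \<in> S \<inter> ?I"
      then obtain p where p: "p \<in> topspace X" "z = \<phi> p" "z \<in> S" by blast
      obtain c where c: "c \<in> \<A>" "p \<in> fst c" using chart_exists[OF p(1)] by blast
      have "p \<notin> surface_boundary \<A>" using ip p by blast
      then have "snd (snd c p) \<noteq> 0" using c by (auto simp: surface_boundary_def)
      then have "0 < snd (snd c p)" using chart_half_plane[OF c] by (simp add: half_plane_def)
      from int[OF c this] obtain e where "e > 0" "\<And>z. dist q0 z = R \<Longrightarrow> dist z (\<phi> p) < e \<Longrightarrow> z \<in> ?I" by blast
      then show "\<exists>e>0. \<forall>x'\<in>S. dist x' z < e \<longrightarrow> x' \<in> S \<inter> ?I"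
        using S(2) p by (intro exI[of _ e]) blast
    qed auto
    moreover have "closedin (top_of_set S) (S \<inter> ?I)" using cl by (simp add: closedin_closed_Int)
    ultimately show ?thesis using S(1,3) unfolding connected_clopen by blast
  qed
  show ?thesis
  proof (cases "surface_boundary \<A> = {}")
    case True
    have "connected {x. dist q0 x = R}"
      using connected_sphere[of q0 R] by (simp add: sphere_def)
    moreover have "{x. dist q0 x = R} \<inter> ?I \<noteq> {}" using dI ne by blast
    ultimately have "{x. dist q0 x = R} \<subseteq> ?I" using True by (intro clopen) auto
    then have I: "?I = {x. dist q0 x = R}" using dI by blast
    have "- R \<le> n \<bullet> (x - q0) \<and> n \<bullet> (x - q0) \<le> R" if "dist q0 x = R" for x
      using Cauchy_Schwarz_ineq2[of n "x - q0"] n1 that by (simp add: dist_norm norm_minus_commute abs_le_iff)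
    then have "?I = {x. dist q0 x = R \<and> R * sin (- (pi/2)) \<le> n \<bullet> (x - q0) \<and> n \<bullet> (x - q0) \<le> R * sin (pi/2)}"
      unfolding I sin_minus sin_pi_half sin_zero mult_1_right mult_minus_right mult_zero_right by blast
    then show ?thesis using surface_of_revolution_spherical_zone[OF n1 R, of "- (pi/2)" "pi/2" q0] pi_gt_zero by simp
  next
    case False
    have bdc: "n \<bullet> (\<phi> p - q0) = 0" if pb: "p \<in> surface_boundary \<A>" for p
    proof -
      obtain c where c: "c \<in> \<A>" "p \<in> fst c" "snd (snd c p) = 0"
        using pb unfolding surface_boundary_def by blast
      show ?thesis using boundary_normal(3)[OF fb c] sph[OF in_topspace[OF c(1,2)]] by simp
    qed
    obtain p0 where p0: "p0 \<in> surface_boundary \<A>" using False by blast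
    then obtain c where c: "c \<in> \<A>" "p0 \<in> fst c" "snd (snd c p0) = 0"
      unfolding surface_boundary_def by blast
    have slab: "a \<le> n \<bullet> z \<and> n \<bullet> z \<le> b" if "z \<in> ?I" for z
      using fb that by (auto simp: free_boundary_in_slab_def slab_def)
    have "n \<bullet> \<phi> p0 = a \<or> n \<bullet> \<phi> p0 = b" using boundary_normal(2)[OF fb c] by (auto simp: plane_def)
    then have s: "n \<bullet> q0 = a \<or> n \<bullet> q0 = b" using bdc[OF p0] by (simp add: inner_diff_right)
    define m where "m = (if n \<bullet> q0 = a then n else - n)"
    have m1: "norm m = 1" using n1 by (simp add: m_def)
    have side: "0 \<le> m \<bullet> (z - q0)" if "z \<in> ?I" for z
      using slab[OF that] s by (auto simp: m_def inner_diff_right)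
    let ?O = "{x. dist q0 x = R \<and> 0 < m \<bullet> (x - q0)}"
    \<comment> \<open>Otherwise the image would lie in the plane of the boundary, but the surface meets it orthogonally.\<close>
    have "?O \<inter> ?I \<noteq> {}"
    proof
      assume E: "?O \<inter> ?I = {}"
      have Z: "n \<bullet> (z - q0) = 0" if "z \<in> ?I" for z
      proof -
        have "\<not> 0 < m \<bullet> (z - q0)" using E dI[OF that] that by blast
        then have "m \<bullet> (z - q0) = 0" using side[OF that] by linarith
        then show ?thesis by (auto simp: m_def split: if_splits)
      qed
      obtain V G N where par: "parametrised c V G N" "snd c p0 \<in> V" using parametrised_exists[OF c(1,2)] .
      have G: "smooth_in V G" and eG: "extends c V G \<phi>" using par by (auto simp: parametrised_def extends_def)
      have x: "snd c p0 \<in> V \<inter> half_plane" using par chart_half_plane[OF c(1,2)] by simp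
      have sm: "smooth_in V (\<lambda>y. G y \<bullet> n)" by (rule smooth_in_inner[OF G])
      have "dir_deriv (0,1) (\<lambda>y. G y \<bullet> n - q0 \<bullet> n) (snd c p0) = 0"
      proof (rule dir_deriv_zero_on_half_plane[OF _ x])
        show "smooth_in V (\<lambda>y. G y \<bullet> n - q0 \<bullet> n)"
          by (intro smooth_in_diff sm smooth_in_const smooth_in_open[OF G])
        fix y assume "y \<in> V \<inter> half_plane"
        then obtain q where "q \<in> topspace X" "G y = \<phi> q" using parametrised_point[OF par(1)] by metis
        then show "G y \<bullet> n - q0 \<bullet> n = 0" using Z[of "\<phi> q"] by (simp add: inner_diff_right inner_commute)
      qed
      moreover have "along (\<lambda>y. (0,1)) (\<lambda>y. G y \<bullet> n - q0 \<bullet> n) (snd c p0) = dir_deriv (0,1) G (snd c p0) \<bullet> n - 0"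
        using along_diff[OF sm smooth_in_const[OF smooth_in_open[OF G], of "q0 \<bullet> n"] par(2), of "\<lambda>y. (0,1)"]
        by (simp add: along_const) (simp add: along_def dir_deriv_inner_const[OF G par(2)])
      ultimately have "dir_deriv (0,1) G (snd c p0) \<bullet> n = 0" by (simp add: along_def)
      then have "n \<bullet> differential c \<phi> p0 (0,1) = 0"
        using differential_extension[OF c(1,2) par(2) eG] by (simp add: inner_commute)
      then show False using boundary_normal(5)[OF fb c] by simp
    qed
    moreover have "p \<notin> surface_boundary \<A>" if "\<phi> p \<in> ?O" for p
      using that bdc[of p] by (auto simp: m_def split: if_splits)
    ultimately have "?O \<subseteq> ?I" by (intro clopen connected_open_hemisphere[OF R]) auto
    from closed_hemisphere_subset_closure[OF R m1 cl this]
    have I: "?I = {x. dist q0 x = R \<and> 0 \<le> m \<bullet> (x - q0)}" using dI side by blast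
    have ab: "- R \<le> n \<bullet> (x - q0) \<and> n \<bullet> (x - q0) \<le> R" if "dist q0 x = R" for x
      using Cauchy_Schwarz_ineq2[of n "x - q0"] n1 that by (simp add: dist_norm norm_minus_commute abs_le_iff)
    show ?thesis
    proof (cases "n \<bullet> q0 = a")
      case True
      then have m: "m = n" by (simp add: m_def)
      have "?I = {x. dist q0 x = R \<and> R * sin 0 \<le> n \<bullet> (x - q0) \<and> n \<bullet> (x - q0) \<le> R * sin (pi/2)}"
        unfolding I m sin_minus sin_pi_half sin_zero mult_1_right mult_minus_right mult_zero_right using ab by blast
      then show ?thesis using surface_of_revolution_spherical_zone[OF n1 R, of 0 "pi/2" q0] pi_gt_zero by simp
    next
      case False
      then have m: "m = - n" by (simp add: m_def)
      have "?I = {x. dist q0 x = R \<and> R * sin (- (pi/2)) \<le> n \<bullet> (x - q0) \<and> n \<bullet> (x - q0) \<le> R * sin 0}"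
        unfolding I m inner_minus_left neg_0_le_iff_le sin_minus sin_pi_half sin_zero mult_1_right mult_minus_right mult_zero_right using ab by blast
      then show ?thesis using surface_of_revolution_spherical_zone[OF n1 R, of "- (pi/2)" 0 q0] pi_gt_zero by simp
    qed
  qed
qed

end

theorem theorem1p3:
  fixes X :: "'a topology" and \<A> :: "'a chart set"
    and \<phi> \<eta> :: "'a \<Rightarrow> real^3"
    and n :: "real^3" and a b :: real
  assumes "norm n = 1" and "a < b"
    and "compact_connected_surface X \<A>"
    and "surface_genus X \<A> = 0"
    and "immersion \<A> \<phi>"
    and "unit_normal_field X \<A> \<phi> \<eta>"
    and "free_boundary_in_slab X \<A> \<phi> n a b"
    and "\<exists>h>0. \<forall>p\<in>topspace X. H2 \<A> \<phi> \<eta> p = h"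
    and "P1_positive_definite X \<A> \<phi> \<eta>"
    and "one_stable X \<A> \<phi> \<eta>"
  shows "\<exists>q. surface_of_revolution q n (\<phi> ` topspace X)"
proof -
  have X: "topspace X \<noteq> {}" "compact_space X" "connected_space X" "smooth_atlas X \<A>"
    using assms(3) by (auto simp: compact_connected_surface_def)
  interpret immersed_surface X \<A> \<phi> \<eta>
    using X(4) assms(5,6) by unfold_locales
  obtain h where h: "h > 0" "\<And>p. p \<in> topspace X \<Longrightarrow> H2 \<A> \<phi> \<eta> p = h" using assms(8) by blast
  have "sqrt h > 0" using h by simp
  from umbilic_on_sphere[OF X(3,1) this totally_umbilic[OF X(2,1) assms(7) h assms(9)]]
  obtain q0 where "\<And>p. p \<in> topspace X \<Longrightarrow> \<phi> p = q0 - (1 / sqrt h) *\<^sub>R \<eta> p" by blast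
  then have "surface_of_revolution q0 n (\<phi> ` topspace X)"
    using h(1) by (intro spherical_image[OF _ _ X(2,1) assms(1,7), of "1 / sqrt h"]) auto
  then show ?thesis by blast
qed

end
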